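(* Let $A=[D,c_1\boldsymbol n,\dots,c_k\boldsymbol n]\in\mathbb Z^{\ell\times(\ell+k)}$ be a Type II$_k$ weight matrix such that $V_A$ is a faithful $\mathbb T^\ell$-module. Then the symplectic quotient $M_0(A)$ is graded regularly symplectomorphic to the $\mathbb T^1$-symplectic quotient $M_0(B)$, where $B=\big(-\alpha(A),\,c_1\beta(A),\dots,c_k\beta(A)\big)\in\mathbb Z^{1\times(k+1)}$.
   Context: For an integer weight matrix $A=(a_{ij})\in\mathbb Z^{\ell\times n}$ with columns $\boldsymbol a_j$, $V_A=\mathbb C^n$ (coordinates $z_j$, standard hermitian product, symplectic form $\operatorname{Im}\langle\cdot,\cdot\rangle$) carries the $\mathbb T^\ell$-action $\boldsymbol t\cdot\boldsymbol z=(\boldsymbol t^{\boldsymbol a_1}z_1,\dots,\boldsymbol t^{\boldsymbol a_n}z_n)$, $\boldsymbol t^{\boldsymbol a_j}=\prod_i t_i^{a_{ij}}$; faithful means effective. Moment map $J_A=(J_1,\dots,J_\ell)$, $J_i=\tfrac12\sum_j a_{ij}z_j\overline{z_j}$; shell $Z_A=J_A^{-1}(0)$; $M_0(A)=Z_A/\mathbb T^\ell$. With $G=\mathbb T^\ell$: $\mathcal C^\infty(M_0(A))=\mathcal C^\infty(V_A)^G/\mathcal I_{Z_A}^G$ ($\mathcal I_{Z_A}$ = smooth functions vanishing on $Z_A$), Poisson via $\{z_i,\overline{z_j}\}=-2\sqrt{-1}\delta_{ij}$, $\{z_i,z_j\}=\{\overline{z_i},\overline{z_j}\}=0$; $\mathbb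 R[M_0(A)]=\mathbb R[V_A]^G/(\mathcal I_{Z_A}\cap\mathbb R[V_A]^G)$, graded by degree. A symplectomorphism $F:M_0\to M_0'$ is a homeomorphism with $F^*:\mathcal C^\infty(M_0')\to\mathcal C^\infty(M_0)$ a Poisson isomorphism; graded regular if $F^*$ restricts to a degree-preserving isomorphism $\mathbb R[M_0']\to\mathbb R[M_0]$. Type II$_k$: $A=[D,c_1\boldsymbol n,\dots,c_k\boldsymbol n]$ with $D=\operatorname{diag}(-a_1,\dots,-a_\ell)$, $a_i>0$, $\boldsymbol n=(n_1,\dots,n_\ell)^T$, $n_i>0$, integers $c_r\ge1$. $\alpha(A)=\operatorname{lcm}(a_1,\dots,a_\ell)$, $m_i(A)=n_i\alpha(A)/a_i$, $\beta(A)=\sum_i m_i(A)$. *)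

theory Defs
  imports "HOL-Analysis.Analysis"
begin

definition quotient_topology :: "'a topology \<Rightarrow> ('a \<Rightarrow> 'b) \<Rightarrow> 'b topology" where
  "quotient_topology X p =
     topology (\<lambda>U. U \<subseteq> p ` topspace X \<and> openin X {x \<in> topspace X. p x \<in> U})"

lemma istopology_quotient:
  "istopology (\<lambda>U. U \<subseteq> p ` topspace X \<and> openin X {x \<in> topspace X. p x \<in> U})"
proof -
  have 1: "openin X {x \<in> topspace X. p x \<in> S \<inter> T}"
    if "openin X {x \<in> topspace X. p x \<in> S}" "openin X {x \<in> topspace X. p x \<in> T}" for S T
  proof -
    have "{x \<in> topspace X. p x \<in> S \<inter> T} =
          {x \<in> topspace X. p x \<in> S} \<inter> {x \<in> topspace X. p x \<in> T}" by auto
    then show ?thesis using that by auto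
  qed
  have 2: "openin X {x \<in> topspace X. p x \<in> \<Union>K}"
    if "\<forall>S\<in>K. openin X {x \<in> topspace X. p x \<in> S}" for K
  proof -
    have "{x \<in> topspace X. p x \<in> \<Union>K} = (\<Union>S\<in>K. {x \<in> topspace X. p x \<in> S})" by auto
    then show ?thesis using that by auto
  qed
  show ?thesis unfolding istopology_def using 1 2 by blast
qed

text \<open>A weight matrix with rows indexed by the finite type 'i (the torus factors)
  and columns indexed by the finite type 'j (the coordinates of V_A = C^n).\<close>

type_synonym ('i, 'j) wmatrix = "'i \<Rightarrow> 'j \<Rightarrow> int"

definition torus :: "(complex ^ 'i) set" where
  "torus = {t. \<forall>i. cmod (t $ i) = 1}"

definition act :: "('i::finite, 'j::finite) wmatrix \<Rightarrow> complex ^ 'i \<Rightarrow> complex ^ 'j \<Rightarrow> complex ^ 'j" where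
  "act A t z = (\<chi> j. (\<Prod>i\<in>UNIV. (t $ i) powi (A i j)) * z $ j)"

definition faithful :: "('i::finite, 'j::finite) wmatrix \<Rightarrow> bool" where
  "faithful A \<longleftrightarrow> (\<forall>t \<in> torus. (\<forall>z. act A t z = z) \<longrightarrow> t = (\<chi> i. 1))"

definition moment_map :: "('i::finite, 'j::finite) wmatrix \<Rightarrow> complex ^ 'j \<Rightarrow> real ^ 'i" where
  "moment_map A z = (\<chi> i. (1/2) * (\<Sum>j\<in>UNIV. real_of_int (A i j) * (cmod (z $ j))\<^sup>2))"

definition shell :: "('i::finite, 'j::finite) wmatrix \<Rightarrow> (complex ^ 'j) set" where
  "shell A = {z. moment_map A z = 0}"

definition orbit :: "('i::finite, 'j::finite) wmatrix \<Rightarrow> complex ^ 'j \<Rightarrow> (complex ^ 'j) set" where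
  "orbit A z = {act A t z | t. t \<in> torus}"

definition M0 :: "('i::finite, 'j::finite) wmatrix \<Rightarrow> (complex ^ 'j) set set" where
  "M0 A = orbit A ` shell A"

definition M0_top :: "('i::finite, 'j::finite) wmatrix \<Rightarrow> (complex ^ 'j) set topology" where
  "M0_top A = quotient_topology (subtopology euclidean (shell A)) (orbit A)"

definition invariant :: "('i::finite, 'j::finite) wmatrix \<Rightarrow> (complex ^ 'j \<Rightarrow> real) \<Rightarrow> bool" where
  "invariant A f \<longleftrightarrow> (\<forall>t \<in> torus. \<forall>z. f (act A t z) = f z)"

fun Ck :: "nat \<Rightarrow> ('a::real_normed_vector \<Rightarrow> real) \<Rightarrow> bool" where
  "Ck 0 f = continuous_on UNIV f"
| "Ck (Suc k) f = ((\<forall>x. f differentiable (at x)) \<and>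
                    (\<forall>v. Ck k (\<lambda>x. frechet_derivative f (at x) v)))"

definition smooth :: "('a::real_normed_vector \<Rightarrow> real) \<Rightarrow> bool" where
  "smooth f \<longleftrightarrow> (\<forall>k. Ck k f)"

text \<open>Poisson bracket on C^n with {z_i, conj z_j} = -2 sqrt(-1) delta_ij; in real
  coordinates z_j = x_j + sqrt(-1) y_j this is
  {f,g} = sum_j (df/dx_j dg/dy_j - df/dy_j dg/dx_j).\<close>

definition poisson :: "(complex ^ 'j::finite \<Rightarrow> real) \<Rightarrow> (complex ^ 'j \<Rightarrow> real) \<Rightarrow> complex ^ 'j \<Rightarrow> real" where
  "poisson f g z = (\<Sum>j\<in>UNIV.
      frechet_derivative f (at z) (axis j 1) * frechet_derivative g (at z) (axis j \<i>)
    - frechet_derivative f (at z) (axis j \<i>) * frechet_derivative g (at z) (axis j 1))"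

definition hom_poly :: "nat \<Rightarrow> (complex ^ 'j::finite \<Rightarrow> real) \<Rightarrow> bool" where
  "hom_poly d f \<longleftrightarrow> (\<exists>c :: ('j \<Rightarrow> nat) \<times> ('j \<Rightarrow> nat) \<Rightarrow> real.
      \<forall>z. f z = (\<Sum>(a, b) \<in> {(a, b). sum a UNIV + sum b UNIV = d}.
                  c (a, b) * (\<Prod>j\<in>UNIV. Re (z $ j) ^ a j * Im (z $ j) ^ b j)))"

text \<open>A smooth function on M_0(A) is the class of a smooth invariant function on V_A
  modulo functions vanishing on the shell.  For F : M_0(A) \<rightarrow> M_0(B), the relation
  pb_rel A B F f g says that the class of f equals the pullback F^* of the class of g.\<close>

definition pb_rel :: "('i::finite, 'j::finite) wmatrix \<Rightarrow> ('i2::finite, 'j2::finite) wmatrix \<Rightarrow>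
    ((complex ^ 'j) set \<Rightarrow> (complex ^ 'j2) set) \<Rightarrow>
    (complex ^ 'j \<Rightarrow> real) \<Rightarrow> (complex ^ 'j2 \<Rightarrow> real) \<Rightarrow> bool" where
  "pb_rel A B F f g \<longleftrightarrow> (\<forall>z \<in> shell A. \<forall>w \<in> F (orbit A z). f z = g w)"

definition symplectomorphism :: "('i::finite, 'j::finite) wmatrix \<Rightarrow> ('i2::finite, 'j2::finite) wmatrix \<Rightarrow>
    ((complex ^ 'j) set \<Rightarrow> (complex ^ 'j2) set) \<Rightarrow> bool" where
  "symplectomorphism A B F \<longleftrightarrow>
     homeomorphic_map (M0_top A) (M0_top B) F \<and>
     \<comment> \<open>F^* maps C^\<infinity>(M_0(B)) into C^\<infinity>(M_0(A))\<close>
     (\<forall>g. smooth g \<and> invariant B g \<longrightarrow> (\<exists>f. smooth f \<and> invariant A f \<and> pb_rel A B F f g)) \<and>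
     \<comment> \<open>F^* is onto C^\<infinity>(M_0(A))\<close>
     (\<forall>f. smooth f \<and> invariant A f \<longrightarrow> (\<exists>g. smooth g \<and> invariant B g \<and> pb_rel A B F f g)) \<and>
     \<comment> \<open>F^* preserves Poisson brackets\<close>
     (\<forall>f1 f2 g1 g2. smooth f1 \<and> invariant A f1 \<and> smooth f2 \<and> invariant A f2 \<and>
        smooth g1 \<and> invariant B g1 \<and> smooth g2 \<and> invariant B g2 \<and>
        pb_rel A B F f1 g1 \<and> pb_rel A B F f2 g2 \<longrightarrow>
        pb_rel A B F (poisson f1 f2) (poisson g1 g2))"

definition graded_regular_symplectomorphism ::
    "('i::finite, 'j::finite) wmatrix \<Rightarrow> ('i2::finite, 'j2::finite) wmatrix \<Rightarrow>
    ((complex ^ 'j) set \<Rightarrow> (complex ^ 'j2) set) \<Rightarrow> bool" where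
  "graded_regular_symplectomorphism A B F \<longleftrightarrow>
     symplectomorphism A B F \<and>
     (\<forall>d. (\<forall>g. hom_poly d g \<and> invariant B g \<longrightarrow> (\<exists>f. hom_poly d f \<and> invariant A f \<and> pb_rel A B F f g)) \<and>
          (\<forall>f. hom_poly d f \<and> invariant A f \<longrightarrow> (\<exists>g. hom_poly d g \<and> invariant B g \<and> pb_rel A B F f g)))"

definition typeII :: "('l::finite \<Rightarrow> int) \<Rightarrow> ('l \<Rightarrow> int) \<Rightarrow> ('k::finite \<Rightarrow> int) \<Rightarrow> ('l, 'l + 'k) wmatrix" where
  "typeII a n c = (\<lambda>i j. case j of Inl i' \<Rightarrow> (if i = i' then - a i else 0)
                                | Inr r \<Rightarrow> c r * n i)"

definition alpha :: "('l::finite \<Rightarrow> int) \<Rightarrow> int" where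
  "alpha a = Lcm (range a)"

definition mII :: "('l::finite \<Rightarrow> int) \<Rightarrow> ('l \<Rightarrow> int) \<Rightarrow> 'l \<Rightarrow> int" where
  "mII a n i = n i * alpha a div a i"

definition beta :: "('l::finite \<Rightarrow> int) \<Rightarrow> ('l \<Rightarrow> int) \<Rightarrow> int" where
  "beta a n = (\<Sum>i\<in>UNIV. mII a n i)"

definition Bmat :: "('l::finite \<Rightarrow> int) \<Rightarrow> ('l \<Rightarrow> int) \<Rightarrow> ('k::finite \<Rightarrow> int) \<Rightarrow> (unit, unit + 'k) wmatrix" where
  "Bmat a n c = (\<lambda>_ j. case j of Inl _ \<Rightarrow> - alpha a | Inr r \<Rightarrow> c r * beta a n)"

end

theory Submission
  imports Defs
begin

text \<open>
  With coordinates \<open>(w\<^sub>1, \<dots>, w\<^sub>l, u)\<close> on \<open>V\<^sub>A\<close> and \<open>(w, u)\<close> on \<open>V\<^sub>B\<close>, the linear isometry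
  \<open>(w, u) \<mapsto> (sqrt (m\<^sub>1 / \<beta>) w, \<dots>, sqrt (m\<^sub>l / \<beta>) w, u)\<close> is equivariant along \<open>s \<mapsto> (s\<^bsup>\<alpha> / a\<^sub>i\<^esup>)\<^sub>i\<close>,
  and the preimage of the shell \<open>Z\<^sub>A\<close> is \<open>Z\<^sub>B\<close>.  Faithfulness makes the \<open>a\<^sub>i\<close> pairwise coprime and coprime to \<open>n\<^sub>i\<close>, hence
  \<open>\<alpha>\<close> and \<open>\<beta>\<close> coprime, and then the isometry induces a bijection of the quotients; it is a closed map
  because tori are compact.  The symplectomorphism is its inverse, so surjectivity of the pullback is
  composition with a linear map, and only the lifting of invariant functions from \<open>V\<^sub>B\<close> to \<open>V\<^sub>A\<close> needs work.

  Invariant monomials are lifted by \<open>\<bar>w\<bar>\<^sup>2 \<mapsto> \<Sum>\<^sub>i \<bar>w\<^sub>i\<bar>\<^sup>2\<close> and \<open>w\<^sup>\<beta> \<mapsto> const \<cdot> \<Prod>\<^sub>i w\<^sub>i\<^bsup>m\<^sub>i\<^esup>\<close>.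
  For a smooth invariant function the homogeneous Taylor polynomials at the origin are lifted and summed with
  Borel's lemma.  The remaining function \<open>h\<close> is flat at the origin, the only singular point of the
  shell; it is lifted to \<open>h (r y\<^bsup>1 / \<beta>\<^esup>, u)\<close>, where \<open>r\<close> is homogeneous of degree one and
  \<open>y\<close> is the phase of \<open>\<Prod>\<^sub>i w\<^sub>i\<^bsup>m\<^sub>i\<^esup>\<close>, cut off by a function of degree zero to a neighbourhood of \<open>Z\<^sub>A\<close>.
  Invariance removes the ambiguity of the root, and flatness absorbs the negative powers
  of \<open>\<bar>z\<bar>\<close> produced by differentiating the homogeneous factors.
\<close>

section \<open>Smooth functions on open sets\<close>

text \<open>The factors of the isometry come from the shell equations, which make the squared moduli
  of the w_i proportional to n_i / a_i, hence to m_i; dividing by the sum beta makes the squares of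
  the factors add up to one.

  Coprimality enters as follows. A torus element carrying one embedded point to another multiplies w
  by some tau and acts on u through some v with tau^beta v^alpha = 1. The circle acting on V_B
  supplies only the pairs (s^(-alpha), s^beta), and these exhaust the solutions exactly when alpha
  and beta are coprime.

  Lifting is delicate because the product of the w_i^(m_i) remembers w only up to a beta-th root of
  unity. Polynomials need no root: apart from |w|^2 and u, invariance leaves only powers of w^beta
  and of its conjugate. Other smooth functions do need one, and the root is singular at the origin;
  subtracting a lift of the Taylor series first makes this singularity harmless.

  The isometry does not respect brackets of arbitrary functions. It does so for invariant ones where
  w is nonzero; at the origin their brackets vanish on both sides.\<close>

primrec Ck_on :: "nat \<Rightarrow> 'a::euclidean_space set \<Rightarrow> ('a \<Rightarrow> real) \<Rightarrow> bool" where
  "Ck_on 0 U f = continuous_on U f"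
| "Ck_on (Suc k) U f = (\<exists>f'. (\<forall>x\<in>U. (f has_derivative f' x) (at x)) \<and> (\<forall>v. Ck_on k U (\<lambda>x. f' x v)))"

text \<open>The derivative in \<open>Ck_on\<close> is existentially quantified, so only its values
  on U matter. On the whole space this is \<open>smooth\<close>, see
  \<open>smooth_iff_smooth_on\<close>; proper open subsets occur because the homogeneous functions
  used later are singular at the origin.\<close>

definition smooth_on :: "'a::euclidean_space set \<Rightarrow> ('a \<Rightarrow> real) \<Rightarrow> bool" where
  "smooth_on U f \<longleftrightarrow> (\<forall>k. Ck_on k U f)"

lemma Ck_on_SucI:
  "(\<And>x. x \<in> U \<Longrightarrow> (f has_derivative f' x) (at x)) \<Longrightarrow> (\<And>v. Ck_on k U (\<lambda>x. f' x v)) \<Longrightarrow> Ck_on (Suc k) U f"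
  by auto

lemma Ck_on_cong:
  assumes "open U" "\<And>x. x \<in> U \<Longrightarrow> f x = g x" "Ck_on k U f"
  shows "Ck_on k U g"
proof (cases k)
  case 0
  then show ?thesis using assms by (simp cong: continuous_on_cong)
next
  case (Suc k')
  then obtain f' where f': "\<forall>x\<in>U. (f has_derivative f' x) (at x)" "\<forall>v. Ck_on k' U (\<lambda>x. f' x v)"
    using assms by auto
  then have "(g has_derivative f' x) (at x)" if "x \<in> U" for x
    using has_derivative_transform_within_open[of f "f' x" x UNIV U g] assms(1,2) that by auto
  then show ?thesis
    unfolding Suc using f' by (intro Ck_on_SucI[where f'=f']) auto
qed

lemma Ck_on_Suc_imp: "Ck_on (Suc k) U f \<Longrightarrow> Ck_on k U f"
proof (induction k arbitrary: f)
  case 0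
  then obtain f' where "\<forall>x\<in>U. (f has_derivative f' x) (at x)" by auto
  then show ?case
    using continuous_at_imp_continuous_on has_derivative_continuous by fastforce
next
  case (Suc k)
  then obtain f' where "\<forall>x\<in>U. (f has_derivative f' x) (at x)" "\<forall>v. Ck_on (Suc k) U (\<lambda>x. f' x v)"
    by (metis Ck_on.simps(2))
  then show ?case by (intro Ck_on_SucI[where f'=f']) (auto intro: Suc.IH)
qed

lemma Ck_on_const: "Ck_on k U (\<lambda>x. c)"
proof (induction k arbitrary: c)
  case (Suc k)
  show ?case by (rule Ck_on_SucI[where f'="\<lambda>_ _. 0"]) (auto intro: Suc)
qed auto

lemma Ck_on_add: "Ck_on k U f \<Longrightarrow> Ck_on k U g \<Longrightarrow> Ck_on k U (\<lambda>x. f x + g x)"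
proof (induction k arbitrary: f g)
  case 0 then show ?case by (simp add: continuous_on_add)
next
  case (Suc k)
  from Suc.prems obtain f' g' where "\<forall>x\<in>U. (f has_derivative f' x) (at x)" "\<forall>v. Ck_on k U (\<lambda>x. f' x v)"
   "\<forall>x\<in>U. (g has_derivative g' x) (at x)" "\<forall>v. Ck_on k U (\<lambda>x. g' x v)" by auto
  then show ?case 
    by (intro Ck_on_SucI[where f'="\<lambda>x v. f' x v + g' x v"] Suc.IH has_derivative_add) auto
qed

lemma Ck_on_mult: "Ck_on k U f \<Longrightarrow> Ck_on k U g \<Longrightarrow> Ck_on k U (\<lambda>x. f x * g x)"
proof (induction k arbitrary: f g)
  case 0 then show ?case by (simp add: continuous_on_mult)
next
  case (Suc k)
  from Suc.prems obtain f' g' where "\<forall>x\<in>U. (f has_derivative f' x) (at x)" "\<forall>v. Ck_on k U (\<lambda>x. f' x v)"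
   "\<forall>x\<in>U. (g has_derivative g' x) (at x)" "\<forall>v. Ck_on k U (\<lambda>x. g' x v)" by auto
  then show ?case using Suc.prems[THEN Ck_on_Suc_imp]
    by (intro Ck_on_SucI[where f'="\<lambda>x v. f x * g' x v + f' x v * g x"])
       (intro has_derivative_mult Suc.IH Ck_on_add; auto)+
qed

lemma Ck_on_sum: "(\<And>i. i \<in> I \<Longrightarrow> Ck_on k U (f i)) \<Longrightarrow> Ck_on k U (\<lambda>x. \<Sum>i\<in>I. f i x)"
  by (induction I rule: infinite_finite_induct) (auto intro: Ck_on_const Ck_on_add)

text \<open>Regularity is defined for real-valued functions only, so the inner map is controlled
  through its coordinates. The chain rule then writes the derivative as a sum of products to which
  the induction hypothesis for the partial derivatives of h applies.\<close>

lemma Ck_on_compose: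
  fixes h :: "'b::euclidean_space \<Rightarrow> real" and \<psi> :: "'a::euclidean_space \<Rightarrow> 'b"
  assumes "\<psi> ` U \<subseteq> W" 
  shows "Ck_on k W h \<Longrightarrow> (\<And>b. b \<in> Basis \<Longrightarrow> Ck_on k U (\<lambda>x. \<psi> x \<bullet> b)) \<Longrightarrow> Ck_on k U (\<lambda>x. h (\<psi> x))"
proof (induction k arbitrary: h)
  case 0
  have "continuous_on U \<psi>" using 0(2) 
    by (subst continuous_on_componentwise) auto
  with 0 assms show ?case by (auto intro: continuous_on_compose2)
next
  case (Suc k)
  from Suc.prems(1) obtain h' where h': "\<And>x. x \<in> W \<Longrightarrow> (h has_derivative h' x) (at x)" 
    "\<And>v. Ck_on k W (\<lambda>x. h' x v)" by auto
  have "\<forall>b\<in>Basis. \<exists>p. (\<forall>x\<in>U. ((\<lambda>x. \<psi> x \<bullet> b) has_derivative p x) (at x)) \<and> (\<forall>v. Ck_on k U (\<lambda>x. p x v))"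
    using Suc.prems(2) by auto
  then obtain p where p: "\<And>b x. b \<in> Basis \<Longrightarrow> x \<in> U \<Longrightarrow> ((\<lambda>x. \<psi> x \<bullet> b) has_derivative p b x) (at x)"
    "\<And>b v. b \<in> Basis \<Longrightarrow> Ck_on k U (\<lambda>x. p b x v)" by metis
  show ?case
  proof (rule Ck_on_SucI[where f'="\<lambda>x v. \<Sum>b\<in>Basis. p b x v * h' (\<psi> x) b"])
    fix x assume x: "x \<in> U"
    have "(\<psi> has_derivative (\<lambda>v. \<Sum>b\<in>Basis. p b x v *\<^sub>R b)) (at x)"
      using p(1)[OF _ x] by (subst has_derivative_componentwise_within)
        (simp add: inner_sum_left inner_Basis if_distrib sum.delta cong: if_cong)
    from has_derivative_compose[OF this h'(1)[of "\<psi> x"]] x assms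
    have "((\<lambda>x. h (\<psi> x)) has_derivative (\<lambda>v. h' (\<psi> x) (\<Sum>b\<in>Basis. p b x v *\<^sub>R b))) (at x)" by auto
    moreover have "bounded_linear (h' (\<psi> x))" using h'(1) x assms has_derivative_bounded_linear by blast
    ultimately show "((\<lambda>x. h (\<psi> x)) has_derivative (\<lambda>v. \<Sum>b\<in>Basis. p b x v * h' (\<psi> x) b)) (at x)"
      by (simp add: linear_simps bounded_linear.linear linear_sum linear_scale)
  next
    fix v
    have "Ck_on k U (\<lambda>x. \<psi> x \<bullet> b)" if "b \<in> Basis" for b
      using Suc.prems(2)[OF that] by (rule Ck_on_Suc_imp)
    then have "Ck_on k U (\<lambda>x. h' (\<psi> x) b)" for b
      by (rule Suc.IH[OF h'(2)])
    then show "Ck_on k U (\<lambda>x. \<Sum>b\<in>Basis. p b x v * h' (\<psi> x) b)"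
      by (intro Ck_on_sum Ck_on_mult p(2))
  qed
qed

lemma smooth_on_const [intro, simp]: "smooth_on U (\<lambda>x. c)"
  by (simp add: smooth_on_def Ck_on_const)
lemma smooth_on_add [intro]: "smooth_on U f \<Longrightarrow> smooth_on U g \<Longrightarrow> smooth_on U (\<lambda>x. f x + g x)"
  by (simp add: smooth_on_def Ck_on_add)
lemma smooth_on_mult [intro]: "smooth_on U f \<Longrightarrow> smooth_on U g \<Longrightarrow> smooth_on U (\<lambda>x. f x * g x)"
  by (simp add: smooth_on_def Ck_on_mult)
lemma smooth_on_sum [intro]: "(\<And>i. i \<in> I \<Longrightarrow> smooth_on U (f i)) \<Longrightarrow> smooth_on U (\<lambda>x. \<Sum>i\<in>I. f i x)"
  by (simp add: smooth_on_def Ck_on_sum)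
lemma smooth_on_minus [intro]: "smooth_on U f \<Longrightarrow> smooth_on U (\<lambda>x. - f x)"
  using smooth_on_mult[of U "\<lambda>_. -1" f] by auto
lemma smooth_on_diff [intro]: "smooth_on U f \<Longrightarrow> smooth_on U g \<Longrightarrow> smooth_on U (\<lambda>x. f x - g x)"
  using smooth_on_add[of U f "\<lambda>x. - g x"] by auto
lemma smooth_on_power [intro]: "smooth_on U f \<Longrightarrow> smooth_on U (\<lambda>x. f x ^ n)"
  by (induction n) auto
lemma smooth_on_prod [intro]: "(\<And>i. i \<in> I \<Longrightarrow> smooth_on U (f i)) \<Longrightarrow> smooth_on U (\<lambda>x. \<Prod>i\<in>I. f i x)"
  by (induction I rule: infinite_finite_induct) auto
lemma smooth_on_cong:
  "open U \<Longrightarrow> (\<And>x. x \<in> U \<Longrightarrow> f x = g x) \<Longrightarrow> smooth_on U f \<Longrightarrow> smooth_on U g"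
  by (auto simp: smooth_on_def intro: Ck_on_cong)
lemma smooth_on_compose:
  "smooth_on W h \<Longrightarrow> (\<And>b. b \<in> Basis \<Longrightarrow> smooth_on U (\<lambda>x. \<psi> x \<bullet> b)) \<Longrightarrow> \<psi> ` U \<subseteq> W \<Longrightarrow>
   smooth_on U (\<lambda>x. h (\<psi> x))"
  by (auto simp: smooth_on_def intro: Ck_on_compose)
lemma smooth_on_compose_real:
  fixes h :: "real \<Rightarrow> real"
  shows "smooth_on W h \<Longrightarrow> smooth_on U f \<Longrightarrow> f ` U \<subseteq> W \<Longrightarrow> smooth_on U (\<lambda>x. h (f x))"
  by (rule smooth_on_compose) auto

lemma smooth_on_derivI:
  assumes "\<And>x. x \<in> U \<Longrightarrow> (f has_derivative f' x) (at x)" "\<And>v. smooth_on U (\<lambda>x. f' x v)"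
  shows "smooth_on U f"
  unfolding smooth_on_def
proof
  fix k
  have "Ck_on (Suc k) U f" using assms by (intro Ck_on_SucI) (auto simp: smooth_on_def)
  then show "Ck_on k U f" by (rule Ck_on_Suc_imp)
qed

text \<open>A family closed under differentiation consists of smooth functions: each member is
  continuous because it is differentiable. This treats powers, sine and cosine, and
  \<open>bump\<close> by naming a parametrised family instead of computing all derivatives.\<close>

lemma smooth_on_coinduct:
  assumes "P f"
    and step: "\<And>f. P f \<Longrightarrow> \<exists>f'. (\<forall>x\<in>U. (f has_derivative f' x) (at x)) \<and> (\<forall>v. P (\<lambda>x. f' x v))"
  shows "smooth_on U f"
proof -
  have "Ck_on (Suc k) U f" if "P f" for k f
    using that
  proof (induction k arbitrary: f)
    case 0
    from step[OF this] obtain f' where 1: "\<forall>x\<in>U. (f has_derivative f' x) (at x)" "\<forall>v. P (\<lambda>x. f' x v)" by auto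
    have "continuous_on U (\<lambda>x. f' x v)" for v
    proof -
      from step[of "\<lambda>x. f' x v"] 1 obtain g where "\<forall>x\<in>U. ((\<lambda>x. f' x v) has_derivative g x) (at x)" by blast
      then show ?thesis using continuous_at_imp_continuous_on has_derivative_continuous by fastforce
    qed
    with 1 show ?case by (intro Ck_on_SucI) auto
  next
    case (Suc k)
    from step[OF Suc.prems] Suc.IH show ?case by (metis Ck_on.simps(2))
  qed
  then show ?thesis using assms(1) by (auto simp: smooth_on_def intro: Ck_on_Suc_imp)
qed

lemma smooth_on_has_derivative:
  assumes "smooth_on U f" "x \<in> U"
  shows "(f has_derivative frechet_derivative f (at x)) (at x)"
proof -
  have "Ck_on (Suc 0) U f" using assms by (auto simp: smooth_on_def simp del: Ck_on.simps)
  then show ?thesis using assms(2) by (auto intro: differentiableI simp flip: frechet_derivative_works)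
qed

lemma smooth_on_continuous_on: "smooth_on U f \<Longrightarrow> continuous_on U f"
  unfolding smooth_on_def using Ck_on.simps(1) by blast

lemma smooth_on_frechet:
  assumes "smooth_on U f" "open U"
  shows "smooth_on U (\<lambda>x. frechet_derivative f (at x) v)"
  unfolding smooth_on_def
proof
  fix k
  have "Ck_on (Suc k) U f" using assms by (auto simp: smooth_on_def simp del: Ck_on.simps)
  then obtain f' where f': "\<forall>x\<in>U. (f has_derivative f' x) (at x)" "\<forall>v. Ck_on k U (\<lambda>x. f' x v)" by auto
  then have "frechet_derivative f (at x) v = f' x v" if "x \<in> U" for x 
    using that frechet_derivative_at by metis
  then show "Ck_on k U (\<lambda>x. frechet_derivative f (at x) v)"
    by (intro Ck_on_cong[OF assms(2) _ f'(2)[rule_format]]) auto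
qed

lemma smooth_iff_smooth_on: "smooth f \<longleftrightarrow> smooth_on UNIV f"
proof -
  have "Ck k f \<longleftrightarrow> Ck_on k UNIV f" for k
  proof (induction k arbitrary: f)
    case (Suc k)
    show ?case
    proof
      assume "Ck (Suc k) f"
      then show "Ck_on (Suc k) UNIV f" 
        by (intro Ck_on_SucI) (auto simp: Suc frechet_derivative_works)
    next
      assume "Ck_on (Suc k) UNIV f"
      then obtain f' where f': "\<forall>x. (f has_derivative f' x) (at x)" "\<forall>v. Ck_on k UNIV (\<lambda>x. f' x v)" by auto
      then have "frechet_derivative f (at x) = f' x" for x using frechet_derivative_at by metis
      with f' show "Ck (Suc k) f" by (auto simp: Suc intro: differentiableI)
    qed
  qed auto
  then show ?thesis by (auto simp: smooth_def smooth_on_def)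
qed

lemma smooth_on_bounded_linear:
  assumes "bounded_linear f" shows "smooth_on U f"
proof (rule smooth_on_derivI[where f'="\<lambda>_. f"])
qed (use assms in \<open>auto intro: bounded_linear_imp_has_derivative\<close>)

lemma smooth_on_id_real [intro, simp]: "smooth_on U (\<lambda>x::real. x)"
  by (rule smooth_on_bounded_linear) (rule bounded_linear_ident)

section \<open>Smoothness of concrete functions of one variable\<close>

lemma smooth_on_powr:
  assumes "smooth_on U f" "\<And>x. x \<in> U \<Longrightarrow> f x > 0"
  shows "smooth_on U (\<lambda>x. f x powr s)"
proof (rule smooth_on_compose_real[of "{0<..}" "\<lambda>x. x powr s"])
  show "smooth_on {0<..} (\<lambda>x::real. x powr s)"
  proof (rule smooth_on_coinduct[where P="\<lambda>f. \<exists>c s. f = (\<lambda>x. c * x powr s)"])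
    show "\<exists>c s'. (\<lambda>x::real. x powr s) = (\<lambda>x. c * x powr s')" by (rule exI[of _ 1]) auto
    fix f :: "real \<Rightarrow> real" assume "\<exists>c s. f = (\<lambda>x. c * x powr s)"
    then obtain c s where f: "f = (\<lambda>x. c * x powr s)" by auto
    have "(f has_derivative (\<lambda>v. (v * c * s) * x powr (s - 1))) (at x)" if "x > 0" for x
      unfolding f using that
      by (auto intro!: derivative_eq_intros simp: field_simps powr_diff)
    then show "\<exists>f'. (\<forall>x\<in>{0<..}. (f has_derivative f' x) (at x)) \<and> (\<forall>v. \<exists>c s. (\<lambda>x. f' x v) = (\<lambda>x. c * x powr s))"
      by (intro exI[of _ "\<lambda>x v. (v * c * s) * x powr (s - 1)"]) auto
  qed
qed (use assms in auto)

lemma smooth_on_divide: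
  assumes "smooth_on U f" "smooth_on U g" "\<And>x. x \<in> U \<Longrightarrow> g x > 0" "open U"
  shows "smooth_on U (\<lambda>x. f x / g x)"
proof (rule smooth_on_cong[OF assms(4) _ smooth_on_mult[OF assms(1) smooth_on_powr[OF assms(2,3), of "- 1"]]])
  fix x assume "x \<in> U" with assms(3) have "g x > 0" by auto
  then show "f x * g x powr (-1) = f x / g x" by (simp add: powr_minus divide_inverse)
qed

lemma smooth_on_trig: "smooth_on U (\<lambda>x::real. c * cos x + d * sin x)"
proof (rule smooth_on_coinduct[where P="\<lambda>f. \<exists>c d. f = (\<lambda>x. c * cos x + d * sin x)"])
  fix f :: "real \<Rightarrow> real" assume "\<exists>c d. f = (\<lambda>x. c * cos x + d * sin x)"
  then obtain c d where f: "f = (\<lambda>x. c * cos x + d * sin x)" by auto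
  show "\<exists>f'. (\<forall>x\<in>U. (f has_derivative f' x) (at x)) \<and> (\<forall>v. \<exists>c d. (\<lambda>x. f' x v) = (\<lambda>x. c * cos x + d * sin x))"
  proof (intro exI[of _ "\<lambda>x v. (v * d) * cos x + (- v * c) * sin x"] conjI ballI allI)
    fix x show "(f has_derivative (\<lambda>v. (v * d) * cos x + (- v * c) * sin x)) (at x)"
      unfolding f by (auto intro!: derivative_eq_intros)
  qed blast
qed auto

lemma smooth_on_cos: "smooth_on U f \<Longrightarrow> smooth_on U (\<lambda>x. cos (f x))"
  using smooth_on_compose_real[OF smooth_on_trig[of UNIV 1 0], of U f] by auto

lemma smooth_on_sin: "smooth_on U f \<Longrightarrow> smooth_on U (\<lambda>x. sin (f x))"
  using smooth_on_compose_real[OF smooth_on_trig[of UNIV 0 1], of U f] by auto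

lemma smooth_on_arctan: assumes "smooth_on U f" shows "smooth_on U (\<lambda>x. arctan (f x))"
proof (rule smooth_on_compose_real[OF _ assms])
  show "smooth_on UNIV arctan"
  proof (rule smooth_on_derivI)
    show "(arctan has_derivative (\<lambda>v. v / (1 + x\<^sup>2))) (at x)" for x
      by (auto intro!: derivative_eq_intros simp: divide_inverse)
    show "smooth_on UNIV (\<lambda>x::real. v / (1 + x\<^sup>2))" for v
      by (intro smooth_on_divide smooth_on_add smooth_on_power) (auto intro: add_pos_nonneg)
  qed
qed auto

definition bump :: "real \<Rightarrow> real" where "bump x = (if x > 0 then exp (- 1 / x) else 0)"

lemma bump_pos: "x > 0 \<Longrightarrow> bump x > 0" and bump_zero: "x \<le> 0 \<Longrightarrow> bump x = 0" and bump_nonneg: "bump x \<ge> 0"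
  by (auto simp: bump_def)

lemma poly_inverse_exp_tendsto_0:
  fixes p :: "real poly"
  shows "((\<lambda>x. poly p (1 / x) * exp (- 1 / x)) \<longlongrightarrow> 0) (at_right 0)"
proof -
  have "((\<lambda>y. \<Sum>i\<le>degree p. coeff p i * (y ^ i / exp y)) \<longlongrightarrow> 0) at_top"
    by (intro tendsto_null_sum tendsto_mult_right_zero tendsto_power_div_exp_0)
  then have "((\<lambda>y. poly p y * exp (- y)) \<longlongrightarrow> 0) at_top"
    by (simp add: poly_altdef sum_divide_distrib exp_minus divide_inverse sum_distrib_right mult.assoc)
  from filterlim_compose[OF this filterlim_inverse_at_top_right]
  show ?thesis by (simp add: inverse_eq_divide)
qed

lemma smooth_on_bump: "smooth_on UNIV bump"
proof (rule smooth_on_coinduct[where P="\<lambda>f. \<exists>p. f = (\<lambda>x. if x > 0 then poly p (1 / x) * exp (- 1 / x) else 0)"])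
  show "\<exists>p. bump = (\<lambda>x. if x > 0 then poly p (1 / x) * exp (- 1 / x) else 0)"
    by (rule exI[of _ 1]) (auto simp: bump_def)
  fix f :: "real \<Rightarrow> real" assume "\<exists>p. f = (\<lambda>x. if x > 0 then poly p (1 / x) * exp (- 1 / x) else 0)"
  then obtain p where f: "f = (\<lambda>x. if x > 0 then poly p (1 / x) * exp (- 1 / x) else 0)" by auto
  \<comment> \<open>With y = 1/x one has dy/dx = - y^2, so the derivative of p(y) exp(-y) is y^2
    (p(y) - p'(y)) exp(-y).\<close>
  define q where "q = [:0,0,1:] * (p - pderiv p)"
  define d where "d = (\<lambda>x. if x > 0 then poly q (1 / x) * exp (- 1 / x) else 0)"
  have "(f has_real_derivative d x) (at x)" for x
  proof -
    consider "x > 0" | "x < 0" | "x = 0" by linarith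
    then show ?thesis
    proof cases
      case 1
      have "((\<lambda>x. poly p (1 / x) * exp (- 1 / x)) has_real_derivative d x) (at x)"
        using 1 by (auto intro!: derivative_eq_intros DERIV_chain2[OF poly_DERIV] simp: d_def q_def field_simps power2_eq_square)
      then show ?thesis 
        by (rule has_field_derivative_transform_within_open[of _ _ _ "{0<..}"]) (use 1 in \<open>auto simp: f\<close>)
    next
      case 2
      have "((\<lambda>x. 0) has_real_derivative d x) (at x)" using 2 by (auto simp: d_def)
      then show ?thesis 
        by (rule has_field_derivative_transform_within_open[of _ _ _ "{..<0}"]) (use 2 in \<open>auto simp: f\<close>)
    next
      case 3
      \<comment> \<open>The difference quotient at the origin is again a polynomial in 1/y times the
        exponential, with p multiplied by its variable.\<close>
      have "((\<lambda>y. f y / y) \<longlongrightarrow> 0) (at_right 0)"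
        using poly_inverse_exp_tendsto_0[of "[:0,1:] * p"]
        by (rule Lim_transform_eventually) (auto simp: eventually_at_filter f)
      moreover have "((\<lambda>y. f y / y) \<longlongrightarrow> 0) (at_left 0)"
        by (rule Lim_transform_eventually[OF tendsto_const]) (auto simp: eventually_at_filter f)
      ultimately have "((\<lambda>y. f y / y) \<longlongrightarrow> 0) (at 0)" by (simp add: filterlim_split_at)
      then show ?thesis using 3 by (simp add: has_field_derivative_iff d_def f)
    qed
  qed
  then have "(f has_derivative (\<lambda>v. v * d x)) (at x)" for x
    by (simp add: has_field_derivative_def mult.commute[of _ "d x"])
  moreover have "\<exists>p. (\<lambda>x. v * d x) = (\<lambda>x. if x > 0 then poly p (1 / x) * exp (- 1 / x) else 0)" for v
    by (rule exI[of _ "smult v q"]) (auto simp: d_def)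
  ultimately show "\<exists>f'. (\<forall>x\<in>UNIV. (f has_derivative f' x) (at x)) \<and>
      (\<forall>v. \<exists>p. (\<lambda>x. f' x v) = (\<lambda>x. if x > 0 then poly p (1 / x) * exp (- 1 / x) else 0))"
    by (intro exI[of _ "\<lambda>x v. v * d x"]) auto
qed

lemma smooth_on_bump_compose: "smooth_on U f \<Longrightarrow> smooth_on U (\<lambda>x. bump (f x))"
  by (rule smooth_on_compose_real[OF smooth_on_bump]) auto

section \<open>Flat functions\<close>

abbreviation dd :: "'a::euclidean_space \<Rightarrow> ('a \<Rightarrow> real) \<Rightarrow> 'a \<Rightarrow> real" where
  "dd v f \<equiv> (\<lambda>x. frechet_derivative f (at x) v)"

lemma smooth_on_linear_frechet:
  assumes "smooth_on UNIV f" shows "linear (frechet_derivative f (at x))"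
  using smooth_on_has_derivative[OF assms, of x] has_derivative_linear by blast

lemma frechet_eq_sum_dd:
  assumes "smooth_on U f" "x \<in> U"
  shows "frechet_derivative f (at x) v = (\<Sum>b\<in>Basis. (v \<bullet> b) * dd b f x)"
proof -
  have "linear (frechet_derivative f (at x))"
    using smooth_on_has_derivative[OF assms] has_derivative_linear by blast
  then have "frechet_derivative f (at x) (\<Sum>b\<in>Basis. (v \<bullet> b) *\<^sub>R b) = (\<Sum>b\<in>Basis. (v \<bullet> b) * dd b f x)"
    by (simp add: linear_sum linear_scale)
  then show ?thesis by (simp add: euclidean_representation)
qed

lemma has_derivative_along_line:
  assumes "smooth_on UNIV f"
  shows "((\<lambda>t. f (x + t *\<^sub>R v)) has_real_derivative dd v f (x + t *\<^sub>R v)) (at t)"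
proof -
  have "((\<lambda>t. x + t *\<^sub>R v) has_derivative (\<lambda>s. s *\<^sub>R v)) (at t)"
    by (auto intro!: derivative_eq_intros)
  from has_derivative_compose[OF this smooth_on_has_derivative[OF assms UNIV_I]]
  have "((\<lambda>t. f (x + t *\<^sub>R v)) has_derivative (\<lambda>s. frechet_derivative f (at (x + t *\<^sub>R v)) (s *\<^sub>R v))) (at t)" .
  then show ?thesis
    using smooth_on_linear_frechet[OF assms, of "x + t *\<^sub>R v"]
    by (simp add: has_field_derivative_def linear_scale mult.commute[of _ "dd v f (x + t *\<^sub>R v)"])
qed

lemma smooth_on_bounded_cball:
  assumes "smooth_on UNIV f"
  obtains M where "M \<ge> 0" "\<And>x. norm x \<le> R \<Longrightarrow> \<bar>f x\<bar> \<le> M"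
proof -
  have "compact (f ` cball 0 R)"
    by (intro compact_continuous_image continuous_on_subset[OF smooth_on_continuous_on[OF assms]]) auto
  then have "bounded (f ` cball 0 R)" by (rule compact_imp_bounded)
  then obtain M where "M > 0" "\<forall>y\<in>f ` cball 0 R. norm y \<le> M" by (meson bounded_pos)
  then show ?thesis by (intro that[of M]) auto
qed

text \<open>Stated through decay of the values rather than vanishing of the derivatives, since the
  estimates of Borel and Taylor give it in this form; \<open>flat_dd\<close> shows that the property
  passes to derivatives.\<close>

definition flat :: "('a::euclidean_space \<Rightarrow> real) \<Rightarrow> bool" where
  "flat h \<longleftrightarrow> smooth_on UNIV h \<and> (\<forall>N. \<exists>C. \<forall>z. norm z \<le> 1 \<longrightarrow> \<bar>h z\<bar> \<le> C * norm z ^ N)"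

lemma flat_bound:
  assumes "flat h"
  obtains C where "C \<ge> 0" "\<And>z. norm z \<le> R \<Longrightarrow> \<bar>h z\<bar> \<le> C * norm z ^ N"
proof -
  have s: "smooth_on UNIV h" using assms by (auto simp: flat_def)
  obtain C where C: "\<And>z. norm z \<le> 1 \<Longrightarrow> \<bar>h z\<bar> \<le> C * norm z ^ N"
    using assms by (auto simp: flat_def)
  obtain M where M: "M \<ge> 0" "\<And>z. norm z \<le> R \<Longrightarrow> \<bar>h z\<bar> \<le> M" using smooth_on_bounded_cball[OF s, of R] by metis
  show ?thesis
  proof (rule that[of "max \<bar>C\<bar> M"])
    fix z :: 'a assume z: "norm z \<le> R"
    show "\<bar>h z\<bar> \<le> max \<bar>C\<bar> M * norm z ^ N"
    proof (cases "norm z \<le> 1")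
      case True
      have "C * norm z ^ N \<le> max \<bar>C\<bar> M * norm z ^ N" by (intro mult_right_mono) auto
      with C[OF True] show ?thesis by linarith
    next
      case False
      then have "1 \<le> norm z ^ N" by (intro one_le_power) auto
      then have "max \<bar>C\<bar> M * 1 \<le> max \<bar>C\<bar> M * norm z ^ N" using M(1) by (intro mult_left_mono) auto
      with M(2)[OF z] show ?thesis by linarith
    qed
  qed (use M in auto)
qed

text \<open>With \<open>t = \<bar>z\<bar>^N\<close> in \<open>\<bar>\<partial>\<^sub>v h z\<bar> \<le> (\<bar>h (z + t v)\<bar> + \<bar>h z\<bar>) / t + t sup \<bar>\<partial>\<^sub>v \<partial>\<^sub>v h\<bar>\<close>,
  decay of order \<open>2N\<close> of \<open>h\<close> gives decay of order \<open>N\<close> of the derivative.\<close>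

lemma flat_dd:
  fixes h :: "'a::euclidean_space \<Rightarrow> real"
  assumes "flat h"
  shows "flat (dd v h)"
proof -
  have s: "smooth_on UNIV h" using assms by (auto simp: flat_def)
  have s1: "smooth_on UNIV (dd v h)" by (intro smooth_on_frechet s open_UNIV)
  have s2: "smooth_on UNIV (dd v (dd v h))" by (intro smooth_on_frechet s1 open_UNIV)
  obtain M where M: "M \<ge> 0" "\<And>z. norm z \<le> 1 + norm v \<Longrightarrow> \<bar>dd v (dd v h) z\<bar> \<le> M"
    using smooth_on_bounded_cball[OF s2] by metis
  have key: "\<bar>dd v h z\<bar> \<le> (\<bar>h (z + t *\<^sub>R v)\<bar> + \<bar>h z\<bar>) / t + t * M"
    if z: "norm z \<le> 1" and t: "0 < t" "t \<le> 1" for z t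
  proof -
    obtain \<xi> where \<xi>: "0 < \<xi>" "\<xi> < t" "h (z + t *\<^sub>R v) - h (z + 0 *\<^sub>R v) = (t - 0) * dd v h (z + \<xi> *\<^sub>R v)"
      using MVT2[of 0 t "\<lambda>t. h (z + t *\<^sub>R v)" "\<lambda>t. dd v h (z + t *\<^sub>R v)"] has_derivative_along_line[OF s] t by auto
    obtain \<eta> where \<eta>: "0 < \<eta>" "\<eta> < \<xi>" "dd v h (z + \<xi> *\<^sub>R v) - dd v h (z + 0 *\<^sub>R v) = (\<xi> - 0) * dd v (dd v h) (z + \<eta> *\<^sub>R v)"
      using MVT2[of 0 \<xi> "\<lambda>t. dd v h (z + t *\<^sub>R v)" "\<lambda>t. dd v (dd v h) (z + t *\<^sub>R v)"] has_derivative_along_line[OF s1] \<xi> by auto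
    have "norm (z + \<eta> *\<^sub>R v) \<le> norm z + \<bar>\<eta>\<bar> * norm v" by (rule norm_triangle_le) simp
    also have "\<dots> \<le> 1 + 1 * norm v" using z t \<xi> \<eta> by (intro add_mono mult_right_mono) auto
    finally have "\<bar>dd v (dd v h) (z + \<eta> *\<^sub>R v)\<bar> \<le> M" by (intro M) simp
    then have 1: "\<bar>\<xi> * dd v (dd v h) (z + \<eta> *\<^sub>R v)\<bar> \<le> t * M"
      using \<xi> t by (auto simp: abs_mult intro!: mult_mono)
    have 2: "dd v h (z + \<xi> *\<^sub>R v) = (h (z + t *\<^sub>R v) - h z) / t" using \<xi>(3) t by (simp add: field_simps)
    have "\<bar>dd v h (z + \<xi> *\<^sub>R v)\<bar> = \<bar>h (z + t *\<^sub>R v) - h z\<bar> / t" unfolding 2 using t by simp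
    also have "\<dots> \<le> (\<bar>h (z + t *\<^sub>R v)\<bar> + \<bar>h z\<bar>) / t" using t by (intro divide_right_mono) auto
    finally show ?thesis using \<eta>(3) 1 by simp
  qed
  have "\<exists>C. \<forall>z. norm z \<le> 1 \<longrightarrow> \<bar>dd v h z\<bar> \<le> C * norm z ^ N" for N
  proof -
    \<comment> \<open>The successor matters for N = 0: it gives t \<le> \<open>norm z\<close>, which
      keeps z + t v comparable to z, and a bound tending to zero, which forces the derivative to
      vanish at the origin.\<close>
    let ?m = "Suc N"
    obtain C where C: "C \<ge> 0" "\<And>z. norm z \<le> 1 + norm v \<Longrightarrow> \<bar>h z\<bar> \<le> C * norm z ^ (2 * ?m)"
      using flat_bound[OF assms] by metis
    define L where "L = (1 + norm v) ^ (2 * ?m)"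
    have L: "L \<ge> 1" unfolding L_def by (intro one_le_power) auto
    define C' where "C' = C * L + C + M"
    have C'0: "C' \<ge> 0" using C M L by (auto simp: C'_def)
    have nz: "\<bar>dd v h z\<bar> \<le> C' * norm z ^ ?m" if z: "norm z \<le> 1" "z \<noteq> 0" for z
    proof -
      define t where "t = norm z ^ ?m"
      have t: "0 < t" "t \<le> 1" "t \<le> norm z" using z power_le_one[of "norm z" N]
        using power_le_one[of "norm z" ?m] mult_left_le[of "norm z ^ N" "norm z"] by (auto simp: t_def)
      have t2: "norm z ^ (2 * ?m) = t\<^sup>2" by (metis mult.commute power_mult t_def)
      have a: "norm (z + t *\<^sub>R v) \<le> (1 + norm v) * norm z"
      proof -
        have "norm (z + t *\<^sub>R v) \<le> norm z + t * norm v" using t by (intro norm_triangle_le) simp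
        also have "\<dots> \<le> norm z + norm z * norm v" using t by (intro add_left_mono mult_right_mono) auto
        finally show ?thesis by (simp add: algebra_simps)
      qed
      have "(1 + norm v) * norm z \<le> (1 + norm v) * 1" using z by (intro mult_left_mono) auto
      with a have "\<bar>h (z + t *\<^sub>R v)\<bar> \<le> C * norm (z + t *\<^sub>R v) ^ (2 * ?m)" by (intro C) auto
      also have "\<dots> \<le> C * ((1 + norm v) * norm z) ^ (2 * ?m)" using a C by (intro mult_left_mono power_mono) auto
      also have "\<dots> = C * L * t\<^sup>2" by (simp only: L_def t2 power_mult_distrib mult.assoc)
      finally have h1: "\<bar>h (z + t *\<^sub>R v)\<bar> \<le> C * L * t\<^sup>2" .
      have "\<bar>h z\<bar> \<le> C * norm z ^ (2 * ?m)" using z by (intro C) (simp add: add_increasing2)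
      also have "\<dots> = C * t\<^sup>2" by (simp only: t2)
      finally have h2: "\<bar>h z\<bar> \<le> C * t\<^sup>2" .
      have "\<bar>dd v h z\<bar> \<le> (\<bar>h (z + t *\<^sub>R v)\<bar> + \<bar>h z\<bar>) / t + t * M" using z t by (intro key)
      also have "\<dots> \<le> (C * L * t\<^sup>2 + C * t\<^sup>2) / t + t * M"
        using h1 h2 t by (intro add_right_mono divide_right_mono add_mono) auto
      also have "\<dots> = C' * t" using t by (simp add: C'_def field_simps power2_eq_square)
      finally show ?thesis by (simp add: t_def)
    qed
    have "dd v h 0 = 0"
    proof (rule LIM_unique)
      show "dd v h \<midarrow>0\<rightarrow> dd v h 0"
        using smooth_on_continuous_on[OF s1] by (simp add: continuous_on_eq_continuous_at isCont_def)
      have "((\<lambda>z::'a. norm z) \<longlongrightarrow> 0) (at 0)"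
        using tendsto_norm_zero[OF tendsto_ident_at[of "0::'a" UNIV]] by simp
      from tendsto_power[OF this, of ?m] have "((\<lambda>z::'a. C' * norm z ^ ?m) \<longlongrightarrow> 0) (at 0)"
        by (intro tendsto_mult_right_zero) simp
      then show "dd v h \<midarrow>0\<rightarrow> 0"
        by (rule Lim_null_comparison[rotated]) (use nz in \<open>auto simp: eventually_at intro!: exI[of _ 1]\<close>)
    qed
    then have "\<bar>dd v h z\<bar> \<le> C' * norm z ^ N" if "norm z \<le> 1" for z
    proof (cases "z = 0")
      case False
      have "C' * norm z ^ ?m \<le> C' * norm z ^ N" using that C'0 by (intro mult_left_mono power_decreasing) auto
      with nz[OF that False] show ?thesis by linarith
    qed (use C'0 in auto)
    then show ?thesis by blast
  qed
  with s1 show ?thesis by (auto simp: flat_def)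
qed

section \<open>Homogeneous functions and their products with flat functions\<close>

definition homog :: "real \<Rightarrow> ('a::real_vector \<Rightarrow> real) \<Rightarrow> bool" where
  "homog d f \<longleftrightarrow> (\<forall>r z. r > 0 \<longrightarrow> z \<noteq> 0 \<longrightarrow> f (r *\<^sub>R z) = r powr d * f z)"

lemma homogD: "homog d f \<Longrightarrow> r > 0 \<Longrightarrow> z \<noteq> 0 \<Longrightarrow> f (r *\<^sub>R z) = r powr d * f z"
  by (auto simp: homog_def)

lemma homog_mult: "homog d f \<Longrightarrow> homog e g \<Longrightarrow> homog (d + e) (\<lambda>z. f z * g z)"
  by (auto simp: homog_def powr_add)

text \<open>Differentiating f(r z) = r^d f(z) in z produces an extra factor r on the left. The
  degree is real because it may drop below zero.\<close>

lemma homog_dd: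
  fixes f :: "'a::euclidean_space \<Rightarrow> real"
  assumes "smooth_on (- {0}) f" "homog d f"
  shows "homog (d - 1) (dd v f)"
  unfolding homog_def
proof (intro allI impI)
  fix r :: real and z :: 'a assume rz: "r > 0" "z \<noteq> 0"
  have d1: "(f has_derivative frechet_derivative f (at (r *\<^sub>R z))) (at (r *\<^sub>R z))"
    using rz by (intro smooth_on_has_derivative[OF assms(1)]) auto
  have d2: "(f has_derivative frechet_derivative f (at z)) (at z)"
    using rz by (intro smooth_on_has_derivative[OF assms(1)]) auto
  have "((\<lambda>z. r *\<^sub>R z) has_derivative (\<lambda>v. r *\<^sub>R v)) (at z)" by (auto intro!: derivative_eq_intros)
  from has_derivative_compose[OF this d1]
  have 1: "((\<lambda>z. f (r *\<^sub>R z)) has_derivative (\<lambda>v. frechet_derivative f (at (r *\<^sub>R z)) (r *\<^sub>R v))) (at z)" .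
  have "((\<lambda>z. r powr d * f z) has_derivative (\<lambda>v. r powr d * frechet_derivative f (at z) v)) (at z)"
    by (intro has_derivative_mult_right d2)
  then have 2: "((\<lambda>z. f (r *\<^sub>R z)) has_derivative (\<lambda>v. r powr d * frechet_derivative f (at z) v)) (at z)"
    by (rule has_derivative_transform_within_open[where s="- {0}"]) (use rz assms(2) in \<open>auto simp: homog_def\<close>)
  have "frechet_derivative f (at (r *\<^sub>R z)) (r *\<^sub>R v) = r powr d * frechet_derivative f (at z) v"
    using has_derivative_unique[OF 1 2] by meson
  moreover have "frechet_derivative f (at (r *\<^sub>R z)) (r *\<^sub>R v) = r * frechet_derivative f (at (r *\<^sub>R z)) v"
    using has_derivative_linear[OF d1] by (simp add: linear_scale)
  ultimately show "dd v f (r *\<^sub>R z) = r powr (d - 1) * dd v f z"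
    using rz by (simp add: powr_diff field_simps)
qed

text \<open>Compactness of the unit sphere bounds the function there, and homogeneity carries the
  bound along rays.\<close>

lemma homog_bound:
  fixes m :: "'a::euclidean_space \<Rightarrow> real"
  assumes "smooth_on (- {0}) m" "homog d m"
  obtains M where "M \<ge> 0" "\<And>z. z \<noteq> 0 \<Longrightarrow> \<bar>m z\<bar> \<le> M * norm z powr d"
proof -
  have "compact (m ` sphere 0 1)"
    by (intro compact_continuous_image continuous_on_subset[OF smooth_on_continuous_on[OF assms(1)]]) auto
  then have "bounded (m ` sphere 0 1)" by (rule compact_imp_bounded)
  then obtain M where M: "M > 0" "\<forall>y\<in>m ` sphere 0 1. norm y \<le> M" by (meson bounded_pos)
  show ?thesis
  proof (rule that[of M])
    fix z :: 'a assume z: "z \<noteq> 0"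
    have "m z = norm z powr d * m (z /\<^sub>R norm z)"
      using homogD[OF assms(2), of "norm z" "z /\<^sub>R norm z"] z by auto
    moreover have "\<bar>m (z /\<^sub>R norm z)\<bar> \<le> M" using M(2) z by auto
    ultimately have "\<bar>m z\<bar> = norm z powr d * \<bar>m (z /\<^sub>R norm z)\<bar>" by (simp add: abs_mult)
    also have "\<dots> \<le> norm z powr d * M" using \<open>\<bar>m (z /\<^sub>R norm z)\<bar> \<le> M\<close> by (intro mult_left_mono) auto
    finally show "\<bar>m z\<bar> \<le> M * norm z powr d" by (simp add: mult.commute)
  qed (use M in auto)
qed

text \<open>Differentiation lowers the degree \<open>d\<close> of \<open>m\<close>, possibly below zero, but the decay of \<open>h\<close> makes up for
  any negative power of the norm.\<close>

lemma flat_compose: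
  fixes \<psi> :: "'a::euclidean_space \<Rightarrow> 'b::euclidean_space"
  assumes \<psi>s: "\<And>b. b \<in> Basis \<Longrightarrow> smooth_on (- {0}) (\<lambda>z. \<psi> z \<bullet> b)"
    and \<psi>h: "\<And>b. b \<in> Basis \<Longrightarrow> homog 1 (\<lambda>z. \<psi> z \<bullet> b)"
    and m: "smooth_on (- {0}) m" "homog d m" and h: "flat h"
  shows "smooth_on UNIV (\<lambda>z. if z = 0 then 0 else m z * h (\<psi> z))"
proof -
  have "\<exists>M. M \<ge> 0 \<and> (\<forall>z. z \<noteq> 0 \<longrightarrow> \<bar>\<psi> z \<bullet> b\<bar> \<le> M * norm z)" if b: "b \<in> Basis" for b
  proof -
    obtain M where "M \<ge> 0" "\<And>z. z \<noteq> 0 \<Longrightarrow> \<bar>\<psi> z \<bullet> b\<bar> \<le> M * norm z powr 1"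
      using homog_bound[OF \<psi>s[OF b] \<psi>h[OF b]] by blast
    then show ?thesis by auto
  qed
  then obtain B where B: "\<And>b. b \<in> Basis \<Longrightarrow> B b \<ge> 0" "\<And>b z. b \<in> Basis \<Longrightarrow> z \<noteq> 0 \<Longrightarrow> \<bar>\<psi> z \<bullet> b\<bar> \<le> B b * norm z"
    by metis
  define L where "L = 1 + sum B Basis"
  have L: "L \<ge> 1" using B(1) by (auto simp: L_def intro: sum_nonneg)
  have \<psi>L: "norm (\<psi> z) \<le> L * norm z" if "z \<noteq> 0" for z
  proof -
    have "norm (\<psi> z) \<le> (\<Sum>b\<in>Basis. \<bar>\<psi> z \<bullet> b\<bar>)" by (rule norm_le_l1)
    also have "\<dots> \<le> (\<Sum>b\<in>Basis. B b * norm z)" by (intro sum_mono B that)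
    also have "\<dots> \<le> L * norm z" by (simp add: L_def distrib_right sum_distrib_right)
    finally show ?thesis .
  qed
  have est: "\<exists>C. \<forall>z. z \<noteq> 0 \<longrightarrow> norm z \<le> 1 \<longrightarrow> \<bar>m z * h (\<psi> z)\<bar> \<le> C * (norm z)\<^sup>2"
    if m: "smooth_on (- {0}) m" "homog d m" and h: "flat h" for m d h
  proof -
    obtain M where M: "M \<ge> 0" "\<And>z. z \<noteq> 0 \<Longrightarrow> \<bar>m z\<bar> \<le> M * norm z powr d" using homog_bound[OF m] by blast
    \<comment> \<open>Total order at least 2 makes the product quadratically small, which yields
      both continuity and a zero derivative at the origin.\<close>
    define N where "N = nat \<lceil>2 - d\<rceil>"
    have N: "d + real N \<ge> 2" unfolding N_def by linarith
    obtain C where C: "C \<ge> 0" "\<And>z. norm z \<le> L \<Longrightarrow> \<bar>h z\<bar> \<le> C * norm z ^ N" using flat_bound[OF h, of L N] by blast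
    have "\<bar>m z * h (\<psi> z)\<bar> \<le> (M * C * L ^ N) * (norm z)\<^sup>2" if z: "z \<noteq> 0" "norm z \<le> 1" for z
    proof -
      have "L * norm z \<le> L * 1" using z L by (intro mult_left_mono) auto
      with \<psi>L[OF z(1)] have "norm (\<psi> z) \<le> L" by linarith
      then have "\<bar>h (\<psi> z)\<bar> \<le> C * norm (\<psi> z) ^ N" by (rule C)
      also have "\<dots> \<le> C * (L * norm z) ^ N" using \<psi>L[OF z(1)] C by (intro mult_left_mono power_mono) auto
      finally have "\<bar>m z * h (\<psi> z)\<bar> \<le> (M * norm z powr d) * (C * (L * norm z) ^ N)"
        unfolding abs_mult using M z by (intro mult_mono) auto
      also have "\<dots> = (M * C * L ^ N) * norm z powr (d + real N)"
        using z by (simp add: powr_add powr_realpow power_mult_distrib)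
      also have "\<dots> \<le> (M * C * L ^ N) * norm z powr 2"
        using M C L N z by (intro mult_left_mono powr_mono') auto
      finally show ?thesis using z by simp
    qed
    then show ?thesis by blast
  qed
  have "Ck_on k UNIV (\<lambda>z. if z = 0 then 0 else m z * h (\<psi> z))"
    if m: "smooth_on (- {0}) m" "homog d m" and h: "flat h" for k m d h
    using that
  proof (induction k arbitrary: m d h)
    case (Suc k)
    let ?F = "\<lambda>m h z. if z = 0 then 0 else m z * h (\<psi> z)"
    have hs: "smooth_on UNIV h" using Suc.prems by (auto simp: flat_def)
    show ?case
    \<comment> \<open>Product and chain rule. Every summand is again of the shape \<open>?F\<close>,
      with a homogeneous factor of degree d - 1 or d and a flat function, which is why the induction
      generalises over m, d and h.\<close>
    proof (rule Ck_on_SucI[where f'="\<lambda>z v. ?F (dd v m) h z + (\<Sum>b\<in>Basis. ?F (\<lambda>z. m z * dd v (\<lambda>z. \<psi> z \<bullet> b) z) (dd b h) z)"])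
      fix v
      have mv: "smooth_on (- {0}) (dd v m)" "homog (d - 1) (dd v m)"
        using Suc.prems by (auto intro: smooth_on_frechet homog_dd)
      have pv: "smooth_on (- {0}) (\<lambda>z. m z * dd v (\<lambda>z. \<psi> z \<bullet> b) z)" "homog (d + (1 - 1)) (\<lambda>z. m z * dd v (\<lambda>z. \<psi> z \<bullet> b) z)"
        if "b \<in> Basis" for b
        using Suc.prems that by (auto intro!: smooth_on_mult smooth_on_frechet \<psi>s open_Compl)
         (use homog_mult[OF Suc.prems(2) homog_dd[OF \<psi>s[OF that] \<psi>h[OF that]]] in simp)
      show "Ck_on k UNIV (\<lambda>z. ?F (dd v m) h z + (\<Sum>b\<in>Basis. ?F (\<lambda>z. m z * dd v (\<lambda>z. \<psi> z \<bullet> b) z) (dd b h) z))"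
        by (rule Ck_on_add[OF Suc.IH[OF mv Suc.prems(3)] Ck_on_sum[OF Suc.IH[OF pv flat_dd[OF Suc.prems(3)]]]])
    next
      fix z :: 'a
      show "(?F m h has_derivative (\<lambda>v. ?F (dd v m) h z + (\<Sum>b\<in>Basis. ?F (\<lambda>z. m z * dd v (\<lambda>z. \<psi> z \<bullet> b) z) (dd b h) z))) (at z)"
      proof (cases "z = 0")
        case True
        obtain C where C: "\<And>z. z \<noteq> 0 \<Longrightarrow> norm z \<le> 1 \<Longrightarrow> \<bar>m z * h (\<psi> z)\<bar> \<le> C * (norm z)\<^sup>2"
          using est[OF Suc.prems] by blast
        have "(?F m h has_derivative (\<lambda>v. 0)) (at 0)"
        proof (rule has_derivativeI_sandwich[of 1 _ _ 0 _ "\<lambda>y. C * norm y"])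
          show "norm ((?F m h y - ?F m h 0 - 0)) / norm (y - 0) \<le> C * norm y"
            if "y \<noteq> 0" "dist y 0 < 1" for y
            using C[of y] that by (simp add: divide_le_eq power2_eq_square mult.assoc)
          have "((\<lambda>y::'a. norm y) \<longlongrightarrow> 0) (at 0)"
            using tendsto_norm_zero[OF tendsto_ident_at[of "0::'a" UNIV]] by simp
          then show "((\<lambda>y::'a. C * norm y) \<longlongrightarrow> 0) (at 0)" by (rule tendsto_mult_right_zero)
        qed auto
        then show ?thesis using True by simp
      next
        case False
        have "(\<psi> has_derivative (\<lambda>v. \<Sum>b\<in>Basis. dd v (\<lambda>z. \<psi> z \<bullet> b) z *\<^sub>R b)) (at z)"
          using smooth_on_has_derivative[OF \<psi>s, of _ z] False
          by (subst has_derivative_componentwise_within)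
             (simp add: inner_sum_left inner_Basis if_distrib sum.delta cong: if_cong)
        from has_derivative_compose[OF this smooth_on_has_derivative[OF hs UNIV_I]]
        have "((\<lambda>z. h (\<psi> z)) has_derivative (\<lambda>v. \<Sum>b\<in>Basis. dd v (\<lambda>z. \<psi> z \<bullet> b) z * dd b h (\<psi> z))) (at z)"
          using smooth_on_linear_frechet[OF hs, of "\<psi> z"] by (simp add: linear_sum linear_scale)
        from has_derivative_mult[OF smooth_on_has_derivative[OF Suc.prems(1), of z] this] False
        have "((\<lambda>z. m z * h (\<psi> z)) has_derivative (\<lambda>v. m z * (\<Sum>b\<in>Basis. dd v (\<lambda>z. \<psi> z \<bullet> b) z * dd b h (\<psi> z)) + dd v m z * h (\<psi> z))) (at z)"
          by auto
        then have "(?F m h has_derivative (\<lambda>v. m z * (\<Sum>b\<in>Basis. dd v (\<lambda>z. \<psi> z \<bullet> b) z * dd b h (\<psi> z)) + dd v m z * h (\<psi> z))) (at z)"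
          by (rule has_derivative_transform_within_open[where s="- {0}"]) (use False in auto)
        then show ?thesis using False by (simp add: sum_distrib_left mult.assoc add.commute)
      qed
    qed
  next
    case 0
    let ?F = "\<lambda>z. if z = 0 then 0 else m z * h (\<psi> z)"
    have hs: "smooth_on UNIV h" using 0 by (auto simp: flat_def)
    have "isCont ?F z" for z
    proof (cases "z = 0")
      case True
      obtain C where C: "\<And>z. z \<noteq> 0 \<Longrightarrow> norm z \<le> 1 \<Longrightarrow> \<bar>m z * h (\<psi> z)\<bar> \<le> C * (norm z)\<^sup>2"
        using est[OF 0] by blast
      have "(?F \<longlongrightarrow> 0) (at 0)"
      proof (rule tendsto_0_le[where K=1])
        have "((\<lambda>y::'a. norm y) \<longlongrightarrow> 0) (at 0)"
          using tendsto_norm_zero[OF tendsto_ident_at[of "0::'a" UNIV]] by simp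
        from tendsto_power[OF this, of 2]
        show "((\<lambda>z::'a. C * (norm z)\<^sup>2) \<longlongrightarrow> 0) (at 0)" by (intro tendsto_mult_right_zero) simp
        show "\<forall>\<^sub>F z in at 0. norm (?F z) \<le> norm (C * (norm z)\<^sup>2) * 1"
          unfolding eventually_at using C by (intro exI[of _ 1]) (auto simp: abs_le_iff intro: order_trans[OF _ abs_ge_self])
      qed
      then show ?thesis using True by (simp add: isCont_def)
    next
      case False
      have "smooth_on (- {0}) (\<lambda>z. m z * h (\<psi> z))"
        by (intro smooth_on_mult 0 smooth_on_compose[OF hs \<psi>s]) auto
      from smooth_on_continuous_on[OF this] have "continuous_on (- {0}) ?F"
        by (rule continuous_on_eq) auto
      then show ?thesis using False by (simp add: continuous_on_eq_continuous_at open_Compl)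
    qed
    then show ?case by (simp add: continuous_at_imp_continuous_on)
  qed
  from this[OF m h] show ?thesis by (auto simp: smooth_on_def)
qed

section \<open>Borel's lemma and Taylor expansion\<close>

lemma frechet_compose_scale:
  assumes "smooth_on UNIV q"
  shows "frechet_derivative (\<lambda>z. c * q (s *\<^sub>R z)) (at z) v = c * s * frechet_derivative q (at (s *\<^sub>R z)) v"
proof -
  have "((\<lambda>z. s *\<^sub>R z) has_derivative (\<lambda>v. s *\<^sub>R v)) (at z)" by (auto intro!: derivative_eq_intros)
  from has_derivative_compose[OF this smooth_on_has_derivative[OF assms UNIV_I]]
  have "((\<lambda>z. q (s *\<^sub>R z)) has_derivative (\<lambda>v. frechet_derivative q (at (s *\<^sub>R z)) (s *\<^sub>R v))) (at z)" .
  from has_derivative_mult_right[OF this, of c]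
  have "((\<lambda>z. c * q (s *\<^sub>R z)) has_derivative (\<lambda>v. c * frechet_derivative q (at (s *\<^sub>R z)) (s *\<^sub>R v))) (at z)" .
  then have "frechet_derivative (\<lambda>z. c * q (s *\<^sub>R z)) (at z) = (\<lambda>v. c * frechet_derivative q (at (s *\<^sub>R z)) (s *\<^sub>R v))"
    by (rule frechet_derivative_at[symmetric])
  then show ?thesis using smooth_on_linear_frechet[OF assms, of "s *\<^sub>R z"] by (simp add: linear_scale)
qed

primrec dds :: "'a::euclidean_space list \<Rightarrow> ('a \<Rightarrow> real) \<Rightarrow> 'a \<Rightarrow> real" where
  "dds [] f = f"
| "dds (v # vs) f = dds vs (dd v f)"

lemma smooth_on_dds: "smooth_on UNIV f \<Longrightarrow> smooth_on UNIV (dds vs f)"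
  by (induction vs arbitrary: f) (auto intro: smooth_on_frechet)

lemma smooth_on_scale:
  assumes "smooth_on UNIV q" shows "smooth_on UNIV (\<lambda>z. c * q (s *\<^sub>R z))"
proof (intro smooth_on_mult smooth_on_const smooth_on_compose[OF assms])
  show "smooth_on UNIV (\<lambda>x. s *\<^sub>R x \<bullet> b)" for b :: 'a
    by (intro smooth_on_bounded_linear bounded_linear_intros)
qed auto

lemma dds_scale:
  "smooth_on UNIV q \<Longrightarrow> dds vs (\<lambda>z. c * q (s *\<^sub>R z)) z = c * s ^ length vs * dds vs q (s *\<^sub>R z)"
proof (induction vs arbitrary: q c)
  case (Cons v vs)
  have "dds (v # vs) (\<lambda>z. c * q (s *\<^sub>R z)) z = dds vs (\<lambda>z. (c * s) * dd v q (s *\<^sub>R z)) z"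
    by (simp add: frechet_compose_scale[OF Cons.prems])
  also have "\<dots> = (c * s) * s ^ length vs * dds vs (dd v q) (s *\<^sub>R z)"
    by (intro Cons.IH smooth_on_frechet Cons.prems) auto
  finally show ?case by simp
qed auto

lemma dds_eq_zero_outside:
  assumes "open U" "\<And>z. z \<in> U \<Longrightarrow> f z = 0" "z \<in> U"
  shows "dds vs f z = 0"
  using assms(2,3)
proof (induction vs arbitrary: f z)
  case (Cons v vs)
  have "dd v f z = 0" if "z \<in> U" for z
  proof -
    have "((\<lambda>_. 0) has_derivative (\<lambda>_. 0)) (at z)" by auto
    then have "(f has_derivative (\<lambda>_. 0)) (at z)"
      by (rule has_derivative_transform_within_open[where s=U]) (use assms(1) that Cons.prems in auto)
    then show ?thesis by (simp add: frechet_derivative_at[symmetric])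
  qed
  then show ?case using Cons by auto
qed auto

text \<open>Weierstrass majorants for all iterated partial derivatives allow termwise
  differentiation. The derivative is expressed through basis vectors, so that the differentiated
  series satisfies the same hypothesis, with b put in front of the list.\<close>

lemma smooth_on_suminf:
  fixes p :: "nat \<Rightarrow> 'a::euclidean_space \<Rightarrow> real"
  assumes "\<And>d. smooth_on UNIV (p d)"
    and "\<And>vs. set vs \<subseteq> Basis \<Longrightarrow> \<exists>M. summable M \<and> (\<forall>d z. \<bar>dds vs (p d) z\<bar> \<le> M d)"
  shows "smooth_on UNIV (\<lambda>z. \<Sum>d. p d z)"
proof -
  have main: "\<exists>f'. (\<forall>z. ((\<lambda>z. \<Sum>d. p d z) has_derivative f' z) (at z)) \<and> 
      (\<forall>v. (\<lambda>z. f' z v) = (\<lambda>z. \<Sum>b\<in>Basis. (v \<bullet> b) * (\<Sum>d. dd b (p d) z)))"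
    if s: "\<And>d. smooth_on UNIV (p d)"
    and B: "\<And>vs. set vs \<subseteq> Basis \<Longrightarrow> \<exists>M. summable M \<and> (\<forall>d z. \<bar>dds vs (p d) z\<bar> \<le> M d)"
    for p :: "nat \<Rightarrow> 'a \<Rightarrow> real"
  proof -
    obtain M0 where M0: "summable M0" "\<And>d z. \<bar>p d z\<bar> \<le> M0 d" using B[of "[]"] by auto
    have "\<exists>M. summable M \<and> (\<forall>d z. \<bar>dd b (p d) z\<bar> \<le> M d)" if "b \<in> Basis" for b
      using B[of "[b]"] that by auto
    then obtain M where M: "\<And>b. b \<in> Basis \<Longrightarrow> summable (M b)" "\<And>b d z. b \<in> Basis \<Longrightarrow> \<bar>dd b (p d) z\<bar> \<le> M b d"
      by metis
    define f' where "f' = (\<lambda>z v. \<Sum>b\<in>Basis. (v \<bullet> b) * (\<Sum>d. dd b (p d) z))"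
    have sp: "summable (\<lambda>d. p d z)" for z
      using M0 by (intro summable_comparison_test'[OF M0(1), of 0]) auto
    have sd: "summable (\<lambda>d. dd b (p d) z)" if "b \<in> Basis" for b z
      using M(2)[OF that] by (intro summable_comparison_test'[OF M(1)[OF that], of 0]) auto
    have "\<exists>g. \<forall>x\<in>UNIV. (\<lambda>d. p d x) sums g x \<and> (g has_derivative f' x) (at x within UNIV)"
    proof (rule has_derivative_series)
      show "(p n has_derivative frechet_derivative (p n) (at x)) (at x within UNIV)" for n x
        using smooth_on_has_derivative[OF s UNIV_I] by simp
      show "(\<lambda>d. p d 0) sums suminf (\<lambda>d. p d 0)" using sp by (rule summable_sums)
      fix e :: real assume e: "e > 0"
      \<comment> \<open>The error splits into one contribution per basis vector, each to be kept
        below e / D times the norm of h.\<close>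
      define D where "D = real DIM('a)"
      have D: "D > 0" by (simp add: D_def)
      have "\<forall>\<^sub>F n in sequentially. \<forall>b\<in>Basis. suminf (\<lambda>k. M b (k + n)) < e / D"
      proof (intro eventually_ball_finite ballI)
        fix b :: 'a assume b: "b \<in> Basis"
        have "(\<lambda>n. suminf (\<lambda>k. M b (k + n))) \<longlonglongrightarrow> 0" by (rule suminf_exist_split2[OF M(1)[OF b]])
        then show "\<forall>\<^sub>F n in sequentially. suminf (\<lambda>k. M b (k + n)) < e / D"
          using e D by (intro order_tendstoD) auto
      qed auto
      then show "\<forall>\<^sub>F n in sequentially. \<forall>x\<in>UNIV. \<forall>h. norm ((\<Sum>i<n. frechet_derivative (p i) (at x) h) - f' x h) \<le> e * norm h"
      proof (eventually_elim, intro ballI allI)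
        fix n and x h :: 'a assume n: "\<forall>b\<in>Basis. suminf (\<lambda>k. M b (k + n)) < e / D"
        have "(\<Sum>i<n. frechet_derivative (p i) (at x) h) = (\<Sum>i<n. \<Sum>b\<in>Basis. (h \<bullet> b) * dd b (p i) x)"
          by (intro sum.cong refl frechet_eq_sum_dd[OF s UNIV_I])
        also have "\<dots> = (\<Sum>b\<in>Basis. (h \<bullet> b) * (\<Sum>i<n. dd b (p i) x))"
          by (subst sum.swap) (simp add: sum_distrib_left)
        finally have "(\<Sum>i<n. frechet_derivative (p i) (at x) h) - f' x h
            = (\<Sum>b\<in>Basis. (h \<bullet> b) * ((\<Sum>i<n. dd b (p i) x) - (\<Sum>d. dd b (p d) x)))"
          by (simp add: f'_def sum_subtractf right_diff_distrib)
        also have "norm \<dots> \<le> (\<Sum>b\<in>(Basis :: 'a set). norm h * (e / D))"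
        proof (rule order_trans[OF norm_sum sum_mono])
          fix b :: 'a assume b: "b \<in> Basis"
          have "(\<Sum>d. dd b (p d) x) = (\<Sum>d. dd b (p (d + n)) x) + (\<Sum>i<n. dd b (p i) x)"
            by (rule suminf_split_initial_segment[OF sd[OF b]])
          then have "\<bar>(\<Sum>i<n. dd b (p i) x) - (\<Sum>d. dd b (p d) x)\<bar> = \<bar>\<Sum>d. dd b (p (d + n)) x\<bar>" by simp
          also have "\<dots> \<le> (\<Sum>d. M b (d + n))"
          proof -
            have sM: "summable (\<lambda>d. M b (d + n))" using M(1)[OF b] by (simp add: summable_iff_shift)
            have "summable (\<lambda>d. \<bar>dd b (p (d + n)) x\<bar>)"
              using M(2)[OF b] by (intro summable_comparison_test'[OF sM, of 0]) auto
            then have "\<bar>\<Sum>d. dd b (p (d + n)) x\<bar> \<le> (\<Sum>d. \<bar>dd b (p (d + n)) x\<bar>)" by (rule summable_rabs)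
            also have "\<dots> \<le> (\<Sum>d. M b (d + n))"
              using M(2)[OF b] \<open>summable (\<lambda>d. \<bar>dd b (p (d + n)) x\<bar>)\<close> sM by (intro suminf_le) auto
            finally show ?thesis .
          qed
          also have "\<dots> \<le> e / D" using n b by (intro less_imp_le) auto
          finally show "norm ((h \<bullet> b) * ((\<Sum>i<n. dd b (p i) x) - (\<Sum>d. dd b (p d) x))) \<le> norm h * (e / D)"
            using Basis_le_norm[OF b, of h] by (simp only: real_norm_def abs_mult) (intro mult_mono, auto)
        qed
        also have "\<dots> = e * norm h" using D by (simp add: D_def)
        finally show "norm ((\<Sum>i<n. frechet_derivative (p i) (at x) h) - f' x h) \<le> e * norm h" .
      qed
    qed auto
    then obtain g where g: "\<And>x. (\<lambda>d. p d x) sums g x" "\<And>x. (g has_derivative f' x) (at x)" by auto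
    have "g = (\<lambda>z. \<Sum>d. p d z)" using sums_unique[OF g(1)] by auto
    with g(2) show ?thesis by (intro exI[of _ f']) (auto simp: f'_def)
  qed
  have "Ck_on k UNIV (\<lambda>z. \<Sum>d. p d z)"
    if s: "\<And>d. smooth_on UNIV (p d)"
    and B: "\<And>vs. set vs \<subseteq> Basis \<Longrightarrow> \<exists>M. summable M \<and> (\<forall>d z. \<bar>dds vs (p d) z\<bar> \<le> M d)"
    for p :: "nat \<Rightarrow> 'a \<Rightarrow> real" and k
    using that
  proof (induction k arbitrary: p)
    case 0
    from main[OF 0] obtain f' where "\<And>z. ((\<lambda>z. \<Sum>d. p d z) has_derivative f' z) (at z)" by blast
    then show ?case unfolding Ck_on.simps
      using continuous_at_imp_continuous_on has_derivative_continuous by blast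
  next
    case (Suc k)
    from main[OF Suc.prems] obtain f' where f': "\<And>z. ((\<lambda>z. \<Sum>d. p d z) has_derivative f' z) (at z)"
      "\<And>v. (\<lambda>z. f' z v) = (\<lambda>z. \<Sum>b\<in>Basis. (v \<bullet> b) * (\<Sum>d. dd b (p d) z))" by blast
    show ?case
    proof (rule Ck_on_SucI[OF f'(1)])
      fix v :: 'a
      have "Ck_on k UNIV (\<lambda>z. \<Sum>d. dd b (p d) z)" if b: "b \<in> Basis" for b
      proof (rule Suc.IH)
        show "smooth_on UNIV (dd b (p d))" for d using Suc.prems(1) by (rule smooth_on_frechet) simp
        show "\<exists>M. summable M \<and> (\<forall>d z. \<bar>dds vs (dd b (p d)) z\<bar> \<le> M d)" if "set vs \<subseteq> Basis" for vs
          using Suc.prems(2)[of "b # vs"] b that by simp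
      qed
      then show "Ck_on k UNIV (\<lambda>z. f' z v)"
        unfolding f'(2) by (intro Ck_on_sum Ck_on_mult Ck_on_const)
    qed
  qed
  from this[OF assms] show ?thesis by (auto simp: smooth_on_def)
qed

text \<open>Meant to be applied to a squared norm: it is then one on the ball of radius 1/2, whence
  the constant 1/4, and zero off the open unit ball.\<close>

definition cutoff :: "real \<Rightarrow> real" where
  "cutoff x = bump (1 - x) / (bump (1 - x) + bump (x - 1/4))"

lemma cutoff_pos: "bump (1 - x) + bump (x - 1/4) > 0"
  using bump_nonneg[of "1 - x"] bump_nonneg[of "x - 1/4"] bump_pos[of "1 - x"] bump_pos[of "x - 1/4"]
  by (cases "x < 1") (auto intro: add_nonneg_pos add_pos_nonneg)

lemma smooth_on_cutoff: "smooth_on U f \<Longrightarrow> open U \<Longrightarrow> smooth_on U (\<lambda>z. cutoff (f z))"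
  unfolding cutoff_def
  by (intro smooth_on_divide smooth_on_add smooth_on_bump_compose smooth_on_diff smooth_on_const cutoff_pos)

lemma cutoff_one: "x \<le> 1/4 \<Longrightarrow> cutoff x = 1" 
  using cutoff_pos[of x] by (simp add: cutoff_def bump_zero)

lemma cutoff_zero: "x \<ge> 1 \<Longrightarrow> cutoff x = 0" 
  by (simp add: cutoff_def bump_zero)

lemma cutoff_bounds: "0 \<le> cutoff x" "cutoff x \<le> 1" 
  using cutoff_pos[of x] bump_nonneg[of "1 - x"] bump_nonneg[of "x - 1/4"] by (auto simp: cutoff_def divide_le_eq)

lemma smooth_on_norm_sq: "smooth_on U (\<lambda>z::'a::euclidean_space. (norm z)\<^sup>2)"
proof -
  have "smooth_on U (\<lambda>z::'a. \<Sum>b\<in>Basis. (z \<bullet> b) ^ 2)"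
    by (intro smooth_on_sum smooth_on_power smooth_on_bounded_linear bounded_linear_intros)
  then show ?thesis by (simp add: norm_eq_sqrt_inner euclidean_inner[of _ _, symmetric] power2_eq_square flip: euclidean_inner)
qed

text \<open>The cut-off terms are rescalings \<open>\<epsilon>\<^sup>d q (z / \<epsilon>)\<close> of compactly supported functions \<open>q\<close>, so for small \<open>\<epsilon>\<close>
  all derivatives of the \<open>d\<close>-th term of order less than \<open>d\<close> are bounded by \<open>2\<^bsup>-d\<^esup>\<close>.\<close>

theorem borel_lemma:
  fixes f :: "nat \<Rightarrow> 'a::euclidean_space \<Rightarrow> real"
  assumes sm: "\<And>d. smooth_on UNIV (f d)" and hom: "\<And>d r z. f d (r *\<^sub>R z) = r ^ d * f d z"
  obtains F where "smooth_on UNIV F"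
    "\<And>n. \<exists>C. \<forall>z. norm z \<le> 1 \<longrightarrow> \<bar>F z - (\<Sum>d<n. f d z)\<bar> \<le> C * norm z ^ n"
    "\<And>z z'. norm z = norm z' \<Longrightarrow> (\<And>d. f d z = f d z') \<Longrightarrow> F z = F z'"
proof -
  have "\<exists>A. A \<ge> 0 \<and> (\<forall>z. \<bar>f d z\<bar> \<le> A * norm z ^ d)" for d
  proof -
    obtain A where A: "A \<ge> 0" "\<And>z. norm z \<le> 1 \<Longrightarrow> \<bar>f d z\<bar> \<le> A"
      using smooth_on_bounded_cball[OF sm, of 1] by metis
    have "\<bar>f d z\<bar> \<le> A * norm z ^ d" for z
    proof (cases "z = 0")
      case True
      show ?thesis using A(2)[of 0] hom[of d 0 0] True by (cases d) auto
    next
      case False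
      have "f d z = norm z ^ d * f d (z /\<^sub>R norm z)"
        using hom[of d "norm z" "z /\<^sub>R norm z"] False by simp
      then have "\<bar>f d z\<bar> = norm z ^ d * \<bar>f d (z /\<^sub>R norm z)\<bar>" by (simp add: abs_mult)
      also have "\<dots> \<le> norm z ^ d * A" using False by (intro mult_left_mono A) auto
      finally show ?thesis by (simp add: mult.commute)
    qed
    with A(1) show ?thesis by blast
  qed
  then obtain A where A: "\<And>d. A d \<ge> 0" "\<And>d z. \<bar>f d z\<bar> \<le> A d * norm z ^ d" by metis
  define q where "q = (\<lambda>d z. cutoff ((norm z)\<^sup>2) * f d z)"
  have qs: "smooth_on UNIV (q d)" for d
    unfolding q_def by (intro smooth_on_mult smooth_on_cutoff smooth_on_norm_sq sm open_UNIV)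
  have q0: "dds vs (q d) z = 0" if "norm z > 1" for vs d z
  proof (rule dds_eq_zero_outside[of "- cball 0 1"])
    show "q d z = 0" if "z \<in> - cball 0 1" for z
      using that by (simp add: q_def cutoff_zero)
  qed (use that in auto)
  have ex: "\<exists>K. K \<ge> 0 \<and> (\<forall>z. \<bar>dds vs (q d) z\<bar> \<le> K)" for vs d
  proof -
    obtain K where "K \<ge> 0" "\<And>z. norm z \<le> 1 \<Longrightarrow> \<bar>dds vs (q d) z\<bar> \<le> K"
      using smooth_on_bounded_cball[OF smooth_on_dds[OF qs], of 1] by metis
    then show ?thesis using q0 by (metis abs_zero linorder_not_less)
  qed
  define K where "K = (\<lambda>d vs. SOME K. K \<ge> 0 \<and> (\<forall>z. \<bar>dds vs (q d) z\<bar> \<le> K))"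
  have K: "K d vs \<ge> 0" "\<bar>dds vs (q d) z\<bar> \<le> K d vs" for d vs z
    using someI_ex[OF ex[of vs d]] by (auto simp: K_def)
  define W where "W = (\<lambda>d. {vs :: 'a list. set vs \<subseteq> Basis \<and> length vs \<le> d})"
  have W: "finite (W d)" for d unfolding W_def by (intro finite_lists_length_le finite_Basis)
  \<comment> \<open>One constant for all demands on the d-th term: the summand 1 keeps the radius at
    most 1, \<open>A d\<close> serves the remainder estimate and the sum of the
    \<open>K d vs\<close> the bounds on derivatives. The radius is chosen so that its product with
    \<open>H d\<close> is 2^(-d).\<close>
  define H where "H = (\<lambda>d. 1 + A d + (\<Sum>vs\<in>W d. K d vs))"
  have H: "H d \<ge> 1" "A d \<le> H d" "\<And>vs. vs \<in> W d \<Longrightarrow> K d vs \<le> H d" for d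
  proof -
    have s: "(\<Sum>vs\<in>W d. K d vs) \<ge> 0" by (intro sum_nonneg K)
    then show "H d \<ge> 1" "A d \<le> H d" using A(1)[of d] by (auto simp: H_def)
    fix vs assume "vs \<in> W d"
    then have "K d vs \<le> (\<Sum>vs\<in>W d. K d vs)" by (intro member_le_sum K W)
    then show "K d vs \<le> H d" using A(1)[of d] by (auto simp: H_def)
  qed
  define \<epsilon> where "\<epsilon> = (\<lambda>d. 1 / (2 ^ d * H d))"
  have \<epsilon>: "\<epsilon> d > 0" "\<epsilon> d \<le> 1" "\<epsilon> d * H d = (1/2) ^ d" for d
  proof -
    show "\<epsilon> d > 0" using H(1)[of d] by (simp add: \<epsilon>_def)
    have "1 * 1 \<le> 2 ^ d * H d" using H(1)[of d] by (intro mult_mono) auto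
    then show "\<epsilon> d \<le> 1" by (simp add: \<epsilon>_def)
    show "\<epsilon> d * H d = (1/2) ^ d" using H(1)[of d] by (simp add: \<epsilon>_def power_divide)
  qed
  define p where "p = (\<lambda>d z. \<epsilon> d ^ d * q d ((1 / \<epsilon> d) *\<^sub>R z))"
  have ps: "smooth_on UNIV (p d)" for d unfolding p_def by (intro smooth_on_scale qs)
  have pd: "dds vs (p d) z = \<epsilon> d ^ d * (1 / \<epsilon> d) ^ length vs * dds vs (q d) ((1 / \<epsilon> d) *\<^sub>R z)" for vs d z
    unfolding p_def by (rule dds_scale[OF qs])
  have p_eq: "p d z = cutoff ((norm z / \<epsilon> d)\<^sup>2) * f d z" for d z
  proof -
    have "\<epsilon> d ^ d * (1 / \<epsilon> d) ^ d = 1" using \<epsilon>(1)[of d] by (simp flip: power_mult_distrib)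
    then have "\<epsilon> d ^ d * f d ((1 / \<epsilon> d) *\<^sub>R z) = f d z" by (simp only: hom) (simp flip: mult.assoc)
    then show ?thesis using \<epsilon>(1)[of d] by (simp add: p_def q_def mult.left_commute)
  qed
  have bound: "\<exists>M. summable M \<and> (\<forall>d z. \<bar>dds vs (p d) z\<bar> \<le> M d)" if vs: "set vs \<subseteq> Basis" for vs
  proof -
    \<comment> \<open>Only the finitely many d up to \<open>length vs\<close> escape the uniform
      estimate; they do not affect summability.\<close>
    define M where "M = (\<lambda>d. if d \<le> length vs then \<epsilon> d ^ d * (1 / \<epsilon> d) ^ length vs * K d vs else (1/2) ^ d)"
    have "\<bar>dds vs (p d) z\<bar> \<le> M d" for d z
    proof -
      have "\<bar>dds vs (p d) z\<bar> = \<epsilon> d ^ d * (1 / \<epsilon> d) ^ length vs * \<bar>dds vs (q d) ((1 / \<epsilon> d) *\<^sub>R z)\<bar>"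
        unfolding pd abs_mult using \<epsilon>(1)[of d] by simp
      also have "\<dots> \<le> \<epsilon> d ^ d * (1 / \<epsilon> d) ^ length vs * K d vs"
        using \<epsilon>(1)[of d] by (intro mult_left_mono K) auto
      also have "\<dots> \<le> M d"
      proof (cases "d \<le> length vs")
        case False
        define e where "e = d - length vs"
        have e: "d = e + length vs" "1 \<le> e" using False by (auto simp: e_def)
        have "\<epsilon> d ^ (e + length vs) * (1 / \<epsilon> d) ^ length vs = \<epsilon> d ^ e"
          using \<epsilon>(1)[of d] by (simp add: power_add power_divide)
        then have "\<epsilon> d ^ d * (1 / \<epsilon> d) ^ length vs = \<epsilon> d ^ e" by (simp flip: e(1))
        also have "\<dots> \<le> \<epsilon> d" using \<epsilon>[of d] power_decreasing[OF e(2), of "\<epsilon> d"] by simp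
        finally have "\<epsilon> d ^ d * (1 / \<epsilon> d) ^ length vs * K d vs \<le> \<epsilon> d * H d"
          using \<epsilon>(1)[of d] K(1) False vs by (intro mult_mono H) (auto simp: W_def)
        then show ?thesis using False \<epsilon>(3)[of d] by (simp add: M_def)
      qed (simp add: M_def)
      finally show ?thesis .
    qed
    moreover have "summable M"
    proof (rule summable_cong[THEN iffD1])
      show "summable (\<lambda>d. (1/2::real) ^ d)" by (rule summable_geometric) simp
      show "\<forall>\<^sub>F d in sequentially. (1/2::real) ^ d = M d"
        using eventually_gt_at_top[of "length vs"] by eventually_elim (simp add: M_def)
    qed
    ultimately show ?thesis by blast
  qed
  define F where "F = (\<lambda>z. \<Sum>d. p d z)"
  show ?thesis
  proof (rule that[of F])
    show "smooth_on UNIV F" unfolding F_def by (rule smooth_on_suminf[OF ps bound])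
    \<comment> \<open>Each term depends on z only through its norm and \<open>f d z\<close>. Since
      tori act by isometries, this passes invariance of the polynomials on to their Borel
      sum.\<close>
    show "F z = F z'" if "norm z = norm z'" "\<And>d. f d z = f d z'" for z z'
      using that by (simp add: F_def p_eq)
    fix n
    \<comment> \<open>The three summands belong to the terms below n, the term n, and the tail.
      Below n the cutoff differs from one only if \<open>norm z\<close> exceeds half the radius, and
      then 1 is at most the n-th power of 2 \<open>norm z\<close> divided by the radius.\<close>
    define C where "C = (\<Sum>d<n. A d * (2 / \<epsilon> d) ^ n) + A n + 1"
    have "\<bar>F z - (\<Sum>d<n. f d z)\<bar> \<le> C * norm z ^ n" if z: "norm z \<le> 1" for z
    proof -
      obtain M0 where M0: "summable M0" "\<And>d z. \<bar>p d z\<bar> \<le> M0 d" using bound[of "[]"] by auto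
      have sp: "summable (\<lambda>d. p d z)"
        using M0 by (intro summable_comparison_test'[OF M0(1), of 0]) auto
      have pf: "\<bar>p d z\<bar> \<le> \<bar>f d z\<bar>" for d
        unfolding p_eq abs_mult using cutoff_bounds by (intro mult_left_le_one_le) auto
      \<comment> \<open>The n-th term is split off because the terms beyond it have a factor
        \<open>norm z\<close> to spare after n powers are extracted; on the support of the cutoff
        that factor is at most the radius, which makes the tail summable.\<close>
      have 1: "F z - (\<Sum>d<n. f d z) = (\<Sum>d. p (d + Suc n) z) + p n z + (\<Sum>d<n. p d z - f d z)"
        unfolding F_def suminf_split_initial_segment[OF sp, of "Suc n"] by (simp add: sum_subtractf)
      have 2: "\<bar>p d z - f d z\<bar> \<le> A d * (2 / \<epsilon> d) ^ n * norm z ^ n" for d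
      proof (cases "norm z \<le> \<epsilon> d / 2")
        case True
        then have "norm z / \<epsilon> d \<le> 1 / 2" using \<epsilon>(1)[of d] by (simp add: field_simps)
        then have "(norm z / \<epsilon> d)\<^sup>2 \<le> (1/2)\<^sup>2" using \<epsilon>(1)[of d] by (intro power_mono) auto
        then have "cutoff ((norm z / \<epsilon> d)\<^sup>2) = 1" by (intro cutoff_one) (simp add: power2_eq_square)
        then have "p d z = f d z" by (simp add: p_eq)
        then show ?thesis using A(1)[of d] \<epsilon>(1)[of d] by simp
      next
        case False
        have "\<bar>p d z - f d z\<bar> = (1 - cutoff ((norm z / \<epsilon> d)\<^sup>2)) * \<bar>f d z\<bar>"
        proof -
          have "p d z - f d z = - ((1 - cutoff ((norm z / \<epsilon> d)\<^sup>2)) * f d z)" by (simp add: p_eq algebra_simps)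
          then show ?thesis using cutoff_bounds by (simp add: abs_mult)
        qed
        also have "\<dots> \<le> 1 * \<bar>f d z\<bar>" using cutoff_bounds by (intro mult_right_mono) auto
        also have "\<dots> \<le> A d * norm z ^ d" using A(2) by simp
        also have "\<dots> \<le> A d * 1" using z A(1) by (intro mult_left_mono power_le_one) auto
        also have "\<dots> \<le> A d * (2 / \<epsilon> d * norm z) ^ n"
          using False \<epsilon>(1)[of d] by (intro mult_left_mono one_le_power A(1)) (simp add: field_simps)
        finally show ?thesis by (simp only: power_mult_distrib mult.assoc)
      qed
      have 3: "\<bar>p n z\<bar> \<le> A n * norm z ^ n" using pf[of n] A(2)[of n z] by linarith
      have 4: "\<bar>p (d + Suc n) z\<bar> \<le> norm z ^ n * (1/2) ^ Suc d" for d
      proof (cases "norm z \<le> \<epsilon> (d + Suc n)")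
        case True
        let ?d = "d + Suc n"
        have "\<bar>p ?d z\<bar> \<le> A ?d * norm z ^ ?d" using pf[of ?d] A(2)[of ?d z] by linarith
        also have "\<dots> = norm z ^ n * (A ?d * (norm z * norm z ^ d))" by (simp add: power_add)
        also have "\<dots> \<le> norm z ^ n * (H ?d * (\<epsilon> ?d * 1))"
          using True z H(1)[of ?d] \<epsilon>(1)[of ?d] by (intro mult_left_mono mult_mono H A power_le_one) auto
        also have "\<dots> = norm z ^ n * (1/2) ^ ?d" using \<epsilon>(3)[of ?d] by (simp add: mult.commute)
        also have "\<dots> \<le> norm z ^ n * (1/2) ^ Suc d"
          by (intro mult_left_mono power_decreasing) auto
        finally show ?thesis .
      next
        case False
        then have "norm z / \<epsilon> (d + Suc n) \<ge> 1" using \<epsilon>(1)[of "d + Suc n"] by (simp add: field_simps)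
        then have "cutoff ((norm z / \<epsilon> (d + Suc n))\<^sup>2) = 0" by (intro cutoff_zero one_le_power)
        then show ?thesis by (simp add: p_eq)
      qed
      have g: "(\<lambda>d. norm z ^ n * (1/2) ^ Suc d) sums (norm z ^ n * 1)"
        by (intro sums_mult power_half_series)
      have sa: "summable (\<lambda>d. \<bar>p (d + Suc n) z\<bar>)"
        using 4 by (intro summable_comparison_test'[OF sums_summable[OF g], of 0]) auto
      have "\<bar>\<Sum>d. p (d + Suc n) z\<bar> \<le> (\<Sum>d. \<bar>p (d + Suc n) z\<bar>)" by (rule summable_rabs[OF sa])
      also have "\<dots> \<le> (\<Sum>d. norm z ^ n * (1/2) ^ Suc d)" by (rule suminf_le[OF 4 sa sums_summable[OF g]])
      also have "\<dots> = norm z ^ n" using sums_unique[OF g] by simp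
      finally have 5: "\<bar>\<Sum>d. p (d + Suc n) z\<bar> \<le> norm z ^ n" .
      have "\<bar>\<Sum>d<n. p d z - f d z\<bar> \<le> (\<Sum>d<n. A d * (2 / \<epsilon> d) ^ n * norm z ^ n)"
        by (rule order_trans[OF sum_abs sum_mono[OF 2]])
      also have "\<dots> = (\<Sum>d<n. A d * (2 / \<epsilon> d) ^ n) * norm z ^ n" by (rule sum_distrib_right[symmetric])
      finally have 6: "\<bar>\<Sum>d<n. p d z - f d z\<bar> \<le> (\<Sum>d<n. A d * (2 / \<epsilon> d) ^ n) * norm z ^ n" .
      have "C * norm z ^ n = (\<Sum>d<n. A d * (2 / \<epsilon> d) ^ n) * norm z ^ n + A n * norm z ^ n + norm z ^ n"
        by (simp add: C_def algebra_simps)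
      then show ?thesis unfolding 1 using 3 5 6 by linarith
    qed
    then show "\<exists>C. \<forall>z. norm z \<le> 1 \<longrightarrow> \<bar>F z - (\<Sum>d<n. f d z)\<bar> \<le> C * norm z ^ n" by blast
  qed
qed

text \<open>The d-th derivative of g at x along z. Expanding it over basis vectors exhibits it as a
  homogeneous polynomial in z, see \<open>hom_poly_tay\<close>.\<close>

primrec tay :: "nat \<Rightarrow> ('a::euclidean_space \<Rightarrow> real) \<Rightarrow> 'a \<Rightarrow> 'a \<Rightarrow> real" where
  "tay 0 g z x = g x"
| "tay (Suc d) g z x = (\<Sum>b\<in>Basis. (z \<bullet> b) * tay d (dd b g) z x)"

lemma tay_deriv:
  "smooth_on UNIV g \<Longrightarrow> ((\<lambda>t. tay d g z (t *\<^sub>R z)) has_real_derivative tay (Suc d) g z (t *\<^sub>R z)) (at t)"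
proof (induction d arbitrary: g)
  case 0
  have "((\<lambda>t. g (0 + t *\<^sub>R z)) has_real_derivative dd z g (0 + t *\<^sub>R z)) (at t)"
    by (rule has_derivative_along_line[OF 0])
  then show ?case using frechet_eq_sum_dd[OF 0 UNIV_I, of "t *\<^sub>R z" z] by simp
next
  case (Suc d)
  have "((\<lambda>t. \<Sum>b\<in>Basis. (z \<bullet> b) * tay d (dd b g) z (t *\<^sub>R z)) has_real_derivative
      (\<Sum>b\<in>Basis. (z \<bullet> b) * tay (Suc d) (dd b g) z (t *\<^sub>R z))) (at t)"
    by (intro DERIV_sum DERIV_cmult Suc.IH smooth_on_frechet Suc.prems open_UNIV)
  then show ?case by (simp only: tay.simps(2)[of "Suc d"] tay.simps(2)[of d g])
qed

lemma tay_bound: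
  "smooth_on UNIV g \<Longrightarrow> \<exists>C\<ge>0. \<forall>x z. norm x \<le> 1 \<longrightarrow> \<bar>tay d g z x\<bar> \<le> C * norm z ^ d"
proof (induction d arbitrary: g)
  case 0
  then show ?case using smooth_on_bounded_cball[OF 0, of 1] by auto
next
  case (Suc d)
  have "\<exists>C\<ge>0. \<forall>x z. norm x \<le> 1 \<longrightarrow> \<bar>tay d (dd b g) z x\<bar> \<le> C * norm z ^ d" for b
    by (intro Suc.IH smooth_on_frechet Suc.prems open_UNIV)
  then obtain C where C: "\<And>b. C b \<ge> 0" "\<And>b x z. norm x \<le> 1 \<Longrightarrow> \<bar>tay d (dd b g) z x\<bar> \<le> C b * norm z ^ d" by metis
  have "\<bar>tay (Suc d) g z x\<bar> \<le> (\<Sum>b\<in>Basis. C b) * norm z ^ Suc d" if "norm x \<le> 1" for x z :: 'a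
  proof -
    have "\<bar>tay (Suc d) g z x\<bar> \<le> (\<Sum>b\<in>Basis. \<bar>z \<bullet> b\<bar> * \<bar>tay d (dd b g) z x\<bar>)"
      unfolding tay.simps abs_mult[symmetric] by (rule sum_abs)
    also have "\<dots> \<le> (\<Sum>b\<in>Basis. norm z * (C b * norm z ^ d))"
      by (intro sum_mono mult_mono C Basis_le_norm that) auto
    also have "\<dots> = (\<Sum>b\<in>Basis. C b) * norm z ^ Suc d" by (simp add: sum_distrib_right sum_distrib_left mult_ac)
    finally show ?thesis .
  qed
  then show ?case using C(1) by (intro exI[of _ "\<Sum>b\<in>Basis. C b"]) (auto intro: sum_nonneg)
qed

text \<open>Maclaurin's formula for the restriction of g to the segment from 0 to z, with
  \<open>tay_bound\<close> for the remainder.\<close>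

lemma taylor_expansion:
  assumes "smooth_on UNIV g"
  shows "\<exists>C. \<forall>z. norm z \<le> 1 \<longrightarrow> \<bar>g z - (\<Sum>d<n. tay d g z 0 / fact d)\<bar> \<le> C * norm z ^ n"
proof -
  obtain C where C: "C \<ge> 0" "\<And>x z. norm x \<le> 1 \<Longrightarrow> \<bar>tay n g z x\<bar> \<le> C * norm z ^ n" using tay_bound[OF assms] by metis
  have "\<bar>g z - (\<Sum>d<n. tay d g z 0 / fact d)\<bar> \<le> C * norm z ^ n" if z: "norm z \<le> 1" for z
  proof (cases "n = 0")
    case True
    then show ?thesis using C(2)[OF z, of z] by simp
  next
    case False
    have "\<exists>t>0. t < 1 \<and> tay 0 g z (1 *\<^sub>R z) = (\<Sum>m<n. tay m g z (0 *\<^sub>R z) / fact m * 1 ^ m) + tay n g z (t *\<^sub>R z) / fact n * 1 ^ n"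
      using False tay_deriv[OF assms]
      by (intro Maclaurin[where diff="\<lambda>d t. tay d g z (t *\<^sub>R z)"]) auto
    then obtain t where t: "0 < t" "t < 1" "g z - (\<Sum>d<n. tay d g z 0 / fact d) = tay n g z (t *\<^sub>R z) / fact n" by auto
    have "norm (t *\<^sub>R z) \<le> 1" using t z by (simp add: mult_le_one)
    then have "\<bar>tay n g z (t *\<^sub>R z)\<bar> \<le> C * norm z ^ n" by (rule C)
    moreover have "1 * \<bar>tay n g z (t *\<^sub>R z)\<bar> \<le> fact n * \<bar>tay n g z (t *\<^sub>R z)\<bar>"
      by (intro mult_right_mono fact_ge_1) auto
    then have "\<bar>tay n g z (t *\<^sub>R z) / fact n\<bar> \<le> \<bar>tay n g z (t *\<^sub>R z)\<bar>"
      by (simp add: abs_divide divide_le_eq mult.commute)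
    ultimately show ?thesis unfolding t(3) by linarith
  qed
  then show ?thesis by blast
qed

text \<open>A description of \<open>tay\<close> that does not refer to a basis; it makes the
  invariance of Taylor polynomials immediate.\<close>

lemma tay_eq_deriv:
  assumes "smooth_on UNIV g"
  shows "(deriv ^^ d) (\<lambda>t. g (t *\<^sub>R z)) = (\<lambda>t. tay d g z (t *\<^sub>R z))"
proof (induction d)
  case (Suc d)
  then show ?case using DERIV_imp_deriv[OF tay_deriv[OF assms]] by auto
qed simp

section \<open>Homogeneous polynomials\<close>

lemma finite_bounded_functions: "finite {f :: 'j::finite \<Rightarrow> nat. \<forall>j. f j \<le> d}"
proof -
  have "{f :: 'j \<Rightarrow> nat. \<forall>j. f j \<le> d} \<subseteq> PiE UNIV (\<lambda>_. {..d})" by auto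
  moreover have "finite (PiE (UNIV :: 'j set) (\<lambda>_. {..d}))" by (intro finite_PiE) auto
  ultimately show ?thesis by (rule finite_subset)
qed

definition deg_set :: "nat \<Rightarrow> (('j::finite \<Rightarrow> nat) \<times> ('j \<Rightarrow> nat)) set" where
  "deg_set d = {(a, b). sum a UNIV + sum b UNIV = d}"

lemma finite_deg_set: "finite (deg_set d :: (('j::finite \<Rightarrow> nat) \<times> ('j \<Rightarrow> nat)) set)"
proof (rule finite_subset)
  have le: "f j \<le> sum f UNIV" for f :: "'j \<Rightarrow> nat" and j by (rule member_le_sum) auto
  show "deg_set d \<subseteq> {f :: 'j \<Rightarrow> nat. \<forall>j. f j \<le> d} \<times> {f :: 'j \<Rightarrow> nat. \<forall>j. f j \<le> d}"
    unfolding deg_set_def using le by (fastforce intro: order_trans)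
qed (intro finite_cartesian_product finite_bounded_functions)

definition rmono :: "('j::finite \<Rightarrow> nat) \<Rightarrow> ('j \<Rightarrow> nat) \<Rightarrow> complex ^ 'j \<Rightarrow> real" where
  "rmono a b z = (\<Prod>j\<in>UNIV. Re (z $ j) ^ a j * Im (z $ j) ^ b j)"

lemma hom_poly_iff:
  "hom_poly d f \<longleftrightarrow> (\<exists>c. f = (\<lambda>z. \<Sum>(a, b)\<in>deg_set d. c (a, b) * rmono a b z))"
  unfolding hom_poly_def deg_set_def rmono_def by (simp add: fun_eq_iff)

lemma hom_poly_rmono:
  assumes "sum a UNIV + sum b UNIV = d" shows "hom_poly d (rmono a b)"
proof -
  have "(\<Sum>(a', b')\<in>deg_set d. (if (a', b') = (a, b) then 1 else 0) * rmono a' b' z) = rmono a b z" for z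
  proof -
    have "(\<Sum>(a', b')\<in>deg_set d. (if (a', b') = (a, b) then 1 else 0) * rmono a' b' z)
      = (\<Sum>ab\<in>deg_set d. if ab = (a, b) then rmono a b z else 0)"
      by (intro sum.cong) (auto split: if_splits)
    also have "\<dots> = rmono a b z" using assms by (simp add: finite_deg_set) (simp add: deg_set_def)
    finally show ?thesis .
  qed
  then show ?thesis unfolding hom_poly_iff by (intro exI[of _ "\<lambda>ab. if ab = (a, b) then 1 else 0"]) (simp add: fun_eq_iff)
qed

lemma hom_poly_add: assumes "hom_poly d f" "hom_poly d g" shows "hom_poly d (\<lambda>z. f z + g z)"
proof -
  obtain c c' where "f = (\<lambda>z. \<Sum>(a, b)\<in>deg_set d. c (a, b) * rmono a b z)"
    "g = (\<lambda>z. \<Sum>(a, b)\<in>deg_set d. c' (a, b) * rmono a b z)" using assms unfolding hom_poly_iff by blast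
  then show ?thesis unfolding hom_poly_iff
    by (intro exI[of _ "\<lambda>ab. c ab + c' ab"]) (simp add: sum.distrib distrib_right case_prod_unfold)
qed

lemma hom_poly_cmult: assumes "hom_poly d f" shows "hom_poly d (\<lambda>z. k * f z)"
proof -
  obtain c where "f = (\<lambda>z. \<Sum>(a, b)\<in>deg_set d. c (a, b) * rmono a b z)" using assms unfolding hom_poly_iff by blast
  then show ?thesis unfolding hom_poly_iff
    by (intro exI[of _ "\<lambda>ab. k * c ab"]) (simp add: sum_distrib_left case_prod_unfold mult.assoc)
qed

lemma hom_poly_diff: "hom_poly d f \<Longrightarrow> hom_poly d g \<Longrightarrow> hom_poly d (\<lambda>z. f z - g z)"
  using hom_poly_add[of d f "\<lambda>z. -1 * g z"] hom_poly_cmult[of d g "-1"] by simp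

lemma hom_poly_const: "hom_poly 0 (\<lambda>z. k)"
  using hom_poly_cmult[OF hom_poly_rmono[of "\<lambda>_. 0" "\<lambda>_. 0" 0], of k] by (simp add: rmono_def)

lemma hom_poly_zero: "hom_poly d (\<lambda>z. 0)"
  unfolding hom_poly_iff by (intro exI[of _ "\<lambda>_. 0"]) simp

lemma hom_poly_sum: "(\<And>i. i \<in> I \<Longrightarrow> hom_poly d (f i)) \<Longrightarrow> hom_poly d (\<lambda>z. \<Sum>i\<in>I. f i z)"
  by (induction I rule: infinite_finite_induct) (auto intro: hom_poly_zero hom_poly_add)

lemma rmono_mult: "rmono a b z * rmono a' b' z = rmono (\<lambda>j. a j + a' j) (\<lambda>j. b j + b' j) z"
  by (simp add: rmono_def power_add mult_ac flip: prod.distrib)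

lemma hom_poly_mult: assumes "hom_poly d f" "hom_poly e g" shows "hom_poly (d + e) (\<lambda>z. f z * g z)"
proof -
  obtain c c' where f: "f = (\<lambda>z. \<Sum>(a, b)\<in>deg_set d. c (a, b) * rmono a b z)"
    and g: "g = (\<lambda>z. \<Sum>(a, b)\<in>deg_set e. c' (a, b) * rmono a b z)" using assms unfolding hom_poly_iff by blast
  have eq: "(\<lambda>z. f z * g z) = (\<lambda>z. \<Sum>ab\<in>deg_set d. \<Sum>ab'\<in>deg_set e. (c ab * c' ab') *
      rmono (\<lambda>j. fst ab j + fst ab' j) (\<lambda>j. snd ab j + snd ab' j) z)"
    unfolding f g sum_product case_prod_unfold rmono_mult[symmetric]
    by (intro ext sum.cong refl) (simp add: mult_ac)
  show ?thesis unfolding eq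
    by (intro hom_poly_sum hom_poly_cmult hom_poly_rmono) (auto simp: deg_set_def sum.distrib)
qed

lemma hom_poly_power: "hom_poly d f \<Longrightarrow> hom_poly (k * d) (\<lambda>z. f z ^ k)"
proof (induction k)
  case (Suc k) then show ?case using hom_poly_mult[of d f "k * d" "\<lambda>z. f z ^ k"] by simp
qed (use hom_poly_const[of 1] in simp)

lemma hom_poly_prod:
  "finite I \<Longrightarrow> (\<And>i. i \<in> I \<Longrightarrow> hom_poly (d i) (f i)) \<Longrightarrow> hom_poly (sum d I) (\<lambda>z. \<Prod>i\<in>I. f i z)"
proof (induction I rule: finite_induct)
  case (insert i I) 
  then show ?case using hom_poly_mult[of "d i" "f i" "sum d I" "\<lambda>z. \<Prod>i\<in>I. f i z"] by simp
qed (use hom_poly_const[of 1] in simp)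

lemma rmono_single: "rmono (\<lambda>j. if j = i then 1 else 0) (\<lambda>_. 0) z = Re (z $ i)"
  "rmono (\<lambda>_. 0) (\<lambda>j. if j = i then 1 else 0) z = Im (z $ i)"
proof -
  have "rmono (\<lambda>j. if j = i then 1 else 0) (\<lambda>_. 0) z = (\<Prod>j\<in>UNIV. if j = i then Re (z $ j) else 1)"
    unfolding rmono_def by (intro prod.cong) auto
  then show "rmono (\<lambda>j. if j = i then 1 else 0) (\<lambda>_. 0) z = Re (z $ i)" by simp
  have "rmono (\<lambda>_. 0) (\<lambda>j. if j = i then 1 else 0) z = (\<Prod>j\<in>UNIV. if j = i then Im (z $ j) else 1)"
    unfolding rmono_def by (intro prod.cong) auto
  then show "rmono (\<lambda>_. 0) (\<lambda>j. if j = i then 1 else 0) z = Im (z $ i)" by simp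
qed

lemma hom_poly_Re: "hom_poly 1 (\<lambda>z. Re (z $ i))" and hom_poly_Im: "hom_poly 1 (\<lambda>z. Im (z $ i))"
  using hom_poly_rmono[of "\<lambda>j. if j = i then 1 else 0" "\<lambda>_. 0" 1] hom_poly_rmono[of "\<lambda>_. 0" "\<lambda>j. if j = i then 1 else 0" 1]
  unfolding rmono_single[abs_def] by simp_all

lemma hom_poly_compose:
  assumes "hom_poly d f" "\<And>j. hom_poly 1 (\<lambda>z. Re (\<phi> z $ j))" "\<And>j. hom_poly 1 (\<lambda>z. Im (\<phi> z $ j))"
  shows "hom_poly d (\<lambda>z. f (\<phi> z))"
proof -
  obtain c where f: "f = (\<lambda>z. \<Sum>(a, b)\<in>deg_set d. c (a, b) * rmono a b z)" using assms unfolding hom_poly_iff by blast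
  have "hom_poly d (\<lambda>z. rmono a b (\<phi> z))" if "(a, b) \<in> deg_set d" for a b
  proof -
    have "hom_poly (\<Sum>j\<in>UNIV. a j * 1 + b j * 1) (\<lambda>z. rmono a b (\<phi> z))"
      unfolding rmono_def by (intro hom_poly_prod hom_poly_mult hom_poly_power assms) auto
    then show ?thesis using that by (simp add: deg_set_def sum.distrib)
  qed
  then show ?thesis unfolding f case_prod_unfold by (intro hom_poly_sum hom_poly_cmult) auto
qed

lemma bounded_linear_Re_nth: "bounded_linear (\<lambda>z :: complex ^ 'j::finite. Re (z $ j))"
  by (rule bounded_linear_compose[OF bounded_linear_Re bounded_linear_vec_nth])

lemma bounded_linear_Im_nth: "bounded_linear (\<lambda>z :: complex ^ 'j::finite. Im (z $ j))"
  by (rule bounded_linear_compose[OF bounded_linear_Im bounded_linear_vec_nth])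

lemma smooth_on_hom_poly: "hom_poly d f \<Longrightarrow> smooth_on U f"
  unfolding hom_poly_iff rmono_def case_prod_unfold
  by (auto intro!: smooth_on_sum smooth_on_mult smooth_on_prod smooth_on_power
       smooth_on_bounded_linear[OF bounded_linear_Re_nth] smooth_on_bounded_linear[OF bounded_linear_Im_nth])

lemma hom_poly_scale:
  assumes "hom_poly d f" shows "f (r *\<^sub>R z) = r ^ d * f z"
proof -
  obtain c where f: "f = (\<lambda>z. \<Sum>(a, b)\<in>deg_set d. c (a, b) * rmono a b z)" using assms unfolding hom_poly_iff by blast
  have "rmono a b (r *\<^sub>R z) = r ^ d * rmono a b z" if "(a, b) \<in> deg_set d" for a b
  proof -
    have "rmono a b (r *\<^sub>R z) = (\<Prod>j\<in>UNIV. r ^ (a j + b j) * (Re (z $ j) ^ a j * Im (z $ j) ^ b j))"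
      unfolding rmono_def by (intro prod.cong) (auto simp: power_mult_distrib power_add)
    also have "\<dots> = r ^ d * rmono a b z"
      using that by (simp add: prod.distrib rmono_def power_sum[symmetric] deg_set_def sum.distrib)
    finally show ?thesis .
  qed
  then show ?thesis unfolding f by (auto simp: sum_distrib_left intro!: sum.cong)
qed

section \<open>Complex-valued polynomials, monomials and weights\<close>

definition chom_poly :: "nat \<Rightarrow> (complex ^ 'j::finite \<Rightarrow> complex) \<Rightarrow> bool" where
  "chom_poly d f \<longleftrightarrow> hom_poly d (\<lambda>z. Re (f z)) \<and> hom_poly d (\<lambda>z. Im (f z))"

lemma chom_poly_const: "chom_poly 0 (\<lambda>z. k)" by (simp add: chom_poly_def hom_poly_const)
lemma chom_poly_zero: "chom_poly d (\<lambda>z. 0)" by (simp add: chom_poly_def hom_poly_zero)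
lemma chom_poly_nth: "chom_poly 1 (\<lambda>z. z $ j)" unfolding chom_poly_def by (intro conjI hom_poly_Re hom_poly_Im)
lemma chom_poly_cnj: "chom_poly d f \<Longrightarrow> chom_poly d (\<lambda>z. cnj (f z))"
  using hom_poly_cmult[of d "\<lambda>z. Im (f z)" "-1"] by (simp add: chom_poly_def)
lemma chom_poly_add: "chom_poly d f \<Longrightarrow> chom_poly d g \<Longrightarrow> chom_poly d (\<lambda>z. f z + g z)"
  by (simp add: chom_poly_def hom_poly_add)
lemma chom_poly_mult: "chom_poly d f \<Longrightarrow> chom_poly e g \<Longrightarrow> chom_poly (d + e) (\<lambda>z. f z * g z)"
  unfolding chom_poly_def by (auto intro!: hom_poly_add hom_poly_diff hom_poly_mult)
lemma chom_poly_cmult: "chom_poly d f \<Longrightarrow> chom_poly d (\<lambda>z. k * f z)"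
  using chom_poly_mult[OF chom_poly_const] by simp
lemma chom_poly_sum: "(\<And>i. i \<in> I \<Longrightarrow> chom_poly d (f i)) \<Longrightarrow> chom_poly d (\<lambda>z. \<Sum>i\<in>I. f i z)"
  by (induction I rule: infinite_finite_induct) (auto intro: chom_poly_zero chom_poly_add)
lemma chom_poly_power: "chom_poly d f \<Longrightarrow> chom_poly (k * d) (\<lambda>z. f z ^ k)"
proof (induction k)
  case (Suc k) then show ?case using chom_poly_mult[of d f "k * d" "\<lambda>z. f z ^ k"] by simp
qed (use chom_poly_const[of 1] in simp)
lemma chom_poly_prod:
  "finite I \<Longrightarrow> (\<And>i. i \<in> I \<Longrightarrow> chom_poly (d i) (f i)) \<Longrightarrow> chom_poly (sum d I) (\<lambda>z. \<Prod>i\<in>I. f i z)"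
proof (induction I rule: finite_induct)
  case (insert i I) 
  then show ?case using chom_poly_mult[of "d i" "f i" "sum d I" "\<lambda>z. \<Prod>i\<in>I. f i z"] by simp
qed (use chom_poly_const[of 1] in simp)

definition cmono :: "('j::finite \<Rightarrow> nat) \<Rightarrow> ('j \<Rightarrow> nat) \<Rightarrow> complex ^ 'j \<Rightarrow> complex" where
  "cmono p q z = (\<Prod>j\<in>UNIV. (z $ j) ^ p j * cnj (z $ j) ^ q j)"

text \<open>Unlike the real monomials \<open>rmono\<close>, monomials in the coordinates and their
  conjugates are eigenvectors of the torus action, so invariance becomes a condition P on the
  exponents.\<close>

inductive cspan :: "(('j::finite \<Rightarrow> nat) \<Rightarrow> ('j \<Rightarrow> nat) \<Rightarrow> bool) \<Rightarrow> (complex ^ 'j \<Rightarrow> complex) \<Rightarrow> bool"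
  for P where
  cspan_zero: "cspan P (\<lambda>z. 0)"
| cspan_mono: "P p q \<Longrightarrow> cspan P (\<lambda>z. k * cmono p q z)"
| cspan_add: "cspan P f \<Longrightarrow> cspan P g \<Longrightarrow> cspan P (\<lambda>z. f z + g z)"

lemma cspan_cmult: "cspan P f \<Longrightarrow> cspan P (\<lambda>z. k * f z)"
proof (induction rule: cspan.induct)
  case (cspan_mono p q k')
  then show ?case using cspan.cspan_mono[of P p q "k * k'"] by (simp add: mult.assoc)
qed (auto simp: distrib_left intro: cspan.intros)

lemma cspan_sum: "(\<And>i. i \<in> I \<Longrightarrow> cspan P (f i)) \<Longrightarrow> cspan P (\<lambda>z. \<Sum>i\<in>I. f i z)"
  by (induction I rule: infinite_finite_induct) (auto intro: cspan.intros)

lemma cspan_mult: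
  assumes R: "\<And>p q p' q'. P p q \<Longrightarrow> Q p' q' \<Longrightarrow> R (\<lambda>j. p j + p' j) (\<lambda>j. q j + q' j)"
  assumes "cspan P f" "cspan Q g"
  shows "cspan R (\<lambda>z. f z * g z)"
  using assms(2)
proof (induction rule: cspan.induct)
  case (cspan_mono p q k)
  have "cspan R (\<lambda>z. cmono p q z * g z)"
    using assms(3)
  proof (induction rule: cspan.induct)
    case (cspan_mono p' q' k')
    have "(\<lambda>z. cmono p q z * (k' * cmono p' q' z)) = (\<lambda>z. k' * cmono (\<lambda>j. p j + p' j) (\<lambda>j. q j + q' j) z)"
      by (simp add: cmono_def fun_eq_iff power_add prod.distrib mult_ac)
    then show ?case using R[OF \<open>P p q\<close> \<open>Q p' q'\<close>] by (simp add: cspan.cspan_mono)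
  qed (auto simp: distrib_left intro: cspan.intros)
  from cspan_cmult[OF this, of k] show ?case by (simp add: mult.assoc)
qed (auto simp: distrib_right intro: cspan.intros)

definition has_deg :: "nat \<Rightarrow> ('j::finite \<Rightarrow> nat) \<Rightarrow> ('j \<Rightarrow> nat) \<Rightarrow> bool" where
  "has_deg d p q \<longleftrightarrow> sum p UNIV + sum q UNIV = d"

lemma cspan_deg_mult: "cspan (has_deg d) f \<Longrightarrow> cspan (has_deg e) g \<Longrightarrow> cspan (has_deg (d + e)) (\<lambda>z. f z * g z)"
  by (rule cspan_mult[of "has_deg d" "has_deg e"]) (auto simp: has_deg_def sum.distrib)

lemma cspan_deg_const: "cspan (has_deg 0) (\<lambda>z. k)"
  using cspan_mono[of "has_deg 0" "\<lambda>_. 0" "\<lambda>_. 0" k] by (simp add: has_deg_def cmono_def)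

lemma cspan_deg_power: "cspan (has_deg d) f \<Longrightarrow> cspan (has_deg (k * d)) (\<lambda>z. f z ^ k)"
proof (induction k)
  case (Suc k) then show ?case using cspan_deg_mult[of d f "k * d" "\<lambda>z. f z ^ k"] by simp
qed (use cspan_deg_const[of 1] in simp)

lemma cspan_deg_prod:
  "finite I \<Longrightarrow> (\<And>i. i \<in> I \<Longrightarrow> cspan (has_deg (d i)) (f i)) \<Longrightarrow> cspan (has_deg (sum d I)) (\<lambda>z. \<Prod>i\<in>I. f i z)"
proof (induction I rule: finite_induct)
  case (insert i I) 
  then show ?case using cspan_deg_mult[of "d i" "f i" "sum d I" "\<lambda>z. \<Prod>i\<in>I. f i z"] by simp
qed (use cspan_deg_const[of 1] in simp)

lemma cmono_single: "cmono (\<lambda>j. if j = i then 1 else 0) (\<lambda>_. 0) z = z $ i"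
  "cmono (\<lambda>_. 0) (\<lambda>j. if j = i then 1 else 0) z = cnj (z $ i)"
proof -
  have "cmono (\<lambda>j. if j = i then 1 else 0) (\<lambda>_. 0) z = (\<Prod>j\<in>UNIV. if j = i then z $ j else 1)"
    unfolding cmono_def by (intro prod.cong) auto
  then show "cmono (\<lambda>j. if j = i then 1 else 0) (\<lambda>_. 0) z = z $ i" by simp
  have "cmono (\<lambda>_. 0) (\<lambda>j. if j = i then 1 else 0) z = (\<Prod>j\<in>UNIV. if j = i then cnj (z $ j) else 1)"
    unfolding cmono_def by (intro prod.cong) auto
  then show "cmono (\<lambda>_. 0) (\<lambda>j. if j = i then 1 else 0) z = cnj (z $ i)" by simp
qed

lemma cspan_nth: "cspan (has_deg 1) (\<lambda>z. k * z $ i)" and cspan_cnj_nth: "cspan (has_deg 1) (\<lambda>z. k * cnj (z $ i))"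
  using cspan_mono[of "has_deg 1" "\<lambda>j. if j = i then 1 else 0" "\<lambda>_. 0" k]
    cspan_mono[of "has_deg 1" "\<lambda>_. 0" "\<lambda>j. if j = i then 1 else 0" k]
  by (simp_all only: cmono_single) (simp_all add: has_deg_def)

lemma cspan_Re: "cspan (has_deg 1) (\<lambda>z. of_real (Re (z $ i)))"
proof -
  have "(\<lambda>z. complex_of_real (Re (z $ i))) = (\<lambda>z. (1/2) * z $ i + (1/2) * cnj (z $ i))"
    by (simp add: fun_eq_iff complex_eq_iff)
  then show ?thesis by (simp only: cspan_add[OF cspan_nth cspan_cnj_nth])
qed

lemma cspan_Im: "cspan (has_deg 1) (\<lambda>z. of_real (Im (z $ i)))"
proof -
  have "(\<lambda>z. complex_of_real (Im (z $ i))) = (\<lambda>z. (- \<i>/2) * z $ i + (\<i>/2) * cnj (z $ i))"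
    by (simp add: fun_eq_iff complex_eq_iff)
  then show ?thesis by (simp only: cspan_add[OF cspan_nth cspan_cnj_nth])
qed

lemma cspan_hom_poly:
  assumes "hom_poly d f" shows "cspan (has_deg d) (\<lambda>z. of_real (f z))"
proof -
  obtain c where f: "f = (\<lambda>z. \<Sum>(a, b)\<in>deg_set d. c (a, b) * rmono a b z)" using assms unfolding hom_poly_iff by blast
  have "cspan (has_deg d) (\<lambda>z. of_real (rmono a b z))" if "(a, b) \<in> deg_set d" for a b
  proof -
    have "cspan (has_deg (\<Sum>j\<in>UNIV. a j * 1 + b j * 1)) (\<lambda>z. of_real (rmono a b z))"
      unfolding rmono_def of_real_prod of_real_mult of_real_power
      by (intro cspan_deg_prod cspan_deg_mult cspan_deg_power cspan_Re cspan_Im) auto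
    then show ?thesis using that by (simp add: deg_set_def sum.distrib)
  qed
  then show ?thesis unfolding f case_prod_unfold of_real_sum of_real_mult
    by (intro cspan_sum cspan_cmult) auto
qed

text \<open>The exponent of the character by which the circle acts on \<open>cmono p q\<close>;
  conjugated coordinates count negatively.\<close>

definition weight :: "(unit, 'j::finite) wmatrix \<Rightarrow> ('j \<Rightarrow> nat) \<Rightarrow> ('j \<Rightarrow> nat) \<Rightarrow> int" where
  "weight B p q = (\<Sum>j\<in>UNIV. B () j * (int (p j) - int (q j)))"

lemma powi_prod_distrib: "(\<Prod>i\<in>I. f i) powi k = (\<Prod>i\<in>I. (f i :: complex) powi k)"
  by (induction I rule: infinite_finite_induct) (auto simp: power_int_mult_distrib)

lemma powi_sum: "(x::complex) \<noteq> 0 \<Longrightarrow> x powi (\<Sum>i\<in>I. f i) = (\<Prod>i\<in>I. x powi f i)"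
  by (induction I rule: infinite_finite_induct) (auto simp: power_int_add)

lemma cmod_1_nonzero: "cmod x = 1 \<Longrightarrow> x \<noteq> 0"
  by auto

lemma cnj_unit: "cmod x = 1 \<Longrightarrow> cnj x = inverse x"
  by (metis complex_mod_mult_cnj inverse_unique of_real_1 power_one complex_norm_square)

lemma cmono_act:
  assumes "cmod (t $ ()) = 1"
  shows "cmono p q (act B t z) = (t $ ()) powi weight B p q * cmono p q z"
proof -
  let ?s = "t $ ()"
  have nz: "?s \<noteq> 0" using assms by auto
  have "cmono p q (act B t z) = (\<Prod>j\<in>UNIV. ?s powi (B () j * (int (p j) - int (q j))) * ((z $ j) ^ p j * cnj (z $ j) ^ q j))"
    unfolding cmono_def
  proof (intro prod.cong refl)
    fix j
    have 1: "act B t z $ j = ?s powi B () j * z $ j" by (simp add: act_def UNIV_unit)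
    have "?s powi (B () j * (int (p j) - int (q j))) = (?s powi B () j) ^ p j * inverse (?s powi B () j) ^ q j"
      using nz by (simp add: power_int_mult power_int_diff power_inverse divide_inverse)
    moreover have "cnj (?s powi B () j) = inverse (?s powi B () j)"
      using assms by (intro cnj_unit) (simp add: norm_power_int)
    ultimately show "act B t z $ j ^ p j * cnj (act B t z $ j) ^ q j =
       ?s powi (B () j * (int (p j) - int (q j))) * ((z $ j) ^ p j * cnj (z $ j) ^ q j)"
      unfolding 1 complex_cnj_mult power_mult_distrib by (simp add: mult_ac)
  qed
  then show ?thesis by (simp add: prod.distrib cmono_def weight_def powi_sum[OF nz])
qed

text \<open>For nonzero w the bound prevents N from dividing w, so this is a geometric sum whose
  ratio is an N-th root of unity other than 1.\<close>

lemma sum_roots_of_unity: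
  assumes "\<bar>w\<bar> < int N"
  shows "(\<Sum>k<N. cis (2 * pi * real k / real N) powi w) = (if w = 0 then of_nat N else 0)"
proof (cases "w = 0")
  case False
  have N: "N > 0" using assms by auto
  define x where "x = cis (2 * pi * real_of_int w / real N)"
  have "(\<Sum>k<N. cis (2 * pi * real k / real N) powi w) = (\<Sum>k<N. x ^ k)"
  proof (intro sum.cong refl)
    fix k
    have "cis (2 * pi * real k / real N) powi w = cis (real k * (2 * pi * real_of_int w / real N))"
      by (simp add: cis_power_int mult_ac)
    then show "cis (2 * pi * real k / real N) powi w = x ^ k" by (simp only: x_def Complex.DeMoivre)
  qed
  moreover have "x \<noteq> 1"
  proof
    assume "x = 1"
    then have "cos (2 * pi * real_of_int w / real N) = 1" by (simp add: x_def cis.code complex_eq_iff)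
    then obtain n :: int where "2 * pi * real_of_int w / real N = n * 2 * pi" unfolding cos_one_2pi_int by auto
    then have "real_of_int w = real_of_int n * real N" using N by (simp add: field_simps)
    then have w: "w = n * int N" by (metis of_int_eq_iff of_int_mult of_int_of_nat_eq)
    with False have "n \<noteq> 0" by auto
    then have "1 * int N \<le> \<bar>n\<bar> * int N" by (intro mult_right_mono) auto
    then show False using assms w by (simp add: abs_mult)
  qed
  moreover have "x ^ N = 1" using N by (simp add: x_def Complex.DeMoivre)
  ultimately show ?thesis using False by (simp add: geometric_sum)
qed auto

text \<open>Averaging over the \<open>N\<close>-th roots of unity kills every monomial of nonzero weight once \<open>N\<close>
  exceeds all the weights that occur.\<close>

lemma invariant_hom_poly_cspan:
  fixes g :: "complex ^ 'j::finite \<Rightarrow> real"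
  assumes "hom_poly d g" "invariant B g"
  shows "cspan (\<lambda>p q. has_deg d p q \<and> weight B p q = 0) (\<lambda>z. of_real (g z))"
proof -
  define N where "N = Suc (\<Sum>(p, q)\<in>deg_set d. nat \<bar>weight B p q\<bar>)"
  have N: "\<bar>weight B p q\<bar> < int N" if "has_deg d p q" for p q
  proof -
    have "(p, q) \<in> deg_set d" using that by (simp add: has_deg_def deg_set_def)
    then have "(\<lambda>(p, q). nat \<bar>weight B p q\<bar>) (p, q) \<le> (\<Sum>(p, q)\<in>deg_set d. nat \<bar>weight B p q\<bar>)"
      by (intro member_le_sum finite_deg_set) auto
    then have "nat \<bar>weight B p q\<bar> < N" unfolding N_def by simp
    then show ?thesis by linarith
  qed
  have N0: "N > 0" by (simp add: N_def)
  define s :: "nat \<Rightarrow> complex ^ unit" where "s = (\<lambda>k. \<chi> _. cis (2 * pi * real k / real N))"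
  have s: "cmod (s k $ ()) = 1" "s k \<in> torus" for k by (auto simp: s_def torus_def)
  let ?P = "\<lambda>p q. has_deg d p q \<and> weight B p q = 0"
  have "cspan ?P (\<lambda>z. (\<Sum>k<N. G (act B (s k) z)) / of_nat N)" if "cspan (has_deg d) G" for G
    using that
  proof (induction rule: cspan.induct)
    case (cspan_mono p q k')
    have "(\<lambda>z. (\<Sum>k<N. k' * cmono p q (act B (s k) z)) / of_nat N)
        = (\<lambda>z. (\<Sum>k<N. (s k $ ()) powi weight B p q) / of_nat N * (k' * cmono p q z))"
      by (simp add: cmono_act s sum_distrib_right sum_distrib_left mult_ac)
    also have "\<dots> = (\<lambda>z. (if weight B p q = 0 then k' else 0) * cmono p q z)"
      using sum_roots_of_unity[OF N[OF cspan_mono]] N0 by (auto simp: s_def)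
    finally show ?case using cspan_mono cspan.cspan_mono[of ?P p q k'] cspan_zero[of ?P]
      by (cases "weight B p q = 0") auto
  qed (auto simp: add_divide_distrib sum.distrib intro: cspan.intros)
  from this[OF cspan_hom_poly[OF assms(1)]]
  have "cspan ?P (\<lambda>z. (\<Sum>k<N. of_real (g (act B (s k) z))) / of_nat N)" .
  moreover have "g (act B (s k) z) = g z" for k z using assms(2) s by (auto simp: invariant_def)
  ultimately show ?thesis using N0 by simp
qed

section \<open>The quotient map\<close>

lemma sum_UNIV_Plus: "(\<Sum>j\<in>(UNIV :: ('x::finite + 'y::finite) set). f j) = (\<Sum>i\<in>UNIV. f (Inl i)) + (\<Sum>r\<in>UNIV. f (Inr r))"
  unfolding UNIV_Plus_UNIV[symmetric] by (subst sum.Plus) auto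

lemma prod_UNIV_Plus: "(\<Prod>j\<in>(UNIV :: ('x::finite + 'y::finite) set). f j) = (\<Prod>i\<in>UNIV. f (Inl i)) * (\<Prod>r\<in>UNIV. f (Inr r))"
  unfolding UNIV_Plus_UNIV[symmetric] by (subst prod.Plus) auto

section \<open>Torus actions, their orbits and the quotient topology\<close>

lemma torus_cmod: "t \<in> torus \<Longrightarrow> cmod (t $ i) = 1"
  by (simp add: torus_def)

lemma torus_nonzero: "t \<in> torus \<Longrightarrow> t $ i \<noteq> 0"
  by (auto dest: torus_cmod[of t i])

lemma one_in_torus: "(\<chi> i. 1) \<in> torus" by (simp add: torus_def)

lemma act_one: "act A (\<chi> i. 1) z = z"
  by (simp add: act_def vec_eq_iff)

lemma act_mult: "act A t (act A s z) = act A (\<chi> i. t $ i * s $ i) z"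
  by (simp add: act_def vec_eq_iff power_int_mult_distrib prod.distrib mult_ac)

lemma torus_mult: "t \<in> torus \<Longrightarrow> s \<in> torus \<Longrightarrow> (\<chi> i. t $ i * s $ i) \<in> torus"
  by (simp add: torus_def norm_mult)

lemma torus_inverse: "t \<in> torus \<Longrightarrow> (\<chi> i. inverse (t $ i)) \<in> torus"
  by (simp add: torus_def norm_inverse)

lemma act_inverse: "t \<in> torus \<Longrightarrow> act A (\<chi> i. inverse (t $ i)) (act A t z) = z"
  using act_one[of A z] by (simp add: act_mult torus_nonzero)

lemma orbit_self: "z \<in> orbit A z"
  unfolding orbit_def using act_one[of A z] one_in_torus by force

lemma orbit_act: assumes "t \<in> torus" shows "orbit A (act A t z) = orbit A z"
proof
  show "orbit A (act A t z) \<subseteq> orbit A z"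
    using assms by (auto simp: orbit_def act_mult intro: torus_mult)
  show "orbit A z \<subseteq> orbit A (act A t z)"
  proof
    fix x assume "x \<in> orbit A z"
    then obtain s where s: "s \<in> torus" "x = act A s z" by (auto simp: orbit_def)
    then have "x = act A s (act A (\<chi> i. inverse (t $ i)) (act A t z))" using assms by (simp add: act_inverse)
    also have "\<dots> = act A (\<chi> i. s $ i * (\<chi> i. inverse (t $ i)) $ i) (act A t z)" by (rule act_mult)
    finally show "x \<in> orbit A (act A t z)"
      using torus_mult[OF s(1) torus_inverse[OF assms]] by (auto simp: orbit_def)
  qed
qed

lemma orbit_eq: "z' \<in> orbit A z \<Longrightarrow> orbit A z' = orbit A z"
  using orbit_act unfolding orbit_def by blast

lemma cmod_act: assumes "t \<in> torus" shows "cmod (act A t z $ j) = cmod (z $ j)"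
proof -
  have "cmod (\<Prod>i\<in>UNIV. (t $ i) powi A i j) = 1"
    using assms by (simp add: prod_norm[symmetric] norm_power_int torus_cmod)
  then show ?thesis by (simp add: act_def norm_mult)
qed

lemma shell_act: "t \<in> torus \<Longrightarrow> act A t z \<in> shell A \<longleftrightarrow> z \<in> shell A"
  by (simp add: shell_def moment_map_def cmod_act)

lemma norm_act: "t \<in> torus \<Longrightarrow> norm (act A t z) = norm z"
  by (simp add: norm_vec_def cmod_act)

lemma linear_act: "linear (act A t)"
  by (rule linearI) (simp_all add: act_def vec_eq_iff distrib_left)

lemma compact_torus: "compact (torus :: (complex ^ 'i::finite) set)"
proof -
  have "torus = (\<Inter>i. {t :: complex ^ 'i. cmod (t $ i) = 1})" by (auto simp: torus_def)
  moreover have "closed {t :: complex ^ 'i. cmod (t $ i) = 1}" for i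
    by (intro closed_Collect_eq continuous_intros)
  ultimately have cl: "closed (torus :: (complex ^ 'i) set)" using closed_INT[of UNIV "\<lambda>i. {t :: complex ^ 'i. cmod (t $ i) = 1}"] by simp
  have "bounded (torus :: (complex ^ 'i) set)"
    unfolding bounded_iff
  proof (intro exI ballI)
    fix t :: "complex ^ 'i" assume "t \<in> torus"
    then have "(\<Sum>i\<in>UNIV. norm (t $ i)) = real CARD('i)" by (simp add: torus_cmod)
    then show "norm t \<le> real CARD('i)" using L2_set_le_sum[of UNIV "\<lambda>i. norm (t $ i)"] by (simp add: norm_vec_def)
  qed
  with cl show ?thesis by (simp add: compact_eq_bounded_closed)
qed

lemma continuous_on_act:
  "continuous_on (torus \<times> UNIV) (\<lambda>(t, z). act A t z)"
proof -
  have "continuous_on (torus \<times> UNIV) (\<lambda>x. act A (fst x) (snd x) $ j)" for j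
    unfolding act_def vec_lambda_beta
    by (intro continuous_intros continuous_on_prod) (auto dest: torus_nonzero)
  then have "continuous_on (torus \<times> UNIV) (\<lambda>x. \<chi> j. act A (fst x) (snd x) $ j)"
    by (rule continuous_on_vec_lambda)
  then show ?thesis by (simp add: case_prod_unfold)
qed

text \<open>This is the projection, along the compact torus, of a closed subset of the product. It
  is the source of the closedness of the quotient map.\<close>

lemma closed_saturation:
  fixes A :: "('i::finite, 'j::finite) wmatrix"
  assumes "closed K"
  shows "closed {x. \<exists>t\<in>torus. act A t x \<in> K}"
proof -
  have "closed ((torus \<times> UNIV) \<inter> (\<lambda>(t, z). act A t z) -` K)"
    by (intro continuous_closed_preimage continuous_on_act closed_Times compact_imp_closed compact_torus closed_UNIV assms)
  from closed_compact_projection[OF compact_torus this]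
  have "closed {y. \<exists>x. x \<in> torus \<and> (x, y) \<in> torus \<times> UNIV \<inter> (\<lambda>(t, z). act A t z) -` K}" .
  also have "{y. \<exists>x. x \<in> torus \<and> (x, y) \<in> torus \<times> UNIV \<inter> (\<lambda>(t, z). act A t z) -` K} = {x. \<exists>t\<in>torus. act A t x \<in> K}" by auto
  finally show ?thesis .
qed

lemma closed_shell: "closed (shell A)"
  unfolding shell_def moment_map_def vec_eq_iff
  by (simp, intro closed_Collect_all closed_Collect_eq continuous_intros)

lemma openin_M0_top:
  "openin (M0_top A) U \<longleftrightarrow> U \<subseteq> M0 A \<and> openin (top_of_set (shell A)) {x \<in> shell A. orbit A x \<in> U}"
  unfolding M0_top_def quotient_topology_def by (subst topology_inverse'[OF istopology_quotient]) (simp add: M0_def)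

lemma topspace_M0_top: "topspace (M0_top A) = M0 A"
proof
  show "topspace (M0_top A) \<subseteq> M0 A" by (auto simp: topspace_def openin_M0_top)
  have "{x \<in> shell A. orbit A x \<in> M0 A} = shell A" by (auto simp: M0_def)
  then have "openin (M0_top A) (M0 A)" by (simp add: openin_M0_top)
  then show "M0 A \<subseteq> topspace (M0_top A)" by (rule openin_subset)
qed

text \<open>Generic in the first block of the index type, so that the same form occurs in the
  equations of both shells.\<close>

definition shell_form :: "('k::finite \<Rightarrow> int) \<Rightarrow> complex ^ ('x::finite + 'k) \<Rightarrow> real" where
  "shell_form c z = (\<Sum>r\<in>UNIV. real_of_int (c r) * (cmod (z $ Inr r))\<^sup>2)"

lemma cis_eq_1_imp_dvd:
  assumes "cis (2 * pi * real_of_int x / real_of_int d) = 1" "d > 0"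
  shows "d dvd x"
proof -
  have "cos (2 * pi * real_of_int x / real_of_int d) = 1" using assms(1) by (simp add: complex_eq_iff)
  then obtain n :: int where "2 * pi * real_of_int x / real_of_int d = n * 2 * pi" unfolding cos_one_2pi_int by auto
  then have "real_of_int x = real_of_int n * real_of_int d" using assms(2) by (simp add: field_simps)
  then have "x = n * d" by (metis of_int_eq_iff of_int_mult)
  then show ?thesis by simp
qed

locale typeII_data =
  fixes a n :: "'l::finite \<Rightarrow> int" and c :: "'k::finite \<Rightarrow> int"
  assumes a_pos: "a i > 0" and n_pos: "n i > 0" and c_ge: "c r \<ge> 1"
    and faithful: "faithful (typeII a n c)"
begin

abbreviation "A \<equiv> typeII a n c"
abbreviation "B \<equiv> Bmat a n c"
abbreviation "\<alpha> \<equiv> alpha a"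
abbreviation "\<beta> \<equiv> beta a n"
abbreviation "m \<equiv> mII a n"

text \<open>The last columns of the matrix are multiples of one vector n, so the torus acts on the
  last coordinates through powers of this single character.\<close>

definition chr :: "complex ^ 'l \<Rightarrow> complex" where
  "chr t = (\<Prod>i\<in>UNIV. (t $ i) powi n i)"

lemma act_A_Inl: "act A t z $ Inl i = (t $ i) powi (- a i) * z $ Inl i"
proof -
  have "(\<Prod>i'\<in>UNIV. (t $ i') powi A i' (Inl i)) = (\<Prod>i'\<in>UNIV. if i' = i then (t $ i) powi (- a i) else 1)"
    by (intro prod.cong) (auto simp: typeII_def)
  then show ?thesis by (simp add: act_def)
qed

lemma act_A_Inr: "act A t z $ Inr r = chr t powi c r * z $ Inr r"
  by (simp add: act_def typeII_def chr_def powi_prod_distrib power_int_mult[symmetric] mult.commute)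

lemma act_B_Inl: "act B s p $ Inl u = (s $ ()) powi (- \<alpha>) * p $ Inl u"
  by (simp add: act_def Bmat_def UNIV_unit)

lemma act_B_Inr: "act B s p $ Inr r = ((s $ ()) powi \<beta>) powi c r * p $ Inr r"
  by (simp add: act_def Bmat_def UNIV_unit power_int_mult[symmetric] mult.commute)

lemma a_dvd: "a i dvd \<alpha>" unfolding alpha_def by simp

lemma alpha_pos: "\<alpha> > 0"
proof -
  have "\<alpha> \<noteq> 0" unfolding alpha_def using a_pos by (subst Lcm_0_iff) (auto, metis less_irrefl)
  moreover have "\<alpha> \<ge> 0" unfolding alpha_def by (simp add: Lcm_int_greater_eq_0)
  ultimately show ?thesis by simp
qed

lemma m_eq: "m i = n i * (\<alpha> div a i)"
  unfolding mII_def using a_dvd by (simp add: div_mult_swap)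

lemma a_m: "a i * m i = n i * \<alpha>"
  unfolding m_eq using a_dvd[of i] by (simp add: mult.left_commute)

lemma m_pos: "m i > 0"
proof -
  have "a i * m i > 0" unfolding a_m using n_pos alpha_pos by simp
  then show ?thesis using a_pos[of i] by (simp add: zero_less_mult_iff)
qed

lemma beta_pos: "\<beta> > 0"
  unfolding beta_def using m_pos by (intro sum_pos) auto

lemma sum_m: "(\<Sum>i\<in>UNIV. m i) = \<beta>" by (simp add: beta_def)

section \<open>Arithmetic consequences of faithfulness\<close>

lemma trivial_action:
  assumes "t \<in> torus" "\<And>i. (t $ i) powi a i = 1" "chr t = 1"
  shows "t $ i = 1"
proof -
  have "act A t z $ j = z $ j" for z j
    using assms(2,3) by (cases j) (simp_all add: act_A_Inl act_A_Inr power_int_minus)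
  then have "\<forall>z. act A t z = z" by (simp add: vec_eq_iff)
  with faithful assms(1) have "t = (\<chi> i. 1)" by (auto simp: faithful_def)
  then show ?thesis by simp
qed

text \<open>Faithfulness is tested on the elements with entries omega^(x_i), for omega a primitive
  d-th root of unity. The two divisibility hypotheses say that such an element acts trivially, hence
  is the identity.\<close>

lemma dvd_of_trivial_action:
  assumes d: "d > 0" and dx: "\<And>i. d dvd a i * x i" "d dvd (\<Sum>i\<in>UNIV. n i * x i)"
  shows "d dvd x i"
proof -
  define \<omega> where "\<omega> = cis (2 * pi / real_of_int d)"
  have \<omega>: "\<omega> powi y = cis (2 * pi * real_of_int y / real_of_int d)" for y
    by (simp add: \<omega>_def cis_power_int mult.commute)
  have one: "\<omega> powi y = 1" if "d dvd y" for y
  proof -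
    from that obtain k where "y = d * k" by auto
    then have "2 * pi * real_of_int y / real_of_int d = 2 * pi * real_of_int k" using d by simp
    then have "\<omega> powi y = cis (2 * pi * real_of_int k)" by (simp only: \<omega>)
    also have "\<dots> = 1" by (intro cis_multiple_2pi) simp
    finally show ?thesis .
  qed
  define t :: "complex ^ 'l" where "t = (\<chi> i. \<omega> powi x i)"
  have "t $ i = 1"
  proof (rule trivial_action)
    show "t \<in> torus" by (simp add: torus_def t_def norm_power_int \<omega>_def)
    show "(t $ j) powi a j = 1" for j
      using one[OF dx(1)] by (simp add: t_def mult.commute flip: power_int_mult)
    have "chr t = \<omega> powi (\<Sum>i\<in>UNIV. n i * x i)"
      by (subst powi_sum) (auto simp: \<omega>_def chr_def t_def mult.commute simp flip: power_int_mult)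
    then show "chr t = 1" using one[OF dx(2)] by simp
  qed
  then show ?thesis using d by (intro cis_eq_1_imp_dvd) (simp_all add: t_def \<omega>)
qed

lemma coprime_a_n: "coprime (a i) (n i)"
proof -
  have "gcd (a i) (n i) dvd (if i = i then 1 else 0)"
    by (rule dvd_of_trivial_action[where x="\<lambda>j. if j = i then 1 else 0"])
      (use a_pos[of i] in \<open>auto simp: mult_delta_right\<close>)
  then show ?thesis by (simp add: coprime_iff_gcd_eq_1)
qed

text \<open>The exponent vector with entry n_j at i and - n_i at j is orthogonal to n, and a common
  divisor of a_i and a_j satisfies the remaining condition. So it divides n_j, which is coprime to
  a_j.\<close>

lemma coprime_a_a: assumes "i \<noteq> j" shows "coprime (a i) (a j)"
proof -
  let ?d = "gcd (a i) (a j)"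
  have "?d dvd (if i = i then n j else 0) - (if i = j then n i else 0)"
    by (rule dvd_of_trivial_action[where x="\<lambda>k. (if k = i then n j else 0) - (if k = j then n i else 0)"])
      (use a_pos[of i] in \<open>auto simp: right_diff_distrib sum_subtractf mult_delta_right\<close>)
  then have "?d dvd n j" using assms by simp
  then have "?d dvd 1" using coprime_a_n[of j] by (meson coprime_common_divisor gcd_dvd2)
  then show ?thesis by (simp add: coprime_iff_gcd_eq_1)
qed

text \<open>A common prime p divides some a_i. By pairwise coprimality it divides every m_j with j
  different from i, hence also m_i = n_i (alpha / a_i). As it does not divide n_i, it divides alpha
  / a_i, and then alpha / p is still a common multiple of the a_j, contradicting minimality.\<close>

lemma coprime_alpha_beta: "coprime \<alpha> \<beta>"
proof (rule ccontr)
  assume "\<not> coprime \<alpha> \<beta>"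
  then have "\<not> is_unit (gcd \<alpha> \<beta>)" by (simp add: coprime_iff_gcd_eq_1)
  moreover have "gcd \<alpha> \<beta> \<noteq> 0" using alpha_pos by simp
  ultimately obtain p where p: "prime p" "p dvd gcd \<alpha> \<beta>" using prime_divisor_exists by blast
  then have pab: "p dvd \<alpha>" "p dvd \<beta>" by auto
  have "\<alpha> dvd (\<Prod>i\<in>UNIV. a i)" unfolding alpha_def by (intro Lcm_least) (auto intro: dvd_prodI)
  with pab have "p dvd (\<Prod>i\<in>UNIV. a i)" by (meson dvd_trans)
  then obtain i where i: "p dvd a i" using p(1) by (auto simp: prime_dvd_prod_iff)
  have "p dvd m j" if "j \<noteq> i" for j
  proof -
    have "a i dvd a j * (\<alpha> div a j)" using a_dvd by simp
    then have "a i dvd \<alpha> div a j" using coprime_a_a[of i j] that by (simp add: coprime_dvd_mult_right_iff)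
    then show ?thesis using i by (auto simp: m_eq)
  qed
  then have "p dvd (\<Sum>j\<in>UNIV - {i}. m j)" by (intro dvd_sum) auto
  moreover have "\<beta> = m i + (\<Sum>j\<in>UNIV - {i}. m j)" unfolding beta_def by (rule sum.remove) auto
  ultimately have "p dvd m i" using pab(2) by (simp add: dvd_add_left_iff)
  moreover have "\<not> p dvd n i" using coprime_a_n[of i] i p(1) by (meson coprime_common_divisor not_prime_unit)
  ultimately have q: "p dvd \<alpha> div a i" using p(1) by (auto simp: m_eq prime_dvd_mult_iff)
  obtain x where x: "\<alpha> = p * x" using pab by auto
  have "a j dvd x" for j
  proof (cases "j = i")
    case True
    obtain y where "\<alpha> div a i = p * y" using q by auto
    then have "\<alpha> = a i * (p * y)" using a_dvd[of i] by (metis dvd_mult_div_cancel)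
    then have "p * x = p * (a i * y)" using x by (simp add: mult_ac)
    then show ?thesis using True p(1) by auto
  next
    case False
    have "coprime (a j) p" using coprime_a_a[OF False] i by (meson coprime_divisors dvd_refl)
    then show ?thesis using a_dvd[of j] unfolding x by (simp add: coprime_dvd_mult_right_iff)
  qed
  then have "\<alpha> dvd x" unfolding alpha_def by (intro Lcm_least) auto
  then have "p * x dvd 1 * x" using x by simp
  then show False using p(1) x alpha_pos by (auto simp: not_prime_unit)
qed

lemma bezout: obtains x y where "x * \<alpha> + y * \<beta> = 1"
  using bezout_int[of \<alpha> \<beta>] coprime_alpha_beta by (auto simp: coprime_iff_gcd_eq_1)

text \<open>A Bezout relation x alpha + y beta = 1 gives s = tau^(-x) v^y explicitly. Existence of s
  is what turns equivalence under the large torus into equivalence under the circle.\<close>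

lemma common_root:
  assumes "\<tau> powi \<beta> * v powi \<alpha> = 1" "cmod \<tau> = 1" "cmod v = 1"
  obtains s where "cmod s = 1" "s powi (- \<alpha>) = \<tau>" "s powi \<beta> = v"
proof -
  obtain x y where xy: "x * \<alpha> + y * \<beta> = 1" by (rule bezout)
  have nz: "\<tau> \<noteq> 0" "v \<noteq> 0" using assms by auto
  define s where "s = \<tau> powi (- x) * v powi y"
  have va: "v powi \<alpha> = \<tau> powi (- \<beta>)" using assms(1) nz by (simp add: power_int_minus field_simps)
  have tb: "\<tau> powi \<beta> = v powi (- \<alpha>)" using assms(1) nz by (simp add: power_int_minus field_simps)
  have e: "(u powi k) powi l = (u powi l) powi k" for u :: complex and k l by (simp flip: power_int_mult add: mult.commute)
  show ?thesis
  proof (rule that[of s])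
    show "cmod s = 1" using assms by (simp add: s_def norm_mult norm_power_int)
    have "s powi (- \<alpha>) = \<tau> powi (x * \<alpha>) * (v powi \<alpha>) powi (- y)"
      by (simp add: s_def power_int_mult_distrib flip: power_int_mult) (simp add: mult.commute)
    also have "\<dots> = \<tau> powi (x * \<alpha> + y * \<beta>)"
      unfolding va using nz by (simp add: power_int_add flip: power_int_mult) (simp add: mult.commute)
    finally show "s powi (- \<alpha>) = \<tau>" unfolding xy by simp
    have "s powi \<beta> = (\<tau> powi \<beta>) powi (- x) * v powi (y * \<beta>)"
      by (simp add: s_def power_int_mult_distrib flip: power_int_mult) (simp add: mult.commute)
    also have "\<dots> = v powi (x * \<alpha> + y * \<beta>)"
      unfolding tb using nz by (simp add: power_int_add flip: power_int_mult) (simp add: mult.commute)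
    finally show "s powi \<beta> = v" unfolding xy by simp
  qed
qed

section \<open>The shells, the linear isometry between them, and its effect on orbits\<close>

lemma shell_A_iff:
  "z \<in> shell A \<longleftrightarrow> (\<forall>i. real_of_int (a i) * (cmod (z $ Inl i))\<^sup>2 = real_of_int (n i) * shell_form c z)"
proof -
  have "moment_map A z $ i = (1/2) * (real_of_int (n i) * shell_form c z - real_of_int (a i) * (cmod (z $ Inl i))\<^sup>2)" for i
  proof -
    have "(\<Sum>i'\<in>UNIV. real_of_int (A i (Inl i')) * (cmod (z $ Inl i'))\<^sup>2)
        = (\<Sum>i'\<in>UNIV. if i' = i then - real_of_int (a i) * (cmod (z $ Inl i))\<^sup>2 else 0)"
      by (intro sum.cong) (auto simp: typeII_def)
    moreover have "(\<Sum>r\<in>UNIV. real_of_int (A i (Inr r)) * (cmod (z $ Inr r))\<^sup>2) = real_of_int (n i) * shell_form c z"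
      by (simp add: shell_form_def sum_distrib_left typeII_def mult_ac)
    ultimately show ?thesis unfolding moment_map_def vec_lambda_beta sum_UNIV_Plus by simp
  qed
  note mm = this
  have "moment_map A z $ i = 0 $ i \<longleftrightarrow> real_of_int (a i) * (cmod (z $ Inl i))\<^sup>2 = real_of_int (n i) * shell_form c z" for i
    unfolding mm[of i] by auto
  then show ?thesis unfolding shell_def vec_eq_iff mem_Collect_eq by blast
qed

lemma shell_B_iff:
  "p \<in> shell B \<longleftrightarrow> real_of_int \<alpha> * (cmod (p $ Inl ()))\<^sup>2 = real_of_int \<beta> * shell_form c p"
proof -
  have "moment_map B p $ u = (1/2) * (real_of_int \<beta> * shell_form c p - real_of_int \<alpha> * (cmod (p $ Inl ()))\<^sup>2)" for u
  proof -
    have "(\<Sum>r\<in>UNIV. real_of_int (B u (Inr r)) * (cmod (p $ Inr r))\<^sup>2) = real_of_int \<beta> * shell_form c p"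
      by (simp add: shell_form_def sum_distrib_left Bmat_def mult_ac)
    then show ?thesis unfolding moment_map_def vec_lambda_beta sum_UNIV_Plus by (simp add: UNIV_unit Bmat_def)
  qed
  note mm = this
  have "moment_map B p $ u = 0 $ u \<longleftrightarrow> real_of_int \<alpha> * (cmod (p $ Inl ()))\<^sup>2 = real_of_int \<beta> * shell_form c p" for u
    unfolding mm[of u] by auto
  then show ?thesis unfolding shell_def vec_eq_iff mem_Collect_eq by blast
qed

definition emb :: "complex ^ (unit + 'k) \<Rightarrow> complex ^ ('l + 'k)" where
  "emb p = (\<chi> j. case j of Inl i \<Rightarrow> of_real (sqrt (m i / \<beta>)) * p $ Inl () | Inr r \<Rightarrow> p $ Inr r)"

lemma emb_Inl: "emb p $ Inl i = of_real (sqrt (m i / \<beta>)) * p $ Inl ()" and emb_Inr: "emb p $ Inr r = p $ Inr r"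
  by (simp_all add: emb_def)

lemma mb_pos: "real_of_int (m i) / real_of_int \<beta> > 0" using m_pos beta_pos by simp

lemma sum_mb: "(\<Sum>i\<in>UNIV. real_of_int (m i) / real_of_int \<beta>) = 1"
  using beta_pos sum_m by (simp flip: sum_divide_distrib of_int_sum)

lemma cmod_emb_Inl: "(cmod (emb p $ Inl i))\<^sup>2 = m i / \<beta> * (cmod (p $ Inl ()))\<^sup>2"
  using mb_pos[of i] by (simp add: emb_Inl norm_mult power_mult_distrib)

lemma shell_form_emb: "shell_form c (emb p) = shell_form c p"
  by (simp add: shell_form_def emb_Inr)

lemma emb_shell: "emb p \<in> shell A \<longleftrightarrow> p \<in> shell B"
proof -
  have "real_of_int (a i) * (cmod (emb p $ Inl i))\<^sup>2 = real_of_int (n i) * shell_form c (emb p) \<longleftrightarrow>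
        real_of_int \<alpha> * (cmod (p $ Inl ()))\<^sup>2 = real_of_int \<beta> * shell_form c p" for i
  proof -
    have am: "real_of_int (a i) * real_of_int (m i) = real_of_int (n i) * real_of_int \<alpha>"
      by (metis a_m of_int_mult)
    have "real_of_int (a i) * (cmod (emb p $ Inl i))\<^sup>2 = (real_of_int (a i) * real_of_int (m i)) / \<beta> * (cmod (p $ Inl ()))\<^sup>2"
      by (simp add: cmod_emb_Inl)
    also have "\<dots> = real_of_int (n i) * (\<alpha> * (cmod (p $ Inl ()))\<^sup>2 / \<beta>)" by (simp add: am)
    finally have 3: "real_of_int (a i) * (cmod (emb p $ Inl i))\<^sup>2 = real_of_int (n i) * (\<alpha> * (cmod (p $ Inl ()))\<^sup>2 / \<beta>)" .
    have "real_of_int (n i) \<noteq> 0" using n_pos[of i] by simp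
    then have "real_of_int (a i) * (cmod (emb p $ Inl i))\<^sup>2 = real_of_int (n i) * shell_form c (emb p) \<longleftrightarrow>
        \<alpha> * (cmod (p $ Inl ()))\<^sup>2 / \<beta> = shell_form c p"
      unfolding 3 shell_form_emb mult_cancel_left by simp
    then show ?thesis using beta_pos by (simp add: divide_eq_eq mult.commute)
  qed
  then show ?thesis by (simp add: shell_A_iff shell_B_iff)
qed

lemma norm_emb: "norm (emb p) = norm p"
proof -
  have "(\<Sum>i\<in>UNIV. (cmod (emb p $ Inl i))\<^sup>2) = (\<Sum>i\<in>UNIV. m i / \<beta>) * (cmod (p $ Inl ()))\<^sup>2"
    unfolding cmod_emb_Inl sum_distrib_right by simp
  then have "(\<Sum>i\<in>UNIV. (cmod (emb p $ Inl i))\<^sup>2) = (cmod (p $ Inl ()))\<^sup>2" by (simp only: sum_mb)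
  then show ?thesis by (simp add: norm_vec_def L2_set_def sum_UNIV_Plus UNIV_unit emb_Inr)
qed

lemma linear_emb: "linear emb"
  by (rule linearI) (auto simp: emb_def vec_eq_iff distrib_left split: sum.splits)

lemma bounded_linear_emb: "bounded_linear emb"
  by (rule linear_conv_bounded_linear[THEN iffD1, OF linear_emb])

lemma inj_emb: "emb p = emb q \<Longrightarrow> p = q"
proof -
  assume "emb p = emb q"
  then have "norm (emb (p - q)) = 0" by (simp add: linear_diff[OF linear_emb])
  then show ?thesis by (simp add: norm_emb)
qed

text \<open>The i-th entry of t contributes the exponent n_i (alpha / a_i) = m_i to the character
  \<open>chr\<close>, so \<open>chr\<close> takes the value s^beta on t: this is where the weights
  c_r beta come from.\<close>

lemma emb_equivariant:
  assumes "s \<in> torus"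
  shows "\<exists>t\<in>torus. \<forall>p. emb (act B s p) = act A t (emb p)"
proof (intro bexI allI)
  define t where "t = (\<chi> i. (s $ ()) powi (\<alpha> div a i))"
  have nz: "s $ () \<noteq> 0" using assms by (rule torus_nonzero)
  show "t \<in> torus" using assms by (simp add: torus_def t_def norm_power_int)
  have 1: "(t $ i) powi (- a i) = (s $ ()) powi (- \<alpha>)" for i
    using a_dvd[of i] by (simp add: t_def flip: power_int_mult)
  have "chr t = (\<Prod>i\<in>UNIV. (s $ ()) powi m i)"
    by (simp add: chr_def t_def m_eq mult.commute flip: power_int_mult)
  then have 2: "chr t = (s $ ()) powi \<beta>" by (simp add: beta_def powi_sum[OF nz])
  show "emb (act B s p) = act A t (emb p)" for p
    unfolding vec_eq_iff
  proof
    fix j show "emb (act B s p) $ j = act A t (emb p) $ j"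
      by (cases j) (simp_all add: emb_Inl emb_Inr act_A_Inl act_A_Inr act_B_Inl act_B_Inr 1 2)
  qed
qed

text \<open>On the shell the moduli already agree with those of an embedded point. Only the phases
  of the first coordinates have to be made equal, by an element with \<open>chr t = 1\<close> so
  that the other coordinates stay fixed.\<close>

lemma shell_rep:
  assumes "z \<in> shell A"
  shows "\<exists>t\<in>torus. \<exists>p\<in>shell B. emb p = act A t z"
proof -
  define S where "S = shell_form c z"
  define \<theta> where "\<theta> = (\<lambda>i. Arg (z $ Inl i))"
  \<comment> \<open>The mean of the phases with weights m_i. Because n_i / a_i = m_i / alpha, it is
    the common phase for which the exponents in \<open>chr t\<close> add up to zero.\<close>
  define \<sigma> where "\<sigma> = (\<Sum>i\<in>UNIV. m i * \<theta> i) / \<beta>"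
  define t :: "complex ^ 'l" where "t = (\<chi> i. cis ((\<theta> i - \<sigma>) / a i))"
  have t: "t \<in> torus" by (simp add: t_def torus_def)
  have n_over_a: "real_of_int (n i) / a i = m i / \<alpha>" for i
    using a_m[of i] a_pos[of i] alpha_pos by (simp add: field_simps flip: of_int_mult)
  have sm: "cmod (z $ Inl i) = sqrt (m i * S / \<alpha>)" for i
  proof -
    have "real_of_int (a i) * (cmod (z $ Inl i))\<^sup>2 = real_of_int (n i) * S" using assms by (simp add: shell_A_iff S_def)
    then have "(cmod (z $ Inl i))\<^sup>2 = n i / a i * S" using a_pos[of i] by (simp add: field_simps)
    then show ?thesis unfolding n_over_a by (simp add: real_sqrt_unique)
  qed
  have "chr t = cis (\<Sum>i\<in>UNIV. n i * ((\<theta> i - \<sigma>) / a i))"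
    unfolding chr_def t_def vec_lambda_beta cis_power_int by (simp add: cis_conv_exp exp_sum sum_distrib_left)
  also have "(\<Sum>i\<in>UNIV. n i * ((\<theta> i - \<sigma>) / a i)) = (\<Sum>i\<in>UNIV. m i / \<alpha> * (\<theta> i - \<sigma>))"
    by (intro sum.cong refl) (simp flip: n_over_a)
  also have "\<dots> = ((\<Sum>i\<in>UNIV. m i * \<theta> i) - (\<Sum>i\<in>UNIV. real_of_int (m i)) * \<sigma>) / \<alpha>"
    by (simp add: sum_divide_distrib sum_subtractf right_diff_distrib diff_divide_distrib sum_distrib_right)
  also have "\<dots> = 0" using beta_pos sum_m by (simp add: \<sigma>_def flip: of_int_sum)
  finally have chr: "chr t = 1" by simp
  define p :: "complex ^ (unit + 'k)" where
    "p = (\<chi> j. case j of Inl _ \<Rightarrow> of_real (sqrt (\<beta> * S / \<alpha>)) * cis \<sigma> | Inr r \<Rightarrow> z $ Inr r)"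
  have e: "emb p = act A t z"
    unfolding vec_eq_iff
  proof
    fix j show "emb p $ j = act A t z $ j"
    proof (cases j)
      case (Inl i)
      have "(t $ i) powi (- a i) = cis (\<sigma> - \<theta> i)"
        using a_pos[of i] by (simp add: t_def cis_power_int del: power_int_minus)
      moreover have "z $ Inl i = of_real (cmod (z $ Inl i)) * cis (\<theta> i)"
        using rcis_cmod_Arg[of "z $ Inl i"] by (simp add: \<theta>_def rcis_def)
      ultimately have "act A t z $ j = of_real (cmod (z $ Inl i)) * cis \<sigma>"
        unfolding Inl act_A_Inl by (metis (no_types, lifting) cis_mult diff_add_cancel mult.left_commute)
      moreover have "sqrt (m i / \<beta>) * sqrt (\<beta> * S / \<alpha>) = sqrt (m i * S / \<alpha>)"
        using beta_pos by (simp flip: real_sqrt_mult)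
      then have "emb p $ j = of_real (sqrt (m i * S / \<alpha>)) * cis \<sigma>"
        unfolding Inl emb_Inl p_def by (simp flip: of_real_mult mult.assoc)
      ultimately show ?thesis by (simp add: sm)
    qed (simp add: emb_Inr act_A_Inr chr p_def)
  qed
  moreover have "p \<in> shell B" using e assms t by (simp add: shell_act flip: emb_shell)
  ultimately show ?thesis using t by auto
qed

text \<open>The form in the remaining coordinates is positive definite. Away from the origin one may
  therefore divide by the first coordinate.\<close>

lemma shell_B_zero:
  assumes "p \<in> shell B" "p $ Inl () = 0" shows "p = 0"
proof -
  have "shell_form c p = 0" using assms beta_pos by (simp add: shell_B_iff)
  moreover have "0 \<le> real_of_int (c r) * (cmod (p $ Inr r))\<^sup>2" for r
    using c_ge[of r] by (intro mult_nonneg_nonneg) auto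
  ultimately have "\<forall>r. real_of_int (c r) * (cmod (p $ Inr r))\<^sup>2 = 0"
    by (simp add: shell_form_def sum_nonneg_eq_0_iff)
  then have "p $ Inr r = 0" for r using c_ge[of r] by (metis less_irrefl mult_eq_0_iff norm_eq_zero of_int_eq_0_iff order_less_le_trans power_eq_0_iff zero_less_one)
  with assms(2) show ?thesis unfolding vec_eq_iff by (metis (full_types) old.sum.exhaust old.unit.exhaust zero_index)
qed

text \<open>Comparing first coordinates shows that every t_i^(-a_i) equals one and the same tau.
  Raising to the powers m_i and multiplying gives tau^beta = (chr t)^(-alpha), the relation needed
  for \<open>common_root\<close>.\<close>

lemma orbit_reflect:
  assumes "p \<in> shell B" "t \<in> torus" "emb p' = act A t (emb p)"
  shows "p' \<in> orbit B p"
proof (cases "p $ Inl () = 0")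
  case True
  then have "p = 0" using assms(1) shell_B_zero by blast
  then have "norm (emb p') = 0" using assms by (simp add: norm_act norm_emb)
  then have "p' = p" using \<open>p = 0\<close> by (simp add: norm_emb)
  then show ?thesis by (simp add: orbit_self)
next
  case False
  define \<tau> where "\<tau> = p' $ Inl () / p $ Inl ()"
  have \<tau>: "(t $ i) powi (- a i) = \<tau>" for i
  proof -
    have "emb p' $ Inl i = act A t (emb p) $ Inl i" using assms(3) by simp
    then have "of_real (sqrt (m i / \<beta>)) * p' $ Inl () = of_real (sqrt (m i / \<beta>)) * ((t $ i) powi (- a i) * p $ Inl ())"
      by (simp add: emb_Inl act_A_Inl mult_ac)
    then have "p' $ Inl () = (t $ i) powi (- a i) * p $ Inl ()" using m_pos[of i] beta_pos by auto
    then show ?thesis using False by (simp add: \<tau>_def)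
  qed
  have nz: "t $ i \<noteq> 0" for i using assms(2) by (rule torus_nonzero)
  have c1: "cmod \<tau> = 1" using \<tau>[of undefined] assms(2) by (metis norm_power_int power_int_1_left torus_cmod)
  have c2: "cmod (chr t) = 1" using assms(2) by (simp add: chr_def norm_power_int torus_cmod flip: prod_norm)
  have "\<tau> powi \<beta> = (\<Prod>i\<in>UNIV. \<tau> powi m i)" using c1 by (simp add: beta_def powi_sum cmod_1_nonzero)
  also have "\<dots> = (\<Prod>i\<in>UNIV. (t $ i) powi (- (n i * \<alpha>)))"
  proof (intro prod.cong refl)
    fix i
    have "\<tau> powi m i = (t $ i) powi (- (a i * m i))" unfolding \<tau>[of i, symmetric] by (simp flip: power_int_mult)
    then show "\<tau> powi m i = (t $ i) powi (- (n i * \<alpha>))" by (simp only: a_m)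
  qed
  also have "\<dots> = chr t powi (- \<alpha>)" by (simp add: chr_def powi_prod_distrib flip: power_int_mult)
  finally have "\<tau> powi \<beta> * chr t powi \<alpha> = 1" using c2 by (simp add: power_int_minus cmod_1_nonzero)
  then obtain s where s: "cmod s = 1" "s powi (- \<alpha>) = \<tau>" "s powi \<beta> = chr t" using c1 c2 by (rule common_root)
  have "p' = act B (\<chi> _. s) p" unfolding vec_eq_iff
  proof
    fix j show "p' $ j = act B (\<chi> _. s) p $ j"
    proof (cases j)
      case (Inl u)
      then show ?thesis using False by (simp add: act_B_Inl s(2) \<tau>_def del: power_int_minus)
    next
      case (Inr r)
      have "emb p' $ Inr r = act A t (emb p) $ Inr r" using assms(3) by simp
      then show ?thesis using Inr by (simp add: emb_Inr act_A_Inr act_B_Inr s(3))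
    qed
  qed
  moreover have "(\<chi> _. s) \<in> torus" using s(1) by (simp add: torus_def)
  ultimately show ?thesis by (auto simp: orbit_def)
qed

section \<open>The homeomorphism of the quotients\<close>

definition quot_map :: "(complex ^ ('l + 'k)) set \<Rightarrow> (complex ^ (unit + 'k)) set" where
  "quot_map X = emb -` X"

text \<open>\<open>orbit_reflect\<close> gives one inclusion and \<open>emb_equivariant\<close> the
  other. Taking preimages describes the inverse of the induced map without choosing
  representatives.\<close>

lemma quot_map_orbit: assumes "p \<in> shell B" shows "quot_map (orbit A (emb p)) = orbit B p"
proof
  show "quot_map (orbit A (emb p)) \<subseteq> orbit B p"
    using orbit_reflect[OF assms] by (auto simp: quot_map_def orbit_def)
  show "orbit B p \<subseteq> quot_map (orbit A (emb p))"
    using emb_equivariant by (fastforce simp: quot_map_def orbit_def)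
qed

lemma orbit_rep: assumes "z \<in> shell A" obtains p where "p \<in> shell B" "orbit A z = orbit A (emb p)"
  using shell_rep[OF assms] orbit_act by metis

lemma M0_A_eq: "M0 A = (\<lambda>p. orbit A (emb p)) ` shell B"
proof
  show "M0 A \<subseteq> (\<lambda>p. orbit A (emb p)) ` shell B" using orbit_rep by (force simp: M0_def)
  show "(\<lambda>p. orbit A (emb p)) ` shell B \<subseteq> M0 A" using emb_shell by (auto simp: M0_def)
qed

text \<open>Every orbit in the shell of A meets the image of \<open>emb\<close>, so for invariant
  functions the pullback relation is a statement about restriction along \<open>emb\<close>. All
  later obligations are checked in this form.\<close>

lemma pb_rel_iff:
  assumes "invariant A f" "invariant B g"
  shows "pb_rel A B quot_map f g \<longleftrightarrow> (\<forall>p\<in>shell B. f (emb p) = g p)"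
proof
  assume "pb_rel A B quot_map f g"
  then show "\<forall>p\<in>shell B. f (emb p) = g p"
    unfolding pb_rel_def using emb_shell quot_map_orbit orbit_self by blast
next
  assume eq: "\<forall>p\<in>shell B. f (emb p) = g p"
  show "pb_rel A B quot_map f g" unfolding pb_rel_def
  proof (intro ballI)
    fix z w assume z: "z \<in> shell A" and w: "w \<in> quot_map (orbit A z)"
    have "emb w \<in> orbit A z" using w by (simp add: quot_map_def)
    then obtain t where t: "t \<in> torus" "emb w = act A t z" by (auto simp: orbit_def)
    then have "f (emb w) = f z" using assms(1) by (simp add: invariant_def)
    moreover have "w \<in> shell B" using t z by (simp add: shell_act flip: emb_shell)
    ultimately show "f z = g w" using eq by auto
  qed
qed

lemma homeomorphic_quot_map: "homeomorphic_map (M0_top A) (M0_top B) quot_map"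
proof -
  have im: "quot_map ` M0 A = M0 B"
    unfolding M0_A_eq image_image unfolding M0_def by (intro image_cong refl quot_map_orbit)
  have inj: "inj_on quot_map (M0 A)"
  proof (rule inj_onI)
    fix X Y assume "X \<in> M0 A" "Y \<in> M0 A" and eq: "quot_map X = quot_map Y"
    then obtain p q where pq: "p \<in> shell B" "q \<in> shell B" "X = orbit A (emb p)" "Y = orbit A (emb q)"
      by (auto simp: M0_A_eq)
    then have "p \<in> quot_map Y" using quot_map_orbit orbit_self eq by metis
    then have "emb p \<in> orbit A (emb q)" using pq by (simp add: quot_map_def)
    then show "X = Y" using pq orbit_eq by metis
  qed
  let ?V = "\<lambda>U. {X \<in> M0 A. quot_map X \<in> U}"
  let ?S = "\<lambda>U. {z \<in> shell A. orbit A z \<in> ?V U}"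
  \<comment> \<open>Openness is shown through complements: the injective linear map sends the closed
    set \<open>?C U\<close> to a closed set, its saturation \<open>?T U\<close> is closed by
    compactness of the torus, and the complement of \<open>?T U\<close> cuts out
    \<open>?S U\<close>.\<close>
  let ?C = "\<lambda>U. shell B - {p \<in> shell B. orbit B p \<in> U}"
  let ?T = "\<lambda>U. {x. \<exists>t\<in>torus. act A t x \<in> emb ` (?C U)}"
  have "openin (M0_top A) (?V U) \<longleftrightarrow> openin (M0_top B) U" if U: "U \<subseteq> M0 B" for U
  proof
    assume "openin (M0_top A) (?V U)"
    then have "openin (top_of_set (shell A)) (?S U)"
      by (simp add: openin_M0_top)
    then obtain W where W: "open W" "(?S U) = shell A \<inter> W"
      by (auto simp: openin_open)
    have "{p \<in> shell B. orbit B p \<in> U} = shell B \<inter> emb -` W"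
    proof (intro set_eqI)
      fix p show "p \<in> {p \<in> shell B. orbit B p \<in> U} \<longleftrightarrow> p \<in> shell B \<inter> emb -` W"
      proof (cases "p \<in> shell B")
        case True
        then have "emb p \<in> (?S U) \<longleftrightarrow> orbit B p \<in> U"
          using quot_map_orbit emb_shell by (auto simp: M0_def)
        then show ?thesis unfolding W using True emb_shell by auto
      qed simp
    qed
    moreover have "open (emb -` W)" using W(1) by (intro open_vimage linear_continuous_on bounded_linear_emb)
    ultimately show "openin (M0_top B) U" using U by (auto simp: openin_M0_top openin_open)
  next
    assume "openin (M0_top B) U"
    then have "openin (top_of_set (shell B)) {p \<in> shell B. orbit B p \<in> U}" by (simp add: openin_M0_top)
    then have "closedin (top_of_set (shell B)) (?C U)"
      by (intro closedin_diff) auto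
    then have cl: "closed (?C U)"
      using closed_shell closedin_closed_trans by blast
    have "closed (emb ` (?C U))"
      by (rule closed_injective_linear_image[OF cl linear_emb]) (auto intro: injI inj_emb)
    then have sat: "closed (?T U)" by (rule closed_saturation)
    have "(?S U) = shell A \<inter> - (?T U)"
    proof (intro set_eqI)
      fix z show "z \<in> (?S U) \<longleftrightarrow> z \<in> shell A \<inter> - (?T U)"
      proof (cases "z \<in> shell A")
        case True
        have "quot_map (orbit A z) \<notin> U \<longleftrightarrow> (\<exists>t\<in>torus. act A t z \<in> emb ` (?C U))"
        proof
          assume nU: "quot_map (orbit A z) \<notin> U"
          obtain t p where tp: "t \<in> torus" "p \<in> shell B" "emb p = act A t z" using shell_rep[OF True] by auto
          then have "orbit A z = orbit A (emb p)" using orbit_act by metis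
          then have "orbit B p \<notin> U" using nU quot_map_orbit[OF tp(2)] by metis
          then show "\<exists>t\<in>torus. act A t z \<in> emb ` (?C U)" using tp by (auto intro!: bexI[of _ t] image_eqI[of _ _ p])
        next
          assume "\<exists>t\<in>torus. act A t z \<in> emb ` (?C U)"
          then obtain t p where tp: "t \<in> torus" "p \<in> shell B" "orbit B p \<notin> U" "act A t z = emb p" by auto
          then have "orbit A z = orbit A (emb p)" using orbit_act by metis
          then show "quot_map (orbit A z) \<notin> U" using quot_map_orbit tp by simp
        qed
        then show ?thesis using True by (auto simp: M0_def)
      qed simp
    qed
    then show "openin (M0_top A) (?V U)"
      using sat by (auto simp: openin_M0_top openin_open intro!: exI[of _ "- (?T U)"])
  qed
  then show ?thesis
    using im inj by (simp add: homeomorphic_map_def quotient_map_def topspace_M0_top)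
qed

end

section \<open>Poisson brackets\<close>

lemma vec_eq_sum_axis: "(x :: complex ^ 'j::finite) = (\<Sum>j\<in>UNIV. axis j (x $ j))"
  by (simp add: vec_eq_iff axis_def)

lemma linear_axis: "linear (axis j :: complex \<Rightarrow> complex ^ 'j::finite)"
  by (rule linearI) (auto simp: axis_def vec_eq_iff)

lemma bounded_linear_axis: "bounded_linear (axis j :: complex \<Rightarrow> complex ^ 'j::finite)"
  by (rule linear_conv_bounded_linear[THEN iffD1, OF linear_axis])

lemma linear_eq_sum_axis:
  fixes L :: "complex ^ 'j::finite \<Rightarrow> real"
  assumes "linear L" shows "L x = (\<Sum>j\<in>UNIV. L (axis j (x $ j)))"
  by (subst vec_eq_sum_axis) (simp add: linear_sum[OF assms])

lemma linear_axis_complex: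
  fixes L :: "complex ^ 'j::finite \<Rightarrow> real"
  assumes "linear L"
  shows "L (axis j w) = Re w * L (axis j 1) + Im w * L (axis j \<i>)"
proof -
  have "axis j w = Re w *\<^sub>R axis j 1 + Im w *\<^sub>R axis j (\<i> :: complex)"
    by (auto simp: vec_eq_iff axis_def complex_eq_iff)
  then show ?thesis by (simp add: linear_add[OF assms] linear_scale[OF assms])
qed

text \<open>The contribution of the j-th complex line to the bracket, computed in the frame w, i w
  instead of 1, i. The change of frame has determinant |w|^2, see \<open>symp_rotate\<close>, so
  brackets can be evaluated in radial and angular directions, where invariance gives
  information.\<close>

definition symp :: "(complex ^ 'j::finite \<Rightarrow> real) \<Rightarrow> (complex ^ 'j \<Rightarrow> real) \<Rightarrow> 'j \<Rightarrow> complex \<Rightarrow> real" where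
  "symp L M j w = L (axis j w) * M (axis j (\<i> * w)) - L (axis j (\<i> * w)) * M (axis j w)"

lemma poisson_eq_symp:
  "poisson f g z = (\<Sum>j\<in>UNIV. symp (frechet_derivative f (at z)) (frechet_derivative g (at z)) j 1)"
  by (simp add: poisson_def symp_def)

lemma symp_rotate:
  assumes "linear L" "linear M"
  shows "symp L M j w = (cmod w)\<^sup>2 * symp L M j 1"
  unfolding symp_def linear_axis_complex[OF assms(1), of j w] linear_axis_complex[OF assms(2), of j w]
    linear_axis_complex[OF assms(1), of j "\<i> * w"] linear_axis_complex[OF assms(2), of j "\<i> * w"]
  by (simp add: cmod_power2) (simp add: algebra_simps power2_eq_square)

lemma act_axis: "act A t (axis j w) = axis j ((\<Prod>i\<in>UNIV. (t $ i) powi A i j) * w)"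
  by (simp add: act_def axis_def vec_eq_iff)

lemma frechet_invariant:
  assumes "smooth_on UNIV f" "invariant A f" "t \<in> torus"
  shows "frechet_derivative f (at (act A t z)) (act A t v) = frechet_derivative f (at z) v"
proof -
  have "bounded_linear (act A t)" by (rule linear_conv_bounded_linear[THEN iffD1, OF linear_act])
  then have "(act A t has_derivative act A t) (at z)" by (rule bounded_linear_imp_has_derivative)
  from has_derivative_compose[OF this smooth_on_has_derivative[OF assms(1) UNIV_I]]
  have "((\<lambda>z. f (act A t z)) has_derivative (\<lambda>v. frechet_derivative f (at (act A t z)) (act A t v))) (at z)" .
  moreover have "(\<lambda>z. f (act A t z)) = f" using assms by (auto simp: invariant_def)
  ultimately have "(f has_derivative (\<lambda>v. frechet_derivative f (at (act A t z)) (act A t v))) (at z)" by simp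
  from frechet_derivative_at[OF this] show ?thesis by metis
qed

text \<open>The action rotates the frame of each coordinate line by a number of modulus one, which
  does not change \<open>symp\<close>.\<close>

lemma poisson_invariant:
  assumes "smooth_on UNIV f" "smooth_on UNIV g" "invariant A f" "invariant A g" "t \<in> torus"
  shows "poisson f g (act A t z) = poisson f g z"
  unfolding poisson_eq_symp
proof (intro sum.cong refl)
  fix j
  define \<tau> where "\<tau> = (\<Prod>i\<in>UNIV. (t $ i) powi A i j)"
  have \<tau>: "cmod \<tau> = 1" using assms(5) by (simp add: \<tau>_def norm_power_int torus_cmod flip: prod_norm)
  let ?L = "frechet_derivative f (at (act A t z))" and ?M = "frechet_derivative g (at (act A t z))"
  have "symp (frechet_derivative f (at z)) (frechet_derivative g (at z)) j 1 = symp ?L ?M j \<tau>"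
    using frechet_invariant[OF assms(1,3,5), of z "axis j 1"] frechet_invariant[OF assms(1,3,5), of z "axis j \<i>"]
      frechet_invariant[OF assms(2,4,5), of z "axis j 1"] frechet_invariant[OF assms(2,4,5), of z "axis j \<i>"]
    by (simp add: symp_def act_axis mult.commute flip: \<tau>_def)
  also have "\<dots> = symp ?L ?M j 1"
    using symp_rotate[OF smooth_on_linear_frechet[OF assms(1)] smooth_on_linear_frechet[OF assms(2)], of _ _ j \<tau>] \<tau> by simp
  finally show "symp ?L ?M j 1 = symp (frechet_derivative f (at z)) (frechet_derivative g (at z)) j 1" by simp
qed

text \<open>A suitable element of the i-th circle acts as -1 on the j-th coordinate and fixes the
  origin. Invariance makes the derivative there even along this coordinate, while linearity makes it
  odd.\<close>

lemma frechet_invariant_0: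
  fixes A :: "('i::finite, 'j::finite) wmatrix"
  assumes "smooth_on UNIV f" "invariant A f" "A i j \<noteq> 0"
  shows "frechet_derivative f (at 0) (axis j w) = 0"
proof -
  define t :: "complex ^ 'i" where "t = (\<chi> i'. if i' = i then cis (pi / A i j) else 1)"
  have t: "t \<in> torus" by (simp add: torus_def t_def)
  have "(\<Prod>i'\<in>UNIV. (t $ i') powi A i' j) = (\<Prod>i'\<in>UNIV. if i' = i then cis (pi / A i j) powi A i j else 1)"
    by (intro prod.cong) (auto simp: t_def)
  also have "\<dots> = -1" using assms(3) by (simp add: cis_power_int)
  finally have "act A t (axis j w) = axis j (- w)" by (simp add: act_axis)
  moreover have "act A t 0 = 0" using linear_act by (rule linear_0)
  ultimately have "frechet_derivative f (at 0) (axis j (- w)) = frechet_derivative f (at 0) (axis j w)"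
    using frechet_invariant[OF assms(1,2) t, of 0 "axis j w"] by simp
  then show ?thesis
    using linear_neg[OF linear_axis, of j w] linear_neg[OF smooth_on_linear_frechet[OF assms(1)], of 0 "axis j w"] by simp
qed

lemma poisson_invariant_0:
  assumes "smooth_on UNIV f" "invariant A f" "\<And>j. \<exists>i. A i j \<noteq> 0"
  shows "poisson f g 0 = 0"
proof -
  have "frechet_derivative f (at 0) (axis j w) = 0" for j w
    using assms(3)[of j] frechet_invariant_0[OF assms(1,2)] by blast
  then show ?thesis by (simp add: poisson_def)
qed

text \<open>The derivative at angle zero of f along the orbit of the i-th circle factor, where f is
  constant.\<close>

lemma infinitesimal_invariance:
  fixes A :: "('i::finite, 'j::finite) wmatrix"
  assumes "smooth_on UNIV f" "invariant A f"
  shows "(\<Sum>j\<in>UNIV. A i j * frechet_derivative f (at z) (axis j (\<i> * z $ j))) = 0"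
proof -
  define t :: "real \<Rightarrow> complex ^ 'i" where "t = (\<lambda>\<theta>. \<chi> i'. if i' = i then cis \<theta> else 1)"
  have t: "t \<theta> \<in> torus" for \<theta> by (simp add: torus_def t_def)
  define \<gamma> :: "real \<Rightarrow> complex ^ 'j" where "\<gamma> = (\<lambda>\<theta>::real. \<Sum>j\<in>UNIV. axis j (cis (A i j * \<theta>) * z $ j))"
  have \<gamma>: "\<gamma> \<theta> = act A (t \<theta>) z" for \<theta>
  proof -
    have "act A (t \<theta>) z $ j = cis (A i j * \<theta>) * z $ j" for j
    proof -
      have "(\<Prod>i'\<in>UNIV. (t \<theta> $ i') powi A i' j) = (\<Prod>i'\<in>UNIV. if i' = i then cis \<theta> powi A i j else 1)"
        by (intro prod.cong) (auto simp: t_def)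
      then show ?thesis by (simp add: act_def cis_power_int)
    qed
    then show ?thesis unfolding \<gamma>_def by (subst (2) vec_eq_sum_axis) simp
  qed
  have z: "\<gamma> 0 = z" unfolding \<gamma>_def using vec_eq_sum_axis[of z] by simp
  have "(\<gamma> has_derivative (\<lambda>s. \<Sum>j\<in>UNIV. axis j (((A i j * s) *\<^sub>R (\<i> * cis (A i j * 0))) * z $ j))) (at 0)"
    unfolding \<gamma>_def
    by (intro has_derivative_sum bounded_linear.has_derivative[OF bounded_linear_axis] derivative_eq_intros refl | simp)+
  from has_derivative_compose[OF this smooth_on_has_derivative[OF assms(1) UNIV_I]]
  have 1: "((\<lambda>\<theta>. f (\<gamma> \<theta>)) has_derivative (\<lambda>s. frechet_derivative f (at z) (\<Sum>j\<in>UNIV. axis j (((A i j * s) *\<^sub>R (\<i> * cis (A i j * 0))) * z $ j)))) (at 0)"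
    unfolding z .
  have 2: "((\<lambda>\<theta>. f (\<gamma> \<theta>)) has_derivative (\<lambda>s. 0)) (at 0)"
    using assms(2) t by (simp add: \<gamma> invariant_def)
  from has_derivative_unique[OF 1 2]
  have "frechet_derivative f (at z) (\<Sum>j\<in>UNIV. axis j ((A i j *\<^sub>R \<i>) * z $ j)) = 0" by (auto dest: fun_cong[of _ _ 1])
  moreover have "axis j ((A i j *\<^sub>R \<i>) * z $ j) = A i j *\<^sub>R axis j (\<i> * z $ j)" for j
    using linear_scale[OF linear_axis, of j "A i j" "\<i> * z $ j"] by simp
  ultimately show ?thesis
    using smooth_on_linear_frechet[OF assms(1), of z] by (simp add: linear_sum linear_scale)
qed

context typeII_data
begin

text \<open>The condition on v is the differentiated shell equation. It is realised by a curve
  inside the shell with velocity v, along which h is constantly zero.\<close>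

lemma tangent_vanishing:
  assumes h: "smooth_on UNIV h" "\<And>p. p \<in> shell B \<Longrightarrow> h p = 0"
    and p: "p \<in> shell B" "p \<noteq> 0"
    and v: "real_of_int \<alpha> * Re (cnj (p $ Inl ()) * v $ Inl ()) = \<beta> * (\<Sum>r\<in>UNIV. c r * Re (cnj (p $ Inr r) * v $ Inr r))"
  shows "frechet_derivative h (at p) v = 0"
proof -
  have w: "p $ Inl () \<noteq> 0" using p shell_B_zero by blast
  have sq: "(cmod (x + t *\<^sub>R y))\<^sup>2 = (cmod x)\<^sup>2 + 2 * t * Re (cnj x * y) + t\<^sup>2 * (cmod y)\<^sup>2" for x y :: complex and t :: real
    by (simp add: cmod_power2) (simp add: power2_eq_square algebra_simps)
  \<comment> \<open>\<open>q1\<close> is the squared modulus of the first coordinate along the line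
    p + t v, \<open>q2\<close> the value that the shell equation demands. Rescaling the first
    coordinate by the square root of the quotient puts the curve on the shell; tangency of v makes
    the rescaling stationary at t = 0.\<close>
  define q1 where "q1 = (\<lambda>t::real. (cmod (p $ Inl () + t *\<^sub>R v $ Inl ()))\<^sup>2)"
  define q2 where "q2 = (\<lambda>t::real. \<beta> / \<alpha> * shell_form c (p + t *\<^sub>R v))"
  define \<rho> where "\<rho> = (\<lambda>t. sqrt (q2 t / q1 t))"
  define \<gamma> where "\<gamma> = (\<lambda>t::real. p + t *\<^sub>R v + (\<rho> t - 1) *\<^sub>R (axis (Inl ()) (p $ Inl ()) + t *\<^sub>R axis (Inl ()) (v $ Inl ())))"
  have q1_0: "q1 0 > 0" using w by (simp add: q1_def)
  have q2_0: "q2 0 = q1 0" using p(1) alpha_pos by (simp add: q1_def q2_def shell_B_iff field_simps)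
  let ?R = "Re (cnj (p $ Inl ()) * v $ Inl ())"
  have d1: "(q1 has_real_derivative 2 * ?R) (at 0)"
    unfolding q1_def sq by (auto intro!: derivative_eq_intros)
  have d2: "(q2 has_real_derivative 2 * ?R) (at 0)"
  proof -
    define R where "R = (\<lambda>r. Re (cnj (p $ Inr r) * v $ Inr r))"
    have "(q2 has_real_derivative \<beta> / \<alpha> * (\<Sum>r\<in>UNIV. c r * (2 * R r))) (at 0)"
      unfolding q2_def shell_form_def vector_add_component vector_scaleR_component sq R_def
      by (intro DERIV_cmult DERIV_sum) (auto intro!: derivative_eq_intros)
    moreover have "(\<Sum>r\<in>UNIV. c r * (2 * R r)) = 2 * (\<Sum>r\<in>UNIV. c r * R r)"
      by (simp add: sum_distrib_left mult_ac)
    then have "\<beta> / \<alpha> * (\<Sum>r\<in>UNIV. c r * (2 * R r)) = 2 * (\<beta> * (\<Sum>r\<in>UNIV. c r * R r)) / \<alpha>" by simp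
    then have "\<beta> / \<alpha> * (\<Sum>r\<in>UNIV. c r * (2 * R r)) = 2 * ?R"
      unfolding R_def v[symmetric] using alpha_pos by simp
    ultimately show ?thesis by (simp only:)
  qed
  have "((\<lambda>t. q2 t / q1 t) has_real_derivative (2 * ?R * q1 0 - q2 0 * (2 * ?R)) / (q1 0 * q1 0)) (at 0)"
    by (intro DERIV_divide d1 d2) (use q1_0 in auto)
  then have "((\<lambda>t. q2 t / q1 t) has_real_derivative 0) (at 0)" by (simp add: q2_0)
  from DERIV_chain2[OF DERIV_real_sqrt this] have d\<rho>: "(\<rho> has_real_derivative 0) (at 0)"
    using q1_0 q2_0 by (simp add: \<rho>_def)
  have \<rho>0: "\<rho> 0 = 1" using q1_0 q2_0 by (simp add: \<rho>_def)
  have \<gamma>0: "\<gamma> 0 = p" by (simp add: \<gamma>_def \<rho>0)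
  have d\<rho>': "(\<rho> has_derivative (\<lambda>s. 0)) (at 0)" by (rule has_derivative_eq_rhs[OF d\<rho>[unfolded has_field_derivative_def]]) auto
  have "(\<gamma> has_derivative (\<lambda>s. s *\<^sub>R v)) (at 0)"
    unfolding \<gamma>_def by (rule derivative_eq_intros d\<rho>' refl | simp add: \<rho>0)+
  from has_derivative_compose[OF this smooth_on_has_derivative[OF h(1) UNIV_I]]
  have 1: "((\<lambda>t. h (\<gamma> t)) has_derivative (\<lambda>s. frechet_derivative h (at p) (s *\<^sub>R v))) (at 0)" by (simp add: \<gamma>0)
  have hz: "h (\<gamma> t) = 0" if "q1 t > 0" for t
  proof (rule h(2))
    have q2: "q2 t \<ge> 0" unfolding q2_def shell_form_def
    proof (intro mult_nonneg_nonneg sum_nonneg)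
      fix r show "0 \<le> real_of_int (c r)" using c_ge[of r] by simp
    qed (use alpha_pos beta_pos in auto)
    have "\<gamma> t $ Inl () = of_real (\<rho> t) * (p $ Inl () + t *\<^sub>R v $ Inl ())"
      by (simp add: \<gamma>_def) (simp add: scaleR_conv_of_real algebra_simps)
    then have "(cmod (\<gamma> t $ Inl ()))\<^sup>2 = (\<rho> t)\<^sup>2 * q1 t" by (simp add: norm_mult power_mult_distrib q1_def)
    also have "\<dots> = q2 t" using that q2 by (simp add: \<rho>_def)
    finally have "real_of_int \<alpha> * (cmod (\<gamma> t $ Inl ()))\<^sup>2 = \<beta> * shell_form c (p + t *\<^sub>R v)"
      using alpha_pos by (simp add: q2_def)
    moreover have "shell_form c (p + t *\<^sub>R v) = shell_form c (\<gamma> t)" by (simp add: shell_form_def \<gamma>_def axis_def)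
    ultimately show "\<gamma> t \<in> shell B" by (simp add: shell_B_iff)
  qed
  have "continuous (at 0) q1" using d1 by (rule DERIV_isCont)
  then have "\<forall>\<^sub>F t in nhds 0. q1 t > 0"
    using q1_0 by (metis continuous_at_imp_continuous_within eventually_nhds_conv_at isCont_def order_tendstoD(1))
  then have "\<forall>\<^sub>F t in nhds 0. h (\<gamma> t) = 0" by eventually_elim (rule hz)
  then obtain U where U: "open U" "0 \<in> U" "\<And>t. t \<in> U \<Longrightarrow> h (\<gamma> t) = 0" unfolding eventually_nhds by blast
  have "((\<lambda>t. 0) has_derivative (\<lambda>s. 0)) (at (0::real))" by simp
  then have 2: "((\<lambda>t. h (\<gamma> t)) has_derivative (\<lambda>s. 0)) (at 0)"
    by (rule has_derivative_transform_within_open[where s=U]) (use U in auto)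
  from fun_cong[OF has_derivative_unique[OF 1 2], of 1] show ?thesis by simp
qed

lemma poisson_skew: "poisson g f z = - poisson f g z"
  by (simp add: poisson_def sum_negf[symmetric] mult.commute)

text \<open>The ideal of the shell is a Poisson ideal: \<open>{h, g}\<close> is the derivative of \<open>h\<close> along the Hamiltonian
  vector field of \<open>g\<close>, which is tangent to the shell because \<open>g\<close> is invariant.\<close>

lemma poisson_ideal:
  assumes h: "smooth_on UNIV h" "\<And>p. p \<in> shell B \<Longrightarrow> h p = 0"
    and g: "smooth_on UNIV g" "invariant B g" and p: "p \<in> shell B" "p \<noteq> 0"
  shows "poisson h g p = 0"
proof -
  let ?L = "frechet_derivative h (at p)" and ?M = "frechet_derivative g (at p)"
  have L: "linear ?L" and M: "linear ?M" using h g by (auto intro: smooth_on_linear_frechet)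
  define v :: "complex ^ (unit + 'k)" where "v = (\<chi> j. Complex (?M (axis j \<i>)) (- ?M (axis j 1)))"
  have "?L v = poisson h g p"
    unfolding poisson_def linear_eq_sum_axis[OF L, of v]
    by (intro sum.cong refl) (subst linear_axis_complex[OF L], simp add: v_def mult.commute)
  moreover have "?L v = 0"
  proof (rule tangent_vanishing[OF h p])
    \<comment> \<open>With this identity the tangency condition for v becomes the infinitesimal
      invariance of g.\<close>
    have e: "Re (cnj (p $ j) * v $ j) = ?M (axis j (\<i> * p $ j))" for j
      by (subst linear_axis_complex[OF M]) (simp add: v_def)
    have "(\<Sum>j\<in>UNIV. B () j * ?M (axis j (\<i> * p $ j))) = 0" by (rule infinitesimal_invariance[OF g])
    then show "real_of_int \<alpha> * Re (cnj (p $ Inl ()) * v $ Inl ()) = \<beta> * (\<Sum>r\<in>UNIV. c r * Re (cnj (p $ Inr r) * v $ Inr r))"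
      unfolding e sum_UNIV_Plus by (simp add: UNIV_unit Bmat_def sum_distrib_left mult_ac)
  qed
  ultimately show ?thesis by simp
qed

lemma frechet_emb:
  assumes "smooth_on UNIV f"
  shows "frechet_derivative (\<lambda>p. f (emb p)) (at p) v = frechet_derivative f (at (emb p)) (emb v)"
proof -
  have "(emb has_derivative emb) (at p)" by (rule bounded_linear_imp_has_derivative[OF bounded_linear_emb])
  from has_derivative_compose[OF this smooth_on_has_derivative[OF assms UNIV_I]]
  have "((\<lambda>p. f (emb p)) has_derivative (\<lambda>v. frechet_derivative f (at (emb p)) (emb v))) (at p)" .
  from frechet_derivative_at[OF this] show ?thesis by metis
qed

lemma smooth_on_emb:
  assumes "smooth_on UNIV f" shows "smooth_on UNIV (\<lambda>p. f (emb p))"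
proof (rule smooth_on_compose[OF assms])
  show "smooth_on UNIV (\<lambda>p. emb p \<bullet> b)" for b
    by (intro smooth_on_bounded_linear bounded_linear_compose[OF bounded_linear_inner_left bounded_linear_emb])
qed auto

lemma invariant_emb: assumes "invariant A f" shows "invariant B (\<lambda>p. f (emb p))"
  using assms emb_equivariant unfolding invariant_def by metis

lemma emb_axis_Inl: "emb (axis (Inl u) w) = (\<Sum>i\<in>UNIV. axis (Inl i) (of_real (sqrt (m i / \<beta>)) * w))"
  unfolding vec_eq_iff
proof
  fix j show "emb (axis (Inl u) w) $ j = (\<Sum>i\<in>UNIV. axis (Inl i) (of_real (sqrt (m i / \<beta>)) * w)) $ j"
    by (cases j) (auto simp: emb_Inl emb_Inr axis_def)
qed

lemma emb_axis_Inr: "emb (axis (Inr r) w) = axis (Inr r) w"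
  unfolding vec_eq_iff
proof
  fix j show "emb (axis (Inr r) w) $ j = axis (Inr r) w $ j"
    by (cases j) (auto simp: emb_Inl emb_Inr axis_def)
qed

text \<open>Invariance determines the derivatives along the rotations of the single coordinates \<open>z\<^sub>i\<close> up to a
  common factor \<open>\<kappa>\<close>, so the directions transverse to the image of \<open>emb\<close> do not contribute.\<close>

lemma poisson_emb:
  assumes f: "smooth_on UNIV f" "invariant A f" and g: "smooth_on UNIV g" "invariant A g" and w: "p $ Inl () \<noteq> 0"
  shows "poisson (\<lambda>p. f (emb p)) (\<lambda>p. g (emb p)) p = poisson f g (emb p)"
proof -
  let ?w = "p $ Inl ()"
  define s where "s = (\<lambda>i. sqrt (m i / \<beta>))"
  have s: "s i > 0" "s i * s i = m i / \<beta>" for i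
    using mb_pos[of i] by (simp add: s_def, simp only: s_def real_sqrt_mult_self abs_of_pos)
  have ssum: "(\<Sum>i\<in>UNIV. s i * s i) = 1" using sum_mb by (simp add: s)
  have \<kappa>: "\<exists>\<kappa>. \<forall>i. frechet_derivative f (at (emb p)) (axis (Inl i) (\<i> * ?w)) = s i * \<kappa>"
    if f: "smooth_on UNIV f" "invariant A f" for f
  proof -
    let ?L = "frechet_derivative f (at (emb p))"
    have L: "linear ?L" using f by (auto intro: smooth_on_linear_frechet)
    define K where "K = (\<Sum>r\<in>UNIV. c r * ?L (axis (Inr r) (\<i> * p $ Inr r)))"
    have "?L (axis (Inl i) (\<i> * ?w)) = s i * (K * \<beta> / \<alpha>)" for i
    proof -
      have "(\<Sum>j\<in>UNIV. A i j * ?L (axis j (\<i> * emb p $ j))) = 0" by (rule infinitesimal_invariance[OF f])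
      moreover have "(\<Sum>i'\<in>UNIV. A i (Inl i') * ?L (axis (Inl i') (\<i> * emb p $ Inl i')))
          = (\<Sum>i'\<in>UNIV. if i' = i then - a i * ?L (axis (Inl i) (\<i> * emb p $ Inl i)) else 0)"
        by (intro sum.cong) (auto simp: typeII_def)
      moreover have "(\<Sum>r\<in>UNIV. A i (Inr r) * ?L (axis (Inr r) (\<i> * emb p $ Inr r))) = n i * K"
        by (simp add: K_def typeII_def sum_distrib_left emb_Inr mult_ac)
      ultimately have 1: "a i * ?L (axis (Inl i) (\<i> * emb p $ Inl i)) = n i * K"
        unfolding sum_UNIV_Plus by simp
      have ax: "axis (Inl i) (\<i> * emb p $ Inl i) = s i *\<^sub>R axis (Inl i) (\<i> * ?w)"
        using linear_scale[OF linear_axis, of "Inl i" "s i" "\<i> * ?w"]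
        by (simp add: emb_Inl s_def scaleR_conv_of_real mult.left_commute)
      have 2: "a i * (s i * ?L (axis (Inl i) (\<i> * ?w))) = n i * K"
        using 1 unfolding ax linear_scale[OF L] by simp
      \<comment> \<open>Inserting n_i = a_i s_i^2 beta / alpha lets a_i s_i cancel. What remains
        depends on i only through one factor s_i, so the other factor is the same for all i.\<close>
      have "real_of_int (a i) * m i = n i * \<alpha>" by (metis a_m of_int_mult)
      then have "real_of_int (n i) = a i * (s i * s i) * \<beta> / \<alpha>" using alpha_pos beta_pos by (simp add: s field_simps)
      then have "a i * s i * ?L (axis (Inl i) (\<i> * ?w)) = a i * s i * (s i * (K * \<beta> / \<alpha>))"
        using 2 by (simp add: mult_ac)
      moreover have "a i * s i \<noteq> 0" using s(1)[of i] a_pos[of i] by simp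
      ultimately show ?thesis unfolding mult_cancel_left by blast
    qed
    then show ?thesis by blast
  qed
  let ?L = "frechet_derivative f (at (emb p))" and ?M = "frechet_derivative g (at (emb p))"
  have L: "linear ?L" and M: "linear ?M" using f g by (auto intro: smooth_on_linear_frechet)
  let ?L' = "frechet_derivative (\<lambda>p. f (emb p)) (at p)" and ?M' = "frechet_derivative (\<lambda>p. g (emb p)) (at p)"
  have L': "linear ?L'" and M': "linear ?M'" using f g by (auto intro: smooth_on_linear_frechet smooth_on_emb)
  have e: "?L' v = ?L (emb v)" "?M' v = ?M (emb v)" for v using frechet_emb f g by auto
  have sc: "(axis (Inl i) (of_real (s i) * x) :: complex ^ ('l + 'k)) = s i *\<^sub>R axis (Inl i) x" for i and x :: complex
    using linear_scale[OF linear_axis, of "Inl i" "s i" x] by (simp add: scaleR_conv_of_real)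
  have es: "emb (axis (Inl ()) x) = (\<Sum>i\<in>UNIV. s i *\<^sub>R axis (Inl i) x)" for x
    unfolding sc[symmetric] unfolding emb_axis_Inl s_def ..
  have eInl: "?L' (axis (Inl ()) x) = (\<Sum>i\<in>UNIV. s i * ?L (axis (Inl i) x))"
    "?M' (axis (Inl ()) x) = (\<Sum>i\<in>UNIV. s i * ?M (axis (Inl i) x))" for x
    unfolding e es by (simp_all add: linear_sum[OF L] linear_sum[OF M] linear_scale[OF L] linear_scale[OF M])
  obtain \<kappa>f \<kappa>g where k: "\<And>i. ?L (axis (Inl i) (\<i> * ?w)) = s i * \<kappa>f" "\<And>i. ?M (axis (Inl i) (\<i> * ?w)) = s i * \<kappa>g"
    using \<kappa>[OF f] \<kappa>[OF g] by blast
  \<comment> \<open>In the frame w, i w the angular derivatives are known multiples of s_i, and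
    since the s_i^2 add up to one the sum collapses to the bracket of the pulled-back
    functions.\<close>
  have "(cmod ?w)\<^sup>2 * (\<Sum>i\<in>UNIV. symp ?L ?M (Inl i) 1) = (\<Sum>i\<in>UNIV. symp ?L ?M (Inl i) ?w)"
    by (simp add: sum_distrib_left symp_rotate[OF L M, of _ ?w])
  also have "\<dots> = (\<Sum>i\<in>UNIV. s i * ?L (axis (Inl i) ?w)) * \<kappa>g - \<kappa>f * (\<Sum>i\<in>UNIV. s i * ?M (axis (Inl i) ?w))"
    by (simp add: symp_def k sum_subtractf sum_distrib_left sum_distrib_right mult_ac)
  also have "\<dots> = symp ?L' ?M' (Inl ()) ?w"
  proof -
    have "(\<Sum>i\<in>UNIV. s i * (s i * \<kappa>)) = \<kappa>" for \<kappa>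
      using ssum by (simp add: sum_distrib_right[symmetric] flip: mult.assoc)
    then show ?thesis by (simp add: symp_def eInl k)
  qed
  also have "\<dots> = (cmod ?w)\<^sup>2 * symp ?L' ?M' (Inl ()) 1" by (rule symp_rotate[OF L' M'])
  finally have "(\<Sum>i\<in>UNIV. symp ?L ?M (Inl i) 1) = symp ?L' ?M' (Inl ()) 1" using w by simp
  moreover have "symp ?L ?M (Inr r) 1 = symp ?L' ?M' (Inr r) 1" for r
    by (simp add: symp_def e emb_axis_Inr)
  ultimately show ?thesis unfolding poisson_eq_symp sum_UNIV_Plus by (simp add: UNIV_unit)
qed

lemma weights_nonzero: "\<exists>i. A i j \<noteq> 0" "\<exists>i. B i j' \<noteq> 0"
proof -
  show "\<exists>i. A i j \<noteq> 0"
  proof (cases j)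
    case (Inl i) then show ?thesis using a_pos[of i] by (intro exI[of _ i]) (simp add: typeII_def)
  next
    case (Inr r)
    have "A undefined j \<noteq> 0" using n_pos[of undefined] c_ge[of r] Inr by (simp add: typeII_def)
    then show ?thesis by blast
  qed
  show "\<exists>i. B i j' \<noteq> 0"
  proof (cases j')
    case (Inl i) then show ?thesis using alpha_pos by (simp add: Bmat_def)
  next
    case (Inr r) then show ?thesis using beta_pos c_ge[of r] by (simp add: Bmat_def)
  qed
qed

lemma poisson_diff_left:
  assumes "smooth_on UNIV f" "smooth_on UNIV g"
  shows "poisson (\<lambda>z. f z - g z) h z = poisson f h z - poisson g h z"
proof -
  have "((\<lambda>z. f z - g z) has_derivative (\<lambda>v. frechet_derivative f (at z) v - frechet_derivative g (at z) v)) (at z)"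
    by (intro has_derivative_diff smooth_on_has_derivative[OF assms(1)] smooth_on_has_derivative[OF assms(2)]) auto
  from frechet_derivative_at[OF this, symmetric]
  show ?thesis by (simp add: poisson_def algebra_simps sum_subtractf sum.distrib)
qed

lemma invariant_poisson:
  assumes "smooth_on UNIV f" "smooth_on UNIV g" "invariant M f" "invariant M g"
  shows "invariant M (poisson f g)"
  unfolding invariant_def using poisson_invariant[OF assms] by blast

text \<open>Away from the origin \<open>poisson_emb\<close> pulls the bracket back, and
  \<open>poisson_ideal\<close> then replaces the pulled-back functions by g1 and g2 one argument at
  a time. At the origin both brackets vanish because no coordinate has weight zero.\<close>

lemma poisson_compat:
  assumes f: "smooth_on UNIV f1" "invariant A f1" "smooth_on UNIV f2" "invariant A f2"
    and g: "smooth_on UNIV g1" "invariant B g1" "smooth_on UNIV g2" "invariant B g2"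
    and "\<forall>p\<in>shell B. f1 (emb p) = g1 p" "\<forall>p\<in>shell B. f2 (emb p) = g2 p"
    and p: "p \<in> shell B"
  shows "poisson f1 f2 (emb p) = poisson g1 g2 p"
proof (cases "p = 0")
  case True
  have "poisson f1 f2 0 = 0" by (rule poisson_invariant_0[OF f(1,2) weights_nonzero(1)])
  moreover have "poisson g1 g2 0 = 0" by (rule poisson_invariant_0[OF g(1,2) weights_nonzero(2)])
  ultimately show ?thesis using True linear_0[OF linear_emb] by simp
next
  case False
  let ?f1 = "\<lambda>p. f1 (emb p)" and ?f2 = "\<lambda>p. f2 (emb p)"
  have w: "p $ Inl () \<noteq> 0" using False p shell_B_zero by blast
  note sm = smooth_on_emb[OF f(1)] smooth_on_emb[OF f(3)]
  have "poisson (\<lambda>p. ?f1 p - g1 p) ?f2 p = 0"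
    using assms by (intro poisson_ideal False p invariant_emb smooth_on_diff sm) auto
  then have 1: "poisson ?f1 ?f2 p = poisson g1 ?f2 p" using poisson_diff_left[OF sm(1) g(1)] by simp
  have "poisson (\<lambda>p. ?f2 p - g2 p) g1 p = 0"
    using assms by (intro poisson_ideal False p smooth_on_diff sm) auto
  then have "poisson ?f2 g1 p = poisson g2 g1 p" using poisson_diff_left[OF sm(2) g(3)] by simp
  then have 2: "poisson g1 ?f2 p = poisson g1 g2 p" by (simp add: poisson_skew[of g1])
  show ?thesis using poisson_emb[OF f w] 1 2 by simp
qed

end

section \<open>Lifting invariant functions\<close>

context typeII_data
begin

section \<open>Lifting invariant polynomials\<close>

definition mn :: "'l \<Rightarrow> nat" where "mn i = nat (m i)"
definition bn :: nat where "bn = nat \<beta>"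

lemma int_mn: "int (mn i) = m i" using m_pos[of i] by (simp add: mn_def)
lemma int_bn: "int bn = \<beta>" using beta_pos by (simp add: bn_def)
lemma real_bn: "real bn = real_of_int \<beta>" by (simp flip: int_bn)
lemma sum_mn: "(\<Sum>i\<in>UNIV. mn i) = bn"
proof -
  have "int (\<Sum>i\<in>UNIV. mn i) = int bn" by (simp add: int_mn int_bn sum_m)
  then show ?thesis by linarith
qed

definition mon :: "complex ^ ('l + 'k) \<Rightarrow> complex" where
  "mon z = (\<Prod>i\<in>UNIV. (z $ Inl i) ^ mn i)"

definition mon_const :: real where
  "mon_const = (\<Prod>i\<in>UNIV. sqrt (m i / \<beta>) ^ mn i)"

lemma mon_const_pos: "mon_const > 0"
  unfolding mon_const_def using mb_pos by (intro prod_pos) auto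

lemma mon_emb: "mon (emb p) = of_real mon_const * (p $ Inl ()) ^ bn"
  by (simp add: mon_def mon_const_def emb_Inl power_mult_distrib prod.distrib power_sum[symmetric] sum_mn)

text \<open>Since a_i m_i = n_i alpha, the factors combine to a power of the character
  \<open>chr\<close>. This is the counterpart of how w^beta transforms under the circle.\<close>

lemma mon_act:
  assumes "t \<in> torus" shows "mon (act A t z) = chr t powi (- \<alpha>) * mon z"
proof -
  have "((t $ i) powi (- a i) * z $ Inl i) ^ mn i = (t $ i) powi (n i * - \<alpha>) * (z $ Inl i) ^ mn i" for i
  proof -
    have "((t $ i) powi (- a i)) ^ mn i = (t $ i) powi (- (a i * m i))"
      by (simp add: power_int_mult[symmetric] flip: power_int_of_nat int_mn)
    then show ?thesis by (simp add: power_mult_distrib a_m)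
  qed
  then show ?thesis
    by (simp add: mon_def act_A_Inl prod.distrib chr_def powi_prod_distrib flip: power_int_mult)
qed

lemma cmod_chr: "t \<in> torus \<Longrightarrow> cmod (chr t) = 1"
  by (simp add: chr_def norm_power_int torus_cmod flip: prod_norm)

lemma chom_poly_mon: "chom_poly bn mon"
proof -
  have "chom_poly (\<Sum>i\<in>UNIV. mn i * 1) mon"
    unfolding mon_def by (intro chom_poly_prod chom_poly_power chom_poly_nth) auto
  then show ?thesis by (simp add: sum_mn)
qed

text \<open>Weight zero and coprimality force beta to divide the difference of the exponents of w
  and its conjugate. The monomial is then a product of powers of |w|^2, of w^beta or its conjugate,
  and of the other coordinates; lifted factor by factor, the remaining characters cancel.\<close>

lemma lift_cmono:
  assumes deg: "has_deg d p q" and wt: "weight B p q = 0"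
  shows "\<exists>F. chom_poly d F \<and> (\<forall>t\<in>torus. \<forall>z. F (act A t z) = F z) \<and> (\<forall>x. F (emb x) = cmono p q x)"
proof -
  let ?p = "p (Inl ())" and ?q = "q (Inl ())"
  define D where "D = (\<Sum>r\<in>UNIV. c r * (int (p (Inr r)) - int (q (Inr r))))"
  have w: "\<beta> * D = \<alpha> * (int ?p - int ?q)"
    using wt unfolding weight_def sum_UNIV_Plus by (simp add: UNIV_unit Bmat_def D_def sum_distrib_left mult_ac)
  then have "\<beta> dvd \<alpha> * (int ?p - int ?q)" by (metis dvd_triv_left)
  then have "\<beta> dvd int ?p - int ?q" using coprime_alpha_beta by (simp add: coprime_dvd_mult_right_iff coprime_commute)
  then obtain k where k: "int ?p - int ?q = \<beta> * k" by auto
  \<comment> \<open>The common power of w and its conjugate is split off; the excess is a multiple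
    of beta on one side, so one of \<open>e1\<close> and \<open>e2\<close> is zero.\<close>
  define s where "s = min ?p ?q"
  define e1 where "e1 = nat k"
  define e2 where "e2 = nat (- k)"
  have pq: "?p = s + bn * e1" "?q = s + bn * e2"
  proof -
    have "int ?p = int s + int bn * int e1 \<and> int ?q = int s + int bn * int e2"
    proof (cases "k \<ge> 0")
      case True
      then have "\<beta> * k \<ge> 0" using beta_pos by simp
      then show ?thesis using True k by (simp add: s_def e1_def e2_def int_bn)
    next
      case False
      then have "\<beta> * k \<le> 0" using beta_pos by (simp add: mult_le_0_iff)
      then show ?thesis using False k by (simp add: s_def e1_def e2_def int_bn)
    qed
    then show "?p = s + bn * e1" "?q = s + bn * e2" by (simp_all flip: of_nat_add of_nat_mult)
  qed
  have ee: "int e1 - int e2 = k" by (simp add: e1_def e2_def)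
  have "\<beta> * D = \<beta> * (\<alpha> * k)" using w k by (simp add: mult_ac)
  then have D: "D = \<alpha> * k" using beta_pos by simp
  define P where "P = (\<lambda>z. of_real (1 / mon_const) * mon z)"
  define U where "U = (\<lambda>z :: complex ^ ('l + 'k). \<Prod>r\<in>UNIV. (z $ Inr r) ^ p (Inr r) * cnj (z $ Inr r) ^ q (Inr r))"
  define F where "F = (\<lambda>z. (\<Sum>i\<in>UNIV. z $ Inl i * cnj (z $ Inl i)) ^ s * ((P z ^ e1 * cnj (P z) ^ e2) * U z))"
  have "chom_poly (s * (1 + 1) + ((e1 * bn + e2 * bn) + (\<Sum>r\<in>UNIV. p (Inr r) * 1 + q (Inr r) * 1))) F"
    unfolding F_def P_def U_def
    by (intro chom_poly_mult chom_poly_power chom_poly_sum chom_poly_cnj chom_poly_nth chom_poly_prod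
         chom_poly_cmult chom_poly_mon finite)
  moreover have "s * (1 + 1) + ((e1 * bn + e2 * bn) + (\<Sum>r\<in>UNIV. p (Inr r) * 1 + q (Inr r) * 1)) = d"
    using deg unfolding has_deg_def sum_UNIV_Plus by (simp add: UNIV_unit pq sum.distrib mult_ac)
  moreover have "F (act A t z) = F z" if t: "t \<in> torus" for t z
  proof -
    let ?v = "chr t"
    have v: "cmod ?v = 1" using t by (rule cmod_chr)
    then have nz: "?v \<noteq> 0" by auto
    have cn: "cnj (?v powi j) = ?v powi (- j)" for j
      using v by (subst cnj_unit) (simp_all add: norm_power_int power_int_minus)
    have 1: "act A t z $ Inl i * cnj (act A t z $ Inl i) = z $ Inl i * cnj (z $ Inl i)" for i
      using cmod_act[OF t, of A z "Inl i"] by (simp flip: complex_norm_square)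
    have Pt: "P (act A t z) = ?v powi (- \<alpha>) * P z" by (simp add: P_def mon_act[OF t] mult_ac)
    have "P (act A t z) ^ e1 * cnj (P (act A t z)) ^ e2 = ((?v powi (- \<alpha>)) ^ e1 * (?v powi \<alpha>) ^ e2) * (P z ^ e1 * cnj (P z) ^ e2)"
      unfolding Pt complex_cnj_mult cn by (simp add: power_mult_distrib mult_ac)
    also have "(?v powi (- \<alpha>)) ^ e1 * (?v powi \<alpha>) ^ e2 = ?v powi (- (\<alpha> * k))"
      using nz by (simp add: ee[symmetric] power_int_add[symmetric] power_int_mult[symmetric] algebra_simps flip: power_int_of_nat del: power_int_minus)
    finally have 2: "P (act A t z) ^ e1 * cnj (P (act A t z)) ^ e2 = ?v powi (- (\<alpha> * k)) * (P z ^ e1 * cnj (P z) ^ e2)" .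
    have "U (act A t z) = (\<Prod>r\<in>UNIV. ?v powi (c r * (int (p (Inr r)) - int (q (Inr r)))) * ((z $ Inr r) ^ p (Inr r) * cnj (z $ Inr r) ^ q (Inr r)))"
      unfolding U_def
    proof (intro prod.cong refl)
      fix r
      have "(?v powi c r) ^ p (Inr r) * (?v powi (- c r)) ^ q (Inr r) = ?v powi (c r * (int (p (Inr r)) - int (q (Inr r))))"
        using nz by (simp add: power_int_add[symmetric] power_int_mult[symmetric] algebra_simps flip: power_int_of_nat del: power_int_minus)
      then show "act A t z $ Inr r ^ p (Inr r) * cnj (act A t z $ Inr r) ^ q (Inr r) =
          ?v powi (c r * (int (p (Inr r)) - int (q (Inr r)))) * ((z $ Inr r) ^ p (Inr r) * cnj (z $ Inr r) ^ q (Inr r))"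
        unfolding act_A_Inr complex_cnj_mult cn power_mult_distrib by (simp add: mult_ac)
    qed
    also have "\<dots> = ?v powi D * U z" by (simp add: prod.distrib U_def D_def powi_sum[OF nz])
    finally have 3: "U (act A t z) = ?v powi D * U z" .
    have 4: "?v powi (- (\<alpha> * k)) * ?v powi D = 1" using nz by (simp add: D flip: power_int_add)
    have "(P (act A t z) ^ e1 * cnj (P (act A t z)) ^ e2) * U (act A t z)
        = (?v powi (- (\<alpha> * k)) * ?v powi D) * ((P z ^ e1 * cnj (P z) ^ e2) * U z)"
      unfolding 2 3 by (simp only: mult_ac)
    then show ?thesis unfolding F_def 1 4 by simp
  qed
  moreover have "F (emb x) = cmono p q x" for x
  proof -
    have "(\<Sum>i\<in>UNIV. emb x $ Inl i * cnj (emb x $ Inl i)) = (\<Sum>i\<in>UNIV. of_real (m i / \<beta>) * (x $ Inl () * cnj (x $ Inl ())))"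
      by (intro sum.cong refl) (simp add: cmod_emb_Inl flip: complex_norm_square)
    also have "\<dots> = of_real (\<Sum>i\<in>UNIV. m i / \<beta>) * (x $ Inl () * cnj (x $ Inl ()))"
      by (simp only: sum_distrib_right of_real_sum)
    finally have 1: "(\<Sum>i\<in>UNIV. emb x $ Inl i * cnj (emb x $ Inl i)) = x $ Inl () * cnj (x $ Inl ())"
      by (simp only: sum_mb of_real_1 mult_1_left)
    have 2: "P (emb x) = (x $ Inl ()) ^ bn" using mon_const_pos by (simp add: P_def mon_emb)
    show ?thesis unfolding F_def 1 2 cmono_def prod_UNIV_Plus
      by (simp add: UNIV_unit pq U_def emb_Inr power_add power_mult_distrib mult_ac flip: power_mult)
  qed
  ultimately show ?thesis by (intro exI[of _ F]) simp
qed

text \<open>Lifting is compatible with complex linear combinations, and as g is real the real part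
  of the lift still restricts to g.\<close>

lemma lift_hom_poly:
  assumes "hom_poly d g" "invariant B g"
  shows "\<exists>f. hom_poly d f \<and> invariant A f \<and> (\<forall>x. f (emb x) = g x)"
proof -
  have "\<exists>F. chom_poly d F \<and> (\<forall>t\<in>torus. \<forall>z. F (act A t z) = F z) \<and> (\<forall>x. F (emb x) = G x)"
    if "cspan (\<lambda>p q. has_deg d p q \<and> weight B p q = 0) G" for G
    using that
  proof (induction rule: cspan.induct)
    case cspan_zero
    show ?case by (intro exI[of _ "\<lambda>_. 0"]) (simp add: chom_poly_zero)
  next
    case (cspan_mono p q k)
    then obtain F where "chom_poly d F" "\<forall>t\<in>torus. \<forall>z. F (act A t z) = F z" "\<forall>x. F (emb x) = cmono p q x"
      using lift_cmono by blast
    then show ?case by (intro exI[of _ "\<lambda>z. k * F z"]) (simp add: chom_poly_cmult)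
  next
    case (cspan_add f g)
    then obtain F G where "chom_poly d F" "\<forall>t\<in>torus. \<forall>z. F (act A t z) = F z" "\<forall>x. F (emb x) = f x"
      "chom_poly d G" "\<forall>t\<in>torus. \<forall>z. G (act A t z) = G z" "\<forall>x. G (emb x) = g x" by blast
    then show ?case by (intro exI[of _ "\<lambda>z. F z + G z"]) (simp add: chom_poly_add)
  qed
  from this[OF invariant_hom_poly_cspan[OF assms]]
  obtain F where "chom_poly d F" "\<forall>t\<in>torus. \<forall>z. F (act A t z) = F z" "\<forall>x. F (emb x) = of_real (g x)" by blast
  then show ?thesis by (intro exI[of _ "\<lambda>z. Re (F z)"]) (simp add: chom_poly_def invariant_def)
qed

lemma hom_poly_emb:
  assumes "hom_poly d f" shows "hom_poly d (\<lambda>p. f (emb p))"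
proof (rule hom_poly_compose[OF assms])
  fix j :: "'l + 'k"
  have "hom_poly 1 (\<lambda>z. Re (emb z $ j)) \<and> hom_poly 1 (\<lambda>z. Im (emb z $ j))"
  proof (cases j)
    case (Inl i)
    show ?thesis unfolding Inl emb_Inl Re_complex_of_real Im_complex_of_real times_complex.sel
      using hom_poly_cmult[OF hom_poly_Re, of "sqrt (m i / \<beta>)" "Inl ()"] hom_poly_cmult[OF hom_poly_Im, of "sqrt (m i / \<beta>)" "Inl ()"]
      by simp
  qed (simp only: emb_Inr hom_poly_Re hom_poly_Im)
  then show "hom_poly 1 (\<lambda>z. Re (emb z $ j))" "hom_poly 1 (\<lambda>z. Im (emb z $ j))" by auto
qed

end

section \<open>Lifting flat invariant functions\<close>

lemma sgn_eq_cis_arctan: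
  assumes "Re x > 0" shows "sgn x = cis (arctan (Im x / Re x))"
proof -
  have "x \<noteq> 0" using assms by auto
  then show ?thesis using cis_Arg[of x] arg_conv_arctan[OF assms] by simp
qed

text \<open>A globally smooth stand-in for the reciprocal, exact from \<delta> > 0 on; the bump
  keeps the denominator positive where x vanishes.\<close>

definition pos_inv :: "real \<Rightarrow> real \<Rightarrow> real" where
  "pos_inv \<delta> x = x / (x\<^sup>2 + bump (\<delta> - x))"

lemma pos_inv_eq: "0 < \<delta> \<Longrightarrow> \<delta> \<le> x \<Longrightarrow> pos_inv \<delta> x = 1 / x"
  by (simp add: pos_inv_def bump_zero power2_eq_square)

lemma smooth_on_pos_inv:
  assumes "smooth_on U f" "open U" "\<delta> > 0" shows "smooth_on U (\<lambda>x. pos_inv \<delta> (f x))"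
proof -
  have "(f x)\<^sup>2 + bump (\<delta> - f x) > 0" for x
    using assms(3) bump_nonneg[of "\<delta> - f x"] bump_pos[of "\<delta> - f x"]
    by (cases "f x = 0") (auto intro: add_pos_nonneg)
  then show ?thesis unfolding pos_inv_def
    by (intro smooth_on_divide smooth_on_add smooth_on_power smooth_on_bump_compose smooth_on_diff smooth_on_const assms)
qed

lemma inner_vec_Basis:
  fixes b :: "complex ^ 'j::finite"
  assumes "b \<in> Basis" obtains j e where "\<And>x. x \<bullet> b = Re (x $ j) * Re e + Im (x $ j) * Im e"
proof -
  from assms obtain j e where "b = axis j e" by (auto simp: Basis_vec_def)
  then have "x \<bullet> b = Re (x $ j) * Re e + Im (x $ j) * Im e" for x by (simp add: inner_axis inner_complex_def)
  then show ?thesis by (rule that)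
qed

context typeII_data
begin

text \<open>Preferred to the squared norm because on embedded shell points it is a constant multiple
  of |w|^2, see \<open>posform_emb\<close>. So it recovers the modulus of w there while remaining
  invariant and positive definite.\<close>

definition posform :: "complex ^ ('l + 'k) \<Rightarrow> real" where
  "posform z = (\<Sum>i\<in>UNIV. (cmod (z $ Inl i))\<^sup>2) + shell_form c z"

lemma posform_pos: assumes "z \<noteq> 0" shows "posform z > 0"
proof -
  from assms obtain j where j: "z $ j \<noteq> 0" by (auto simp: vec_eq_iff)
  have c0: "real_of_int (c r) \<ge> 1" for r using c_ge[of r] by simp
  have nn: "0 \<le> (\<Sum>i\<in>UNIV. (cmod (z $ Inl i))\<^sup>2)" "0 \<le> shell_form c z"
    unfolding shell_form_def using c0 by (auto intro!: sum_nonneg mult_nonneg_nonneg intro: order_trans[OF zero_le_one])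
  show ?thesis
  proof (cases j)
    case (Inl i)
    have "0 < (cmod (z $ Inl i))\<^sup>2" using j Inl by simp
    also have "\<dots> \<le> (\<Sum>i\<in>UNIV. (cmod (z $ Inl i))\<^sup>2)" by (rule member_le_sum) auto
    finally show ?thesis using nn unfolding posform_def by linarith
  next
    case (Inr r)
    have "0 < real_of_int (c r) * (cmod (z $ Inr r))\<^sup>2" using j Inr c0[of r] by simp
    also have "\<dots> \<le> shell_form c z" unfolding shell_form_def
      using c0 by (intro member_le_sum) (auto intro!: mult_nonneg_nonneg intro: order_trans[OF zero_le_one])
    finally show ?thesis using nn unfolding posform_def by linarith
  qed
qed

lemma smooth_on_posform: "smooth_on U posform"
  unfolding posform_def shell_form_def cmod_power2
  by (intro smooth_on_add smooth_on_sum smooth_on_mult smooth_on_const smooth_on_power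
      smooth_on_bounded_linear[OF bounded_linear_Re_nth] smooth_on_bounded_linear[OF bounded_linear_Im_nth])

lemma posform_scale: "posform (r *\<^sub>R z) = r\<^sup>2 * posform z"
  by (simp add: posform_def shell_form_def power_mult_distrib sum_distrib_left distrib_left mult_ac)

lemma posform_act: "t \<in> torus \<Longrightarrow> posform (act A t z) = posform z"
  by (simp add: posform_def shell_form_def cmod_act)

text \<open>The exponent compensates the degree beta of \<open>mon\<close>, so the result has degree
  zero. Its modulus is constant on nonzero embedded shell points, so cutting off small moduli leaves
  those points untouched.\<close>

definition nmon :: "complex ^ ('l + 'k) \<Rightarrow> complex" where
  "nmon z = of_real (posform z powr (- \<beta> / 2)) * mon z"

lemma smooth_on_nmon: "smooth_on (- {0}) (\<lambda>z. Re (nmon z))" "smooth_on (- {0}) (\<lambda>z. Im (nmon z))"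
proof -
  have "smooth_on (- {0}) (\<lambda>z. Re (mon z))" "smooth_on (- {0}) (\<lambda>z. Im (mon z))"
    using chom_poly_mon by (auto simp: chom_poly_def intro: smooth_on_hom_poly)
  moreover have "smooth_on (- {0}) (\<lambda>z. posform z powr (- \<beta> / 2))"
    by (rule smooth_on_powr[OF smooth_on_posform]) (simp add: posform_pos)
  ultimately show "smooth_on (- {0}) (\<lambda>z. Re (nmon z))" "smooth_on (- {0}) (\<lambda>z. Im (nmon z))"
    by (auto simp: nmon_def intro: smooth_on_mult)
qed

lemma nmon_scale: assumes "r > 0" "z \<noteq> 0" shows "nmon (r *\<^sub>R z) = nmon z"
proof -
  have "mon (r *\<^sub>R z) = of_real (r ^ bn) * mon z"
    unfolding mon_def vector_scaleR_component scaleR_conv_of_real[where 'a=complex]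
    by (simp add: power_mult_distrib prod.distrib power_sum[symmetric] sum_mn)
  moreover have "posform (r *\<^sub>R z) powr (- \<beta> / 2) * r ^ bn = posform z powr (- \<beta> / 2)"
  proof -
    have "posform (r *\<^sub>R z) powr (- \<beta> / 2) = (r powr 2) powr (- \<beta> / 2) * posform z powr (- \<beta> / 2)"
      using assms posform_pos[OF assms(2)] by (simp add: posform_scale powr_mult)
    also have "(r powr 2) powr (- \<beta> / 2) = r powr (- real bn)" by (simp add: powr_powr real_bn)
    finally have "posform (r *\<^sub>R z) powr (- \<beta> / 2) * r ^ bn = (r powr (- real bn) * r powr real bn) * posform z powr (- \<beta> / 2)"
      using assms(1) by (simp add: powr_realpow mult_ac)
    also have "r powr (- real bn) * r powr real bn = 1" using assms(1) by (simp flip: powr_add)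
    finally show ?thesis by simp
  qed
  ultimately show ?thesis unfolding nmon_def by (metis mult.assoc of_real_mult)
qed

lemma nmon_act: "t \<in> torus \<Longrightarrow> nmon (act A t z) = chr t powi (- \<alpha>) * nmon z"
  by (simp add: nmon_def posform_act mon_act mult_ac)

text \<open>The constant modulus of \<open>nmon\<close> on nonzero embedded shell points, obtained
  by inserting \<open>mon_emb\<close> and \<open>posform_emb\<close>.\<close>

definition \<kappa> :: real where
  "\<kappa> = mon_const * ((\<alpha> + \<beta>) / \<beta>) powr (- \<beta> / 2)"

lemma kappa_pos: "\<kappa> > 0"
  unfolding \<kappa>_def using mon_const_pos alpha_pos beta_pos by simp

lemma posform_emb:
  assumes "p \<in> shell B" shows "posform (emb p) = (\<alpha> + \<beta>) / \<beta> * (cmod (p $ Inl ()))\<^sup>2"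
proof -
  have "(\<Sum>i\<in>UNIV. (cmod (emb p $ Inl i))\<^sup>2) = (\<Sum>i\<in>UNIV. m i / \<beta>) * (cmod (p $ Inl ()))\<^sup>2"
    unfolding cmod_emb_Inl sum_distrib_right by simp
  then have "posform (emb p) = (cmod (p $ Inl ()))\<^sup>2 + shell_form c p"
    by (simp only: posform_def sum_mb shell_form_emb mult_1_left)
  then show ?thesis using assms beta_pos by (simp add: shell_B_iff field_simps)
qed

lemma nmon_emb:
  assumes "p \<in> shell B" "p \<noteq> 0" shows "cmod (nmon (emb p)) = \<kappa>" "sgn (nmon (emb p)) = sgn (p $ Inl ()) ^ bn"
proof -
  let ?w = "p $ Inl ()"
  have w: "?w \<noteq> 0" using assms shell_B_zero by blast
  have ab: "real_of_int (\<alpha> + \<beta>) / \<beta> > 0" using alpha_pos beta_pos by simp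
  have pp: "posform (emb p) powr (- \<beta> / 2) = ((\<alpha> + \<beta>) / \<beta>) powr (- \<beta> / 2) * cmod ?w powr (- real bn)"
  proof -
    have "posform (emb p) powr (- \<beta> / 2) = ((\<alpha> + \<beta>) / \<beta>) powr (- \<beta> / 2) * ((cmod ?w)\<^sup>2) powr (- \<beta> / 2)"
      unfolding posform_emb[OF assms(1)] using ab w by (subst powr_mult) auto
    also have "((cmod ?w)\<^sup>2) powr (- \<beta> / 2) = (cmod ?w powr 2) powr (- \<beta> / 2)" using w by simp
    also have "\<dots> = cmod ?w powr (- real bn)" unfolding powr_powr real_bn by simp
    finally show ?thesis .
  qed
  have "cmod (nmon (emb p)) = posform (emb p) powr (- \<beta> / 2) * (mon_const * cmod ?w ^ bn)"
    using mon_const_pos by (simp add: nmon_def mon_emb norm_mult norm_power)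
  also have "\<dots> = \<kappa> * (cmod ?w powr (- real bn) * cmod ?w powr real bn)"
    unfolding pp \<kappa>_def using w by (simp add: powr_realpow)
  also have "\<dots> = \<kappa>" using w by (simp flip: powr_add)
  finally show "cmod (nmon (emb p)) = \<kappa>" .
  have "sgn (of_real (posform (emb p) powr (- \<beta> / 2)) :: complex) = 1"
  proof -
    have "posform (emb p) > 0" unfolding posform_emb[OF assms(1)] by (rule mult_pos_pos[OF ab]) (use w in simp)
    then show ?thesis by (simp add: sgn_of_real)
  qed
  moreover have "sgn (of_real mon_const :: complex) = 1" using mon_const_pos by (simp add: sgn_of_real)
  moreover have "sgn (?w ^ bn) = sgn ?w ^ bn" by (simp add: sgn_div_norm norm_power power_divide scaleR_conv_of_real power_mult_distrib power_inverse)
  ultimately show "sgn (nmon (emb p)) = sgn ?w ^ bn" by (simp add: nmon_def mon_emb sgn_mult)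
qed

definition vecB :: "complex \<Rightarrow> ('k \<Rightarrow> complex) \<Rightarrow> complex ^ (unit + 'k)" where
  "vecB w u = (\<chi> j. case j of Inl _ \<Rightarrow> w | Inr r \<Rightarrow> u r)"

lemma vecB_nth [simp]: "vecB w u $ Inl i = w" "vecB w u $ Inr r = u r"
  by (simp_all add: vecB_def)

text \<open>The quotient x / x' and v satisfy the relation of \<open>common_root\<close>, so the two
  arguments lie on one circle orbit. With v = 1 this compares two beta-th roots of the same phase;
  with v a value of \<open>chr\<close> it gives the invariance of the lift.\<close>

lemma invariant_phase:
  assumes "invariant B h" "cmod x = 1" "cmod x' = 1" "cmod v = 1" "x ^ bn = v powi (- \<alpha>) * x' ^ bn"
  shows "h (vecB (of_real r * x) (\<lambda>k. v powi c k * u k)) = h (vecB (of_real r * x') u)"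
proof -
  have nz: "x' \<noteq> 0" "v \<noteq> 0" using assms by auto
  define \<tau> where "\<tau> = x / x'"
  have "\<tau> powi \<beta> = v powi (- \<alpha>)" using assms(5) nz by (simp add: \<tau>_def power_divide flip: int_bn)
  then have "\<tau> powi \<beta> * v powi \<alpha> = 1" using nz by (simp add: power_int_minus)
  moreover have "cmod \<tau> = 1" using assms by (simp add: \<tau>_def norm_divide)
  ultimately obtain s where s: "cmod s = 1" "s powi (- \<alpha>) = \<tau>" "s powi \<beta> = v" using assms(4) by (rule common_root)
  have "act B (\<chi> _. s) (vecB (of_real r * x') u) = vecB (of_real r * x) (\<lambda>k. v powi c k * u k)"
    unfolding vec_eq_iff
  proof
    fix j show "act B (\<chi> _. s) (vecB (of_real r * x') u) $ j = vecB (of_real r * x) (\<lambda>k. v powi c k * u k) $ j"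
    proof (cases j)
      case (Inl i)
      then show ?thesis unfolding Inl act_B_Inl using s(2) nz by (simp add: \<tau>_def del: power_int_minus)
    next
      case (Inr k)
      show ?thesis unfolding Inr act_B_Inr using s(3) by simp
    qed
  qed
  moreover have "(\<chi> _. s) \<in> torus" using s(1) by (simp add: torus_def)
  ultimately show ?thesis using assms(1) unfolding invariant_def by metis
qed

text \<open>The constant inverts \<open>posform_emb\<close>, so that on embedded shell points this
  is the modulus of w.\<close>

definition rad :: "complex ^ ('l + 'k) \<Rightarrow> real" where
  "rad z = sqrt (\<beta> / (\<alpha> + \<beta>)) * posform z powr (1/2)"

text \<open>The \<open>\<beta>\<close>-th root of the phase of \<open>y\<close> has no global branch.  The half planes \<open>Re (\<i>\<^bsup>-k\<^esup> y) > 0\<close>, \<open>k < 4\<close>, cover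
  \<open>y \<noteq> 0\<close>, and \<open>branch_weight\<close> is a subordinate partition of unity times a cutoff vanishing near \<open>y = 0\<close>.
  The extra summand in its denominator vanishes on the support of the cutoff.\<close>

definition branch :: "nat \<Rightarrow> complex \<Rightarrow> complex" where
  "branch k y = cis (- (real k * pi / 2)) * y"

text \<open>Defined for every y thanks to \<open>pos_inv\<close>, but a root of the phase is only
  claimed where \<open>branch_bump k y\<close> is nonzero: there the real part exceeds \<kappa> / 4
  and \<open>pos_inv\<close> is the true reciprocal.\<close>

definition branch_root :: "nat \<Rightarrow> complex \<Rightarrow> complex" where
  "branch_root k y = cis (real k * pi / 2 / \<beta> + arctan (Im (branch k y) * pos_inv (\<kappa> / 4) (Re (branch k y))) / \<beta>)"

definition branch_map :: "nat \<Rightarrow> complex ^ ('l + 'k) \<Rightarrow> complex ^ (unit + 'k)" where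
  "branch_map k z = vecB (of_real (rad z) * branch_root k (nmon z)) (\<lambda>r. z $ Inr r)"

definition branch_bump :: "nat \<Rightarrow> complex \<Rightarrow> real" where
  "branch_bump k y = bump (Re (branch k y) - \<kappa> / 4)"

definition branch_weight :: "nat \<Rightarrow> complex \<Rightarrow> real" where
  "branch_weight k y = (bump ((cmod y)\<^sup>2 - \<kappa>\<^sup>2 / 4) * branch_bump k y) /
     ((\<Sum>l<4. branch_bump l y) + bump (\<kappa>\<^sup>2 / 4 - (cmod y)\<^sup>2))"

text \<open>If all four rotated real parts were at most \<kappa> / 4, then so would be the absolute
  values of the real and imaginary parts of y, whence |y|^2 would be at most one eighth of the
  square of \<kappa>.\<close>

lemma branch_bump_cover: assumes "\<kappa>\<^sup>2 / 4 \<le> (cmod y)\<^sup>2" shows "(\<Sum>l<4. branch_bump l y) > 0"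
proof -
  have cis: "cis (- (real 0 * pi / 2)) = 1" "cis (- (real 1 * pi / 2)) = - \<i>" "cis (- (real 2 * pi / 2)) = - 1" "cis (- (real 3 * pi / 2)) = \<i>"
  proof -
    show "cis (- (real 1 * pi / 2)) = - \<i>" by (simp add: complex_eq_iff)
    have "cis (- (real 3 * pi / 2)) = cis (- pi) * cis (- (pi / 2))"
      unfolding cis_mult by (rule arg_cong[of _ _ cis]) simp
    then show "cis (- (real 3 * pi / 2)) = \<i>" by (simp add: complex_eq_iff)
  qed (auto simp: complex_eq_iff)
  have R: "Re (branch 0 y) = Re y" "Re (branch 1 y) = Im y" "Re (branch 2 y) = - Re y" "Re (branch 3 y) = - Im y"
    unfolding branch_def cis by simp_all
  have "\<exists>l<4. Re (branch l y) > \<kappa> / 4"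
  proof (rule ccontr)
    assume "\<not> (\<exists>l<4. Re (branch l y) > \<kappa> / 4)"
    then have "Re (branch l y) \<le> \<kappa> / 4" if "l < 4" for l using that by (meson not_le)
    from this[of 0] this[of 1] this[of 2] this[of 3]
    have "\<bar>Re y\<bar> \<le> \<kappa> / 4" "\<bar>Im y\<bar> \<le> \<kappa> / 4" unfolding R by auto
    then have "(Re y)\<^sup>2 \<le> (\<kappa> / 4)\<^sup>2" "(Im y)\<^sup>2 \<le> (\<kappa> / 4)\<^sup>2" using kappa_pos by (auto simp: abs_le_square_iff[symmetric])
    then have "(cmod y)\<^sup>2 \<le> \<kappa>\<^sup>2 / 8" by (simp add: cmod_power2 power_divide)
    moreover have "\<kappa>\<^sup>2 > 0" using kappa_pos by simp
    ultimately show False using assms by linarith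
  qed
  then obtain l where l: "l < 4" "Re (branch l y) > \<kappa> / 4" by blast
  then have "0 < branch_bump l y" by (simp add: branch_bump_def bump_pos)
  also have "\<dots> \<le> (\<Sum>l<4. branch_bump l y)" using l(1) by (intro member_le_sum) (auto simp: branch_bump_def bump_nonneg)
  finally show ?thesis .
qed

lemma branch_denominator_pos: "(\<Sum>l<4. branch_bump l y) + bump (\<kappa>\<^sup>2 / 4 - (cmod y)\<^sup>2) > 0"
proof (cases "\<kappa>\<^sup>2 / 4 \<le> (cmod y)\<^sup>2")
  case True
  then show ?thesis using branch_bump_cover bump_nonneg add_pos_nonneg by blast
next
  case False
  then show ?thesis by (intro add_nonneg_pos sum_nonneg bump_pos) (auto simp: branch_bump_def bump_nonneg)
qed

lemma branch_root_power:
  assumes "branch_bump k y \<noteq> 0" shows "branch_root k y ^ bn = sgn y"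
proof -
  let ?x = "branch k y"
  have x: "Re ?x > \<kappa> / 4" using assms bump_zero unfolding branch_bump_def by (metis diff_gt_0_iff_gt not_le)
  then have x0: "Re ?x > 0" using kappa_pos by simp
  have inv: "pos_inv (\<kappa> / 4) (Re ?x) = 1 / Re ?x" using x kappa_pos by (intro pos_inv_eq) auto
  have "real bn * (real k * pi / 2 / \<beta> + arctan (Im ?x * (1 / Re ?x)) / \<beta>) = real k * pi / 2 + arctan (Im ?x / Re ?x)"
    using beta_pos by (simp add: real_bn distrib_left)
  then have "branch_root k y ^ bn = cis (real k * pi / 2 + arctan (Im ?x / Re ?x))"
    by (simp only: branch_root_def Complex.DeMoivre inv)
  also have "\<dots> = cis (real k * pi / 2) * sgn ?x" by (simp add: sgn_eq_cis_arctan[OF x0] cis_mult)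
  also have "\<dots> = sgn y" by (simp add: branch_def sgn_mult sgn_div_norm[of "cis _"] cis_mult flip: mult.assoc)
  finally show ?thesis .
qed

lemma cis_Arg_power: assumes "y \<noteq> 0" shows "cis (Arg y / \<beta>) ^ bn = sgn y"
  using beta_pos assms by (simp add: Complex.DeMoivre real_bn cis_Arg)

definition flat_ext :: "(complex ^ (unit + 'k) \<Rightarrow> real) \<Rightarrow> complex ^ ('l + 'k) \<Rightarrow> real" where
  "flat_ext h z = (\<Sum>k<4. if z = 0 then 0 else branch_weight k (nmon z) * h (branch_map k z))"

text \<open>By invariance all contributing branches give h the same value, and the partition of
  unity sums to one. Smoothness is read off the definition of \<open>flat_ext\<close>, whereas
  invariance and restriction to the shell are read off this formula with the discontinuous principal
  argument.\<close>

lemma flat_ext_eq: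
  assumes "invariant B h" "z \<noteq> 0"
  shows "flat_ext h z = bump ((cmod (nmon z))\<^sup>2 - \<kappa>\<^sup>2 / 4) * h (vecB (of_real (rad z) * cis (Arg (nmon z) / \<beta>)) (\<lambda>r. z $ Inr r))"
proof (cases "(cmod (nmon z))\<^sup>2 \<le> \<kappa>\<^sup>2 / 4")
  case True
  then have b: "bump ((cmod (nmon z))\<^sup>2 - \<kappa>\<^sup>2 / 4) = 0" by (intro bump_zero) simp
  show ?thesis unfolding flat_ext_def branch_weight_def b by (simp add: assms(2))
next
  case False
  let ?y = "nmon z" and ?H = "h (vecB (of_real (rad z) * cis (Arg (nmon z) / \<beta>)) (\<lambda>r. z $ Inr r))"
  have y: "?y \<noteq> 0" using False kappa_pos by auto
  have E: "(\<Sum>l<4. branch_bump l ?y) > 0" using False by (intro branch_bump_cover) simp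
  have "branch_bump k ?y * h (branch_map k z) = branch_bump k ?y * ?H" for k
  proof (cases "branch_bump k ?y = 0")
    case b: False
    have "h (branch_map k z) = h (vecB (of_real (rad z) * branch_root k ?y) (\<lambda>r. 1 powi c r * z $ Inr r))"
      by (simp add: branch_map_def)
    also have "\<dots> = ?H"
      by (rule invariant_phase[OF assms(1)]) (simp_all add: branch_root_power[OF b] cis_Arg_power[OF y], simp add: branch_root_def)
    finally show ?thesis by simp
  qed simp
  note eq = this
  have z0: "bump (\<kappa>\<^sup>2 / 4 - (cmod ?y)\<^sup>2) = 0" using False by (intro bump_zero) simp
  have "branch_weight k ?y * h (branch_map k z) = bump ((cmod ?y)\<^sup>2 - \<kappa>\<^sup>2 / 4) * ?H / (\<Sum>l<4. branch_bump l ?y) * branch_bump k ?y" for k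
  proof -
    have "branch_weight k ?y * h (branch_map k z)
        = bump ((cmod ?y)\<^sup>2 - \<kappa>\<^sup>2 / 4) * (branch_bump k ?y * h (branch_map k z)) / (\<Sum>l<4. branch_bump l ?y)"
      unfolding branch_weight_def z0 by simp
    then show ?thesis unfolding eq by simp
  qed
  then have "flat_ext h z = (\<Sum>k<4. bump ((cmod ?y)\<^sup>2 - \<kappa>\<^sup>2 / 4) * ?H / (\<Sum>l<4. branch_bump l ?y) * branch_bump k ?y)"
    using assms(2) by (simp add: flat_ext_def)
  also have "\<dots> = bump ((cmod ?y)\<^sup>2 - \<kappa>\<^sup>2 / 4) * ?H"
    unfolding sum_distrib_left[symmetric] using E by simp
  finally show ?thesis .
qed

text \<open>A torus element multiplies the phase of \<open>nmon\<close> and the last coordinates by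
  matching powers of \<open>chr\<close>, the situation of \<open>invariant_phase\<close>. Where
  \<open>nmon\<close> vanishes the cutoff is zero.\<close>

lemma flat_ext_invariant: assumes "invariant B h" shows "invariant A (flat_ext h)"
  unfolding invariant_def
proof (intro ballI allI)
  fix t :: "complex ^ 'l" and z :: "complex ^ ('l + 'k)" assume t: "t \<in> torus"
  show "flat_ext h (act A t z) = flat_ext h z"
  proof (cases "z = 0")
    case True
    then show ?thesis using linear_0[OF linear_act, of A t] by simp
  next
    case False
    have nz: "act A t z \<noteq> 0" using False norm_act[OF t, of A z] by auto
    let ?v = "chr t"
    have v: "cmod ?v = 1" using t by (rule cmod_chr)
    have y: "nmon (act A t z) = ?v powi (- \<alpha>) * nmon z" by (rule nmon_act[OF t])
    have cy: "cmod (nmon (act A t z)) = cmod (nmon z)" unfolding y using v by (simp add: norm_mult norm_power_int)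
    have rad: "rad (act A t z) = rad z" by (simp add: rad_def posform_act[OF t])
    show ?thesis
    proof (cases "nmon z = 0")
      case True
      then show ?thesis using kappa_pos by (simp add: flat_ext_eq[OF assms False] flat_ext_eq[OF assms nz] cy bump_zero)
    next
      case y0: False
      then have "nmon (act A t z) \<noteq> 0" using cy by auto
      then have "cis (Arg (nmon (act A t z)) / \<beta>) ^ bn = sgn (nmon (act A t z))" by (rule cis_Arg_power)
      also have "\<dots> = ?v powi (- \<alpha>) * sgn (nmon z)"
        unfolding y using v by (simp add: sgn_mult sgn_div_norm[of "chr t powi _"] norm_power_int del: power_int_minus)
      finally have "h (vecB (of_real (rad z) * cis (Arg (nmon (act A t z)) / \<beta>)) (\<lambda>r. ?v powi c r * z $ Inr r))
          = h (vecB (of_real (rad z) * cis (Arg (nmon z) / \<beta>)) (\<lambda>r. z $ Inr r))"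
        by (intro invariant_phase[OF assms] v) (simp_all add: cis_Arg_power[OF y0])
      then show ?thesis by (simp add: flat_ext_eq[OF assms False] flat_ext_eq[OF assms nz] cy rad act_A_Inr)
    qed
  qed
qed

text \<open>On nonzero shell points the modulus of \<open>nmon\<close> is \<kappa>, so the cutoff
  takes one positive value, which \<open>extend_flat\<close> divides out.\<close>

lemma flat_ext_emb:
  assumes h: "invariant B h" "h 0 = 0" and p: "p \<in> shell B"
  shows "flat_ext h (emb p) = bump (3 * \<kappa>\<^sup>2 / 4) * h p"
proof (cases "p = 0")
  case True
  then show ?thesis using h linear_0[OF linear_emb] by (simp add: flat_ext_def)
next
  case False
  let ?w = "p $ Inl ()"
  have w: "?w \<noteq> 0" using False p shell_B_zero by blast
  have e0: "emb p \<noteq> 0" using False norm_emb[of p] by auto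
  have "rad (emb p) = sqrt (\<beta> / (\<alpha> + \<beta>)) * sqrt ((\<alpha> + \<beta>) / \<beta> * (cmod ?w)\<^sup>2)"
    unfolding rad_def posform_emb[OF p] using alpha_pos beta_pos by (subst powr_half_sqrt) auto
  also have "\<dots> = sqrt (\<beta> / (\<alpha> + \<beta>) * ((\<alpha> + \<beta>) / \<beta> * (cmod ?w)\<^sup>2))" by (simp only: real_sqrt_mult)
  also have "\<beta> / (\<alpha> + \<beta>) * ((\<alpha> + \<beta>) / \<beta> * (cmod ?w)\<^sup>2) = (cmod ?w)\<^sup>2" using alpha_pos beta_pos by (simp add: field_simps flip: of_int_add)
  finally have rad: "rad (emb p) = cmod ?w" by simp
  have y0: "nmon (emb p) \<noteq> 0" using nmon_emb(1)[OF p False] kappa_pos by auto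
  have "h (vecB (of_real (rad (emb p)) * cis (Arg (nmon (emb p)) / \<beta>)) (\<lambda>r. 1 powi c r * emb p $ Inr r))
      = h (vecB (of_real (rad (emb p)) * sgn ?w) (\<lambda>r. emb p $ Inr r))"
    using w by (intro invariant_phase[OF h(1)]) (simp_all add: cis_Arg_power[OF y0] nmon_emb(2)[OF p False] norm_sgn)
  moreover have "vecB (of_real (rad (emb p)) * sgn ?w) (\<lambda>r. emb p $ Inr r) = p"
    unfolding vec_eq_iff
  proof
    fix j show "vecB (of_real (rad (emb p)) * sgn ?w) (\<lambda>r. emb p $ Inr r) $ j = p $ j"
      using w by (cases j) (simp_all add: rad emb_Inr sgn_div_norm scaleR_conv_of_real)
  qed
  ultimately show ?thesis unfolding flat_ext_eq[OF h(1) e0] nmon_emb(1)[OF p False] by simp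
qed

lemma smooth_on_branch: "smooth_on (- {0}) (\<lambda>z. Re (branch k (nmon z)))" "smooth_on (- {0}) (\<lambda>z. Im (branch k (nmon z)))"
  unfolding branch_def times_complex.sel cis.sel
  by (intro smooth_on_diff smooth_on_add smooth_on_mult smooth_on_const smooth_on_nmon)+

text \<open>As \<open>nmon\<close> has degree zero and \<open>rad\<close> degree one, the weights
  have degree zero and the components of \<open>branch_map\<close> degree one, as
  \<open>flat_compose\<close> requires.\<close>

lemma smooth_on_flat_ext: assumes "flat h" shows "smooth_on UNIV (flat_ext h)"
  unfolding flat_ext_def
proof (rule smooth_on_sum, rule flat_compose[OF _ _ _ _ assms, where d=0])
  fix k
  have op: "open (- {0 :: complex ^ ('l + 'k)})" by auto
  show "smooth_on (- {0}) (\<lambda>z. branch_weight k (nmon z))"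
    unfolding branch_weight_def branch_bump_def cmod_power2
    by (intro smooth_on_divide smooth_on_mult smooth_on_bump_compose smooth_on_diff smooth_on_add smooth_on_sum
        smooth_on_power smooth_on_const smooth_on_branch smooth_on_nmon op)
      (use branch_denominator_pos in \<open>simp add: branch_bump_def cmod_power2\<close>)
  show "homog 0 (\<lambda>z. branch_weight k (nmon z))" by (simp add: homog_def nmon_scale)
  define \<theta> where "\<theta> = (\<lambda>z. real k * pi / 2 / \<beta> + arctan (Im (branch k (nmon z)) * pos_inv (\<kappa> / 4) (Re (branch k (nmon z)))) * (1 / \<beta>))"
  have \<theta>: "smooth_on (- {0}) \<theta>" unfolding \<theta>_def using kappa_pos
    by (intro smooth_on_add smooth_on_const smooth_on_mult smooth_on_arctan smooth_on_branch smooth_on_pos_inv op) auto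
  have \<theta>h: "\<theta> (r *\<^sub>R z) = \<theta> z" if "r > 0" "z \<noteq> 0" for r z using that by (simp add: \<theta>_def nmon_scale)
  have rad: "smooth_on (- {0}) rad" unfolding rad_def
    by (intro smooth_on_mult smooth_on_const smooth_on_powr smooth_on_posform) (simp add: posform_pos)
  have radh: "rad (r *\<^sub>R z) = r * rad z" if "r > 0" "z \<noteq> 0" for r z
  proof -
    have "(r\<^sup>2 * posform z) powr (1/2) = r * posform z powr (1/2)"
      using that posform_pos[OF that(2)] by (simp add: powr_half_sqrt real_sqrt_mult)
    then show ?thesis by (simp add: rad_def posform_scale)
  qed
  have comp: "smooth_on (- {0}) (\<lambda>z. Re (branch_map k z $ j)) \<and> smooth_on (- {0}) (\<lambda>z. Im (branch_map k z $ j)) \<and>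
      (\<forall>r z. r > 0 \<longrightarrow> z \<noteq> 0 \<longrightarrow> branch_map k (r *\<^sub>R z) $ j = of_real r * branch_map k z $ j)" for j
  proof (cases j)
    case (Inl i)
    have e: "branch_map k z $ j = of_real (rad z) * cis (\<theta> z)" for z by (simp add: Inl branch_map_def branch_root_def \<theta>_def)
    have "smooth_on (- {0}) (\<lambda>z. rad z * cos (\<theta> z))" "smooth_on (- {0}) (\<lambda>z. rad z * sin (\<theta> z))"
      by (intro smooth_on_mult rad smooth_on_cos smooth_on_sin \<theta>)+
    then show ?thesis unfolding e using \<theta>h radh by simp
  next
    case (Inr r)
    have e: "branch_map k z $ j = z $ Inr r" for z by (simp add: Inr branch_map_def)
    show ?thesis unfolding e
      by (auto intro: smooth_on_bounded_linear[OF bounded_linear_Re_nth] smooth_on_bounded_linear[OF bounded_linear_Im_nth] simp: scaleR_conv_of_real[where 'a=complex])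
  qed
  fix b :: "complex ^ (unit + 'k)" assume "b \<in> Basis"
  then obtain j e where je: "\<And>x. x \<bullet> b = Re (x $ j) * Re e + Im (x $ j) * Im e" using inner_vec_Basis by blast
  show "smooth_on (- {0}) (\<lambda>z. branch_map k z \<bullet> b)" unfolding je
    using comp[of j] by (intro smooth_on_add smooth_on_mult smooth_on_const) auto
  show "homog 1 (\<lambda>z. branch_map k z \<bullet> b)" unfolding je homog_def
    using comp[of j] by (auto simp: algebra_simps)
qed

lemma extend_flat:
  assumes "flat h" "invariant B h"
  shows "\<exists>f. smooth_on UNIV f \<and> invariant A f \<and> (\<forall>p\<in>shell B. f (emb p) = h p)"
proof -
  obtain C where "\<And>z. norm z \<le> 1 \<Longrightarrow> \<bar>h z\<bar> \<le> C * norm z ^ 1" using assms(1) unfolding flat_def by blast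
  from this[of 0] have h0: "h 0 = 0" by simp
  have pos: "bump (3 * \<kappa>\<^sup>2 / 4) > 0" using kappa_pos by (intro bump_pos) simp
  show ?thesis
  proof (intro exI[of _ "\<lambda>z. (1 / bump (3 * \<kappa>\<^sup>2 / 4)) * flat_ext h z"] conjI ballI)
    show "smooth_on UNIV (\<lambda>z. (1 / bump (3 * \<kappa>\<^sup>2 / 4)) * flat_ext h z)"
      by (intro smooth_on_mult smooth_on_const smooth_on_flat_ext assms)
    show "invariant A (\<lambda>z. (1 / bump (3 * \<kappa>\<^sup>2 / 4)) * flat_ext h z)"
      using flat_ext_invariant[OF assms(2)] by (simp add: invariant_def)
    show "(1 / bump (3 * \<kappa>\<^sup>2 / 4)) * flat_ext h (emb p) = h p" if "p \<in> shell B" for p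
      using flat_ext_emb[OF assms(2) h0 that] pos by simp
  qed
qed

section \<open>Taylor polynomials of invariant functions and the final assembly\<close>

lemma hom_poly_tay: "hom_poly d (\<lambda>z :: complex ^ 'j::finite. tay d g z x)"
proof (induction d arbitrary: g)
  case 0
  show ?case by (simp add: hom_poly_const)
next
  case (Suc d)
  have "hom_poly 1 (\<lambda>z :: complex ^ 'j. z \<bullet> b)" if b: "b \<in> Basis" for b
  proof -
    obtain j e where "\<And>x. x \<bullet> b = Re (x $ j) * Re e + Im (x $ j) * Im e" using inner_vec_Basis[OF b] by blast
    then have "(\<lambda>z :: complex ^ 'j. z \<bullet> b) = (\<lambda>z. Re e * Re (z $ j) + Im e * Im (z $ j))" by (simp add: fun_eq_iff mult.commute)
    then show ?thesis using hom_poly_add[OF hom_poly_cmult[OF hom_poly_Re] hom_poly_cmult[OF hom_poly_Im]] by simp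
  qed
  then have "hom_poly (1 + d) (\<lambda>z :: complex ^ 'j. tay (Suc d) g z x)"
    unfolding tay.simps by (intro hom_poly_sum hom_poly_mult Suc) auto
  then show ?case by simp
qed

text \<open>The action is linear, so g has the same restriction to the lines through z and its
  translate; \<open>tay_eq_deriv\<close> reads the Taylor polynomial off this restriction.\<close>

lemma invariant_tay:
  fixes g :: "complex ^ 'j::finite \<Rightarrow> real" and M :: "('i::finite, 'j) wmatrix"
  assumes "smooth_on UNIV g" "invariant M g" shows "invariant M (\<lambda>z. tay d g z 0)"
  unfolding invariant_def
proof (intro ballI allI)
  fix t :: "complex ^ 'i" and z :: "complex ^ 'j" assume t: "t \<in> torus"
  have "g (r *\<^sub>R act M t z) = g (r *\<^sub>R z)" for r
    using assms(2) t linear_scale[OF linear_act, of M t r z] unfolding invariant_def by metis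
  then have "(deriv ^^ d) (\<lambda>r. g (r *\<^sub>R act M t z)) 0 = (deriv ^^ d) (\<lambda>r. g (r *\<^sub>R z)) 0" by simp
  then show "tay d g (act M t z) 0 = tay d g z 0" unfolding tay_eq_deriv[OF assms(1)] by simp
qed

theorem extend_smooth:
  assumes g: "smooth_on UNIV g" "invariant B g"
  shows "\<exists>f. smooth_on UNIV f \<and> invariant A f \<and> (\<forall>p\<in>shell B. f (emb p) = g p)"
proof -
  define G where "G = (\<lambda>d z. (1 / fact d) * tay d g z 0)"
  have "hom_poly d (G d)" for d unfolding G_def by (rule hom_poly_cmult[OF hom_poly_tay])
  moreover have "invariant B (G d)" for d
    unfolding G_def using invariant_tay[OF g, of d] by (simp add: invariant_def)
  ultimately have "\<forall>d. \<exists>f. hom_poly d f \<and> invariant A f \<and> (\<forall>x. f (emb x) = G d x)" using lift_hom_poly by blast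
  then obtain f where f: "\<And>d. hom_poly d (f d)" "\<And>d. invariant A (f d)" "\<And>d x. f d (emb x) = G d x" by metis
  obtain F where F: "smooth_on UNIV F" "\<And>n. \<exists>C. \<forall>z. norm z \<le> 1 \<longrightarrow> \<bar>F z - (\<Sum>d<n. f d z)\<bar> \<le> C * norm z ^ n"
    "\<And>z z'. norm z = norm z' \<Longrightarrow> (\<And>d. f d z = f d z') \<Longrightarrow> F z = F z'"
    by (rule borel_lemma[of f, OF smooth_on_hom_poly[OF f(1)] hom_poly_scale[OF f(1)]]) blast
  have FA: "invariant A F" unfolding invariant_def
    using f(2) by (intro ballI allI F(3)) (auto simp: norm_act invariant_def)
  \<comment> \<open>Since \<open>emb\<close> preserves norms and \<open>f d\<close> restricts to the
    d-th Taylor polynomial of g, the Borel estimate for F at \<open>emb p\<close> and the Taylor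
    estimate for g at p concern the same polynomial and the same power of
    \<open>norm p\<close>.\<close>
  define h where "h = (\<lambda>p. g p - F (emb p))"
  have "flat h" unfolding flat_def
  proof (intro conjI allI)
    show "smooth_on UNIV h" unfolding h_def by (intro smooth_on_diff g smooth_on_emb F)
    fix N
    obtain C1 where C1: "\<And>z. norm z \<le> 1 \<Longrightarrow> \<bar>F z - (\<Sum>d<N. f d z)\<bar> \<le> C1 * norm z ^ N" using F(2) by blast
    obtain C2 where C2: "\<And>z. norm z \<le> 1 \<Longrightarrow> \<bar>g z - (\<Sum>d<N. tay d g z 0 / fact d)\<bar> \<le> C2 * norm z ^ N"
      using taylor_expansion[OF g(1)] by blast
    have "\<bar>h p\<bar> \<le> (C1 + C2) * norm p ^ N" if "norm p \<le> 1" for p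
    proof -
      have "\<bar>F (emb p) - (\<Sum>d<N. G d p)\<bar> \<le> C1 * norm p ^ N" using C1[of "emb p"] that by (simp add: norm_emb f(3))
      moreover have "\<bar>g p - (\<Sum>d<N. G d p)\<bar> \<le> C2 * norm p ^ N" using C2[OF that] by (simp add: G_def)
      ultimately show ?thesis unfolding h_def distrib_right by linarith
    qed
    then show "\<exists>C. \<forall>z. norm z \<le> 1 \<longrightarrow> \<bar>h z\<bar> \<le> C * norm z ^ N" by blast
  qed
  moreover have "invariant B h" using g(2) invariant_emb[OF FA] by (simp add: h_def invariant_def)
  ultimately obtain f' where f': "smooth_on UNIV f'" "invariant A f'" "\<forall>p\<in>shell B. f' (emb p) = h p"
    using extend_flat by blast
  show ?thesis
  proof (intro exI[of _ "\<lambda>z. F z + f' z"] conjI)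
    show "smooth_on UNIV (\<lambda>z. F z + f' z)" by (intro smooth_on_add F f')
    show "invariant A (\<lambda>z. F z + f' z)" using FA f'(2) by (simp add: invariant_def)
  qed (use f'(3) in \<open>simp add: h_def\<close>)
qed

theorem graded_regular_quot_map: "graded_regular_symplectomorphism A B quot_map"
  unfolding graded_regular_symplectomorphism_def symplectomorphism_def smooth_iff_smooth_on
proof (intro conjI allI impI homeomorphic_quot_map)
  fix g assume "smooth_on UNIV g \<and> invariant B g"
  then show "\<exists>f. smooth_on UNIV f \<and> invariant A f \<and> pb_rel A B quot_map f g"
    using extend_smooth[of g] pb_rel_iff by blast
next
  fix f assume "smooth_on UNIV f \<and> invariant A f"
  then show "\<exists>g. smooth_on UNIV g \<and> invariant B g \<and> pb_rel A B quot_map f g"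
    using smooth_on_emb[of f] invariant_emb[of f] pb_rel_iff[of f "\<lambda>p. f (emb p)"] by blast
next
  fix f1 f2 g1 g2
  assume *: "smooth_on UNIV f1 \<and> invariant A f1 \<and> smooth_on UNIV f2 \<and> invariant A f2 \<and>
    smooth_on UNIV g1 \<and> invariant B g1 \<and> smooth_on UNIV g2 \<and> invariant B g2 \<and>
    pb_rel A B quot_map f1 g1 \<and> pb_rel A B quot_map f2 g2"
  then have "\<forall>p\<in>shell B. f1 (emb p) = g1 p" "\<forall>p\<in>shell B. f2 (emb p) = g2 p" using pb_rel_iff by blast+
  then have "\<forall>p\<in>shell B. poisson f1 f2 (emb p) = poisson g1 g2 p" using * poisson_compat by blast
  moreover have "invariant A (poisson f1 f2)" "invariant B (poisson g1 g2)"
    by (rule invariant_poisson; use * in simp)+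
  ultimately show "pb_rel A B quot_map (poisson f1 f2) (poisson g1 g2)"
    by (simp only: pb_rel_iff)
next
  fix d g assume g: "hom_poly d g \<and> invariant B g"
  then obtain f where "hom_poly d f" "invariant A f" "\<forall>x. f (emb x) = g x" using lift_hom_poly by blast
  then show "\<exists>f. hom_poly d f \<and> invariant A f \<and> pb_rel A B quot_map f g" using g pb_rel_iff by blast
next
  fix d f assume "hom_poly d f \<and> invariant A f"
  then show "\<exists>g. hom_poly d g \<and> invariant B g \<and> pb_rel A B quot_map f g"
    using hom_poly_emb[of d f] invariant_emb[of f] pb_rel_iff[of f "\<lambda>p. f (emb p)"] by blast
qed

end

theorem theorem1p2:
  fixes a n :: "'l::finite \<Rightarrow> int" and c :: "'k::finite \<Rightarrow> int"
  assumes "\<forall>i. a i > 0" and "\<forall>i. n i > 0" and "\<forall>r. c r \<ge> 1"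
    and "faithful (typeII a n c)"
  shows "\<exists>F. graded_regular_symplectomorphism (typeII a n c) (Bmat a n c) F"
proof -
  interpret typeII_data a n c using assms by unfold_locales auto
  show ?thesis using graded_regular_quot_map by blast
qed

end
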